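(* For every integer $n\ge 0$ and every $t\in\mathbb{F}_2^{n+1}$, the projective dimension of the toric ring $R(n,t)=S(n)/I_{G_n^t}$ as a module over $S(n)$ is $$\operatorname{pd}_{S(n)}R(n,t)=n+1.$$
   Context: Throughout, $k$ is a field. Ladder-like structures. For $n\ge 0$ and $t=(t_1,\dots,t_{n+1})\in\mathbb{F}_2^{n+1}$, $L_n^t$ is a partially filled array with $\lfloor n/2\rfloor+2$ rows (numbered top to bottom) and $\lceil n/2\rceil+2$ columns (numbered left to right); its nonzero entries are the variables $x_0,x_2,x_3,\dots,x_{2n+4}$ (there is no $x_1$), each occurring exactly once, all other positions being empty. It is defined recursively, with $\widehat t=(t_1,\dots,t_n)$: - $L_0^t$ has first row $x_0,x_2$ and second row $x_3,x_4$ (for both values of $t$). - $L_1^t$ has first row $x_0,x_2,x_5$ and second row $x_3,x_4,x_6$ (for all $t$). - For $n\ge 2$ even, $L_n^t$ is $L_{n-1}^{\widehat t}$ with a new bottom row added whose only nonzero entries are $x_{2n+4}$, in the last column, and $x_{2n+3}$, in the column containing the first (if $t_{n+1}=0$) or the second (if $t_{n+1}=1$) nonzero entry, from left to right, of the row immediately above the new row. - For $n\ge 3$ odd, $L_n^t$ is $L_{n-1}^{\widehat t}$ with a new rightmost column added whose only nonzero entries are $x_{2n+4}$, in the last row, and $x_{2n+3}$, in the row containing the first (if $t_{n+1}=0$) or the second (if $t_{n+1}=1$) nonzero entry, from top to bottom, of the column immediately to the left of the new column. Graphs and toric rings. $G_n^t$ is the bipartite graph with one vertex for each row and one vertex for each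 column of $L_n^t$, and, for each nonzero entry $x_j$ of $L_n^t$, one edge (called $x_j$) joining the vertex of its row to the vertex of its column. Let $V$ be its vertex set, $S(n)=k[x_0,x_2,x_3,\dots,x_{2n+4}]$ the polynomial ring on the edges, and $I_{G_n^t}$ (the toric ideal) the kernel of the $k$-algebra homomorphism $S(n)\to k[V]$ sending each edge to the product of its two endpoints. The toric ring is $R(n,t)=S(n)/I_{G_n^t}$. *)

theory Defs
  imports "HOL-Algebra.Module" "HOL-Algebra.QuotRing" "HOL-Library.Poly_Mapping" "HOL-Library.Z2"
    "HOL-Library.Extended_Nat"
begin

section \<open>Projective dimension\<close>

definition module_hom ::
  "('r, 'x) ring_scheme \<Rightarrow> ('r, 'a, 'y) module_scheme \<Rightarrow> ('r, 'b, 'z) module_scheme \<Rightarrow> ('a \<Rightarrow> 'b) set"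
  where "module_hom R M N =
    {h \<in> carrier M \<rightarrow> carrier N.
      (\<forall>x\<in>carrier M. \<forall>y\<in>carrier M. h (x \<oplus>\<^bsub>M\<^esub> y) = h x \<oplus>\<^bsub>N\<^esub> h y) \<and>
      (\<forall>r\<in>carrier R. \<forall>x\<in>carrier M. h (r \<odot>\<^bsub>M\<^esub> x) = r \<odot>\<^bsub>N\<^esub> h x)}"

text \<open>The record type of modules extends that of rings; the multiplicative fields play no role
  for a module and are filled with arbitrary values.\<close>

definition free_module :: "('r, 'x) ring_scheme \<Rightarrow> 'i set \<Rightarrow> ('r, 'i \<Rightarrow> 'r) module"
  where "free_module R J =
    \<lparr>carrier = {f. (\<forall>i\<in>J. f i \<in> carrier R) \<and> (\<forall>i. i \<notin> J \<longrightarrow> f i = \<zero>\<^bsub>R\<^esub>) \<and> finite {i. f i \<noteq> \<zero>\<^bsub>R\<^esub>}},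
     mult = (\<lambda>f g. undefined), one = undefined,
     zero = (\<lambda>i. \<zero>\<^bsub>R\<^esub>), add = (\<lambda>f g i. f i \<oplus>\<^bsub>R\<^esub> g i),
     smult = (\<lambda>r f i. r \<otimes>\<^bsub>R\<^esub> f i)\<rparr>"

text \<open>A module is projective iff it is isomorphic to a direct summand of a free module.
  The basis may be taken inside the type of elements of \<open>P\<close>: if \<open>P\<close> is a direct summand
  of some free module, it is one of the free module on its own carrier.\<close>

definition projective_module :: "('r, 'x) ring_scheme \<Rightarrow> ('r, 'p, 'y) module_scheme \<Rightarrow> bool"
  where "projective_module R P \<longleftrightarrow> Module.module R P \<and>
    (\<exists>(J :: 'p set) \<phi> Q. \<phi> \<in> module_hom R P (free_module R J) \<and> inj_on \<phi> (carrier P) \<and>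
       submodule Q R (free_module R J) \<and>
       \<phi> ` carrier P \<inter> Q = {\<zero>\<^bsub>free_module R J\<^esub>} \<and>
       \<phi> ` carrier P <+>\<^bsub>free_module R J\<^esub> Q = carrier (free_module R J))"

text \<open>An augmented projective resolution
  \<open>\<dots> \<rightarrow> P 2 \<rightarrow> P 1 \<rightarrow> P 0 \<rightarrow> M \<rightarrow> 0\<close> with differentials \<open>d i : P (i + 1) \<rightarrow> P i\<close>.\<close>

definition projective_resolution ::
  "('r, 'x) ring_scheme \<Rightarrow> ('r, 'b, 'y) module_scheme \<Rightarrow> (nat \<Rightarrow> ('r, 'c) module) \<Rightarrow>
    (nat \<Rightarrow> 'c \<Rightarrow> 'c) \<Rightarrow> ('c \<Rightarrow> 'b) \<Rightarrow> bool"
  where "projective_resolution R M P d \<epsilon> \<longleftrightarrow>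
    (\<forall>i. projective_module R (P i)) \<and>
    (\<forall>i. d i \<in> module_hom R (P (Suc i)) (P i)) \<and>
    \<epsilon> \<in> module_hom R (P 0) M \<and>
    \<epsilon> ` carrier (P 0) = carrier M \<and>
    d 0 ` carrier (P 1) = a_kernel (P 0) M \<epsilon> \<and>
    (\<forall>i. d (Suc i) ` carrier (P (Suc (Suc i))) = a_kernel (P (Suc i)) (P i) (d i))"

text \<open>HOL cannot quantify over all types of module elements, so the terms of a resolution have
  elements in the type \<^typ>\<open>'b \<times> nat \<Rightarrow> 'r\<close>. This loses nothing: if \<open>M\<close> has a projective resolution
  of length \<open>n\<close> over any types, then (Schanuel) it has one whose first \<open>n\<close> terms are the free modules
  obtained by successively taking all elements of the previous kernel as a basis and whose last
  term is the remaining kernel. All these modules have cardinality at most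
  \<open>max |R| |M| \<aleph>\<^sub>0\<close>, hence isomorphic copies inside that type.
  The infimum of the empty set is \<open>\<infinity>\<close>; the zero module gets dimension \<open>0\<close>.\<close>

definition projective_dimension ::
  "('r, 'x) ring_scheme \<Rightarrow> ('r, 'b, 'y) module_scheme \<Rightarrow> enat"
  where "projective_dimension R M =
    Inf {enat n |n. \<exists>(P :: nat \<Rightarrow> ('r, 'b \<times> nat \<Rightarrow> 'r) module) d \<epsilon>.
      projective_resolution R M P d \<epsilon> \<and> (\<forall>i>n. carrier (P i) = {\<zero>\<^bsub>P i\<^esub>})}"

definition quotient_module :: "('r, 'x) ring_scheme \<Rightarrow> 'r set \<Rightarrow> ('r, 'r set) module"
  where "quotient_module R I =
    ring.extend (R Quot I) \<lparr>smult = (\<lambda>r X. (I +>\<^bsub>R\<^esub> r) \<otimes>\<^bsub>R Quot I\<^esub> X)\<rparr>"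


section \<open>Polynomial rings and toric ideals\<close>

text \<open>Monomials are finitely supported exponent functions, polynomials finitely supported
  functions from monomials to the coefficient field.\<close>

definition mpoly_ring :: "'v set \<Rightarrow> (('v \<Rightarrow>\<^sub>0 nat) \<Rightarrow>\<^sub>0 'k::field) ring"
  where "mpoly_ring V =
    \<lparr>carrier = {p. \<forall>m\<in>Poly_Mapping.keys p. Poly_Mapping.keys m \<subseteq> V},
     mult = (*), one = 1, zero = 0, add = (+)\<rparr>"

definition mpoly_var :: "'v \<Rightarrow> ('v \<Rightarrow>\<^sub>0 nat) \<Rightarrow>\<^sub>0 'k::field"
  where "mpoly_var v = Poly_Mapping.single (Poly_Mapping.single v 1) 1"

definition mpoly_const :: "'k \<Rightarrow> ('v \<Rightarrow>\<^sub>0 nat) \<Rightarrow>\<^sub>0 'k::field"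
  where "mpoly_const a = Poly_Mapping.single 0 a"

text \<open>The \<open>k\<close>-algebra homomorphism sending each variable \<open>e\<close> to \<open>f e\<close>.\<close>

definition mpoly_subst ::
  "('e \<Rightarrow> ('v \<Rightarrow>\<^sub>0 nat) \<Rightarrow>\<^sub>0 'k::field) \<Rightarrow> (('e \<Rightarrow>\<^sub>0 nat) \<Rightarrow>\<^sub>0 'k) \<Rightarrow> (('v \<Rightarrow>\<^sub>0 nat) \<Rightarrow>\<^sub>0 'k)"
  where "mpoly_subst f p =
    (\<Sum>m\<in>Poly_Mapping.keys p. mpoly_const (Poly_Mapping.lookup p m) *
      (\<Prod>e\<in>Poly_Mapping.keys m. f e ^ Poly_Mapping.lookup m e))"

text \<open>Here \<open>ends e\<close> is the set of the two endpoints of the edge \<open>e\<close>.\<close>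

definition toric_ideal :: "'v set \<Rightarrow> 'e set \<Rightarrow> ('e \<Rightarrow> 'v set) \<Rightarrow> (('e \<Rightarrow>\<^sub>0 nat) \<Rightarrow>\<^sub>0 'k::field) set"
  where "toric_ideal V E ends =
    a_kernel (mpoly_ring E) (mpoly_ring V) (mpoly_subst (\<lambda>e. \<Prod>v\<in>ends e. mpoly_var v))"


section \<open>Ladder-like structures and their graphs\<close>

text \<open>A partially filled array maps a position (row, column), both counted from 1, to the index
  \<open>j\<close> of the variable \<open>x\<^sub>j\<close> standing there, or to \<^const>\<open>None\<close> if the position is empty.\<close>

type_synonym array = "nat \<times> nat \<Rightarrow> nat option"

definition ladder_rows :: "nat \<Rightarrow> nat"
  where "ladder_rows n = n div 2 + 2"

definition ladder_cols :: "nat \<Rightarrow> nat"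
  where "ladder_cols n = (n + 1) div 2 + 2"

text \<open>The first or second element of a list, as selected by a bit.\<close>

definition pick :: "bit \<Rightarrow> 'a list \<Rightarrow> 'a"
  where "pick b xs = (if b = 0 then xs ! 0 else xs ! 1)"

text \<open>The tuple \<open>(t\<^sub>1, \<dots>, t\<^sub>n\<^sub>+\<^sub>1)\<close> is a list of length \<open>n + 1\<close>, so that \<open>t\<^sub>n\<^sub>+\<^sub>1\<close> is its last
  element and the truncation \<open>(t\<^sub>1, \<dots>, t\<^sub>n)\<close> is \<^term>\<open>butlast t\<close>.\<close>

fun ladder :: "nat \<Rightarrow> bit list \<Rightarrow> array" where
  "ladder 0 t = [(1, 1) \<mapsto> 0, (1, 2) \<mapsto> 2, (2, 1) \<mapsto> 3, (2, 2) \<mapsto> 4]"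
| "ladder (Suc 0) t =
    [(1, 1) \<mapsto> 0, (1, 2) \<mapsto> 2, (1, 3) \<mapsto> 5, (2, 1) \<mapsto> 3, (2, 2) \<mapsto> 4, (2, 3) \<mapsto> 6]"
| "ladder (Suc (Suc m)) t =
    (let n = m + 2; A = ladder (Suc m) (butlast t); r = ladder_rows n; c = ladder_cols n in
     if even n then
       (let j = pick (last t) (filter (\<lambda>j. A (r - 1, j) \<noteq> None) [1..<c + 1])
        in A((r, j) \<mapsto> 2 * n + 3, (r, c) \<mapsto> 2 * n + 4))
     else
       (let i = pick (last t) (filter (\<lambda>i. A (i, c - 1) \<noteq> None) [1..<r + 1])
        in A((i, c) \<mapsto> 2 * n + 3, (r, c) \<mapsto> 2 * n + 4)))"

datatype vertex = Row nat | Col nat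

definition ladder_vertices :: "nat \<Rightarrow> vertex set"
  where "ladder_vertices n = Row ` {1..ladder_rows n} \<union> Col ` {1..ladder_cols n}"

definition ladder_edges :: "nat \<Rightarrow> nat set"
  where "ladder_edges n = {0} \<union> {2..2 * n + 4}"

definition ladder_ends :: "nat \<Rightarrow> bit list \<Rightarrow> nat \<Rightarrow> vertex set"
  where "ladder_ends n t j = (\<Union>(r, c)\<in>{p. ladder n t p = Some j}. {Row r, Col c})"

definition ladder_poly_ring :: "nat \<Rightarrow> ((nat \<Rightarrow>\<^sub>0 nat) \<Rightarrow>\<^sub>0 'k::field) ring"
  where "ladder_poly_ring n = mpoly_ring (ladder_edges n)"

definition ladder_toric_ideal :: "nat \<Rightarrow> bit list \<Rightarrow> ((nat \<Rightarrow>\<^sub>0 nat) \<Rightarrow>\<^sub>0 'k::field) set"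
  where "ladder_toric_ideal n t =
    toric_ideal (ladder_vertices n) (ladder_edges n) (ladder_ends n t)"

definition ladder_toric_ring ::
  "nat \<Rightarrow> bit list \<Rightarrow> ((nat \<Rightarrow>\<^sub>0 nat) \<Rightarrow>\<^sub>0 'k::field, ((nat \<Rightarrow>\<^sub>0 nat) \<Rightarrow>\<^sub>0 'k) set) module"
  where "ladder_toric_ring n t = quotient_module (ladder_poly_ring n) (ladder_toric_ideal n t)"

end

theory Submission
  imports Defs
begin

text \<open>The ring \<open>S\<close> has \<open>2n + 4\<close> variables and the toric ring has dimension \<open>n + 3\<close>, so \<open>n + 1\<close> is the
codimension of the toric ring, and the theorem says that the toric ring is Cohen-Macaulay. The proof
bounds the projective dimension from both sides by hand, without depth.

The graph grows in stages \<open>k = 1, \<dots>, n + 1\<close>; the ladder with parameter \<open>n\<close> has stage \<open>n + 1\<close>. Stage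
\<open>k\<close> adds a vertex \<open>u\<^sub>k\<close> (alternately a row and a column) and two edges: \<open>X\<^sub>k = x\<^bsub>2k+2\<^esub>\<close>, which joins
it to \<open>u\<^bsub>k-1\<^esub>\<close>, and \<open>Y\<^sub>k = x\<^bsub>2k+1\<^esub>\<close>, which joins it to an older vertex \<open>v\<^sub>k\<close>. The four-cycles
through both new edges give the minors \<open>f\<^sub>k = a\<^sub>k X\<^sub>k - X\<^bsub>k-1\<^esub> Y\<^sub>k\<close> and, for
\<open>k \<ge> 2\<close>, \<open>g\<^sub>k = z\<^sub>k X\<^sub>k - Y\<^bsub>k-1\<^esub> Y\<^sub>k\<close>, where \<open>a\<^sub>k\<close> is the edge from \<open>u\<^bsub>k-2\<^esub>\<close> to \<open>v\<^sub>k\<close> and \<open>z\<^sub>k\<close> is the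
edge from \<open>v\<^bsub>k-1\<^esub>\<close> to \<open>v\<^sub>k\<close>. That the second edge exists is the combinatorial heart of the matter:
whichever way a bit decides, the pair of the edges \<open>a\<close> and \<open>z\<close> of stage \<open>k + 1\<close> is \<open>X\<^bsub>k-1\<^esub>, a\<^sub>k\<close>
or \<open>Y\<^bsub>k-1\<^esub>, z\<^sub>k\<close>.

The ideal \<open>G\<^sub>k\<close> of the minors of the first \<open>k\<close> stages is the toric ideal of stage \<open>k\<close>
(\<open>same_weight_congruent\<close>, \<open>toric_ideal_eq_G\<close>): if two monomials have the same degree at every
vertex, the minors of the last stage allow one to pass to monomials that share \<open>X\<^sub>k\<close> or \<open>Y\<^sub>k\<close>, which
then cancels. In particular \<open>G\<^sub>k\<close> is prime.

Upper bound (\<open>pd_G\<close>): put \<open>X = X\<^bsub>k+1\<^esub>\<close>, \<open>Y = Y\<^bsub>k+1\<^esub>\<close> and \<open>Q = (G\<^sub>k + (X, Y)) / G\<^bsub>k+1\<^esub>\<close>. Since \<open>X, Y\<close> is a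
regular sequence modulo \<open>G\<^sub>k\<close>, the quotient of \<open>S\<close> by \<open>G\<^sub>k + (X, Y)\<close> has projective dimension at most
\<open>k + 2\<close>, so \<open>Q\<close>, the kernel of the map onto it from \<open>S / G\<^bsub>k+1\<^esub>\<close>, has projective dimension at most
\<open>k + 1\<close>. The assignment \<open>X \<mapsto> f\<^bsub>k+2\<^esub>\<close>, \<open>Y \<mapsto> g\<^bsub>k+2\<^esub>\<close> is an isomorphism from \<open>Q\<close> to \<open>G\<^bsub>k+2\<^esub> / G\<^bsub>k+1\<^esub>\<close>,
namely multiplication by the fraction \<open>f\<^bsub>k+2\<^esub> / X\<close>, because \<open>X g\<^bsub>k+2\<^esub> - Y f\<^bsub>k+2\<^esub>\<close> is a multiple of a
minor of stage \<open>k + 1\<close>. Hence \<open>S / G\<^bsub>k+2\<^esub>\<close>, the cokernel of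
\<open>Q \<rightarrow> S / G\<^bsub>k+1\<^esub>\<close>, has projective dimension at most \<open>k + 2\<close>, and induction applies.

Lower bound: \<open>f\<^sub>1, \<dots>, f\<^bsub>n+1\<^esub>\<close> is a regular sequence (\<open>f_sequence_regular\<close>), because every \<open>f\<^sub>k\<close> involves
the two variables \<open>X\<^sub>k\<close>, \<open>Y\<^sub>k\<close> that its predecessors do not, and a nonzero module annihilated by a
regular sequence of length \<open>n + 1\<close> has no projective resolution of length at most \<open>n\<close>
(\<open>zero_if_short_resolution\<close>).\<close>

type_synonym ('v, 'k) mpoly = "('v \<Rightarrow>\<^sub>0 nat) \<Rightarrow>\<^sub>0 'k"

abbreviation "single \<equiv> Poly_Mapping.single"
abbreviation "lookup \<equiv> Poly_Mapping.lookup"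
abbreviation "keys \<equiv> Poly_Mapping.keys"

section \<open>Linear relations out of projective modules\<close>

lemma module_homD:
  assumes "h \<in> module_hom R M N"
  shows "x \<in> carrier M \<Longrightarrow> h x \<in> carrier N"
    "x \<in> carrier M \<Longrightarrow> y \<in> carrier M \<Longrightarrow> h (x \<oplus>\<^bsub>M\<^esub> y) = h x \<oplus>\<^bsub>N\<^esub> h y"
    "r \<in> carrier R \<Longrightarrow> x \<in> carrier M \<Longrightarrow> h (r \<odot>\<^bsub>M\<^esub> x) = r \<odot>\<^bsub>N\<^esub> h x"
  using assms by (auto simp: module_hom_def)

lemma module_homI:
  assumes "\<And>x. x \<in> carrier M \<Longrightarrow> h x \<in> carrier N"
    "\<And>x y. x \<in> carrier M \<Longrightarrow> y \<in> carrier M \<Longrightarrow> h (x \<oplus>\<^bsub>M\<^esub> y) = h x \<oplus>\<^bsub>N\<^esub> h y"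
    "\<And>r x. r \<in> carrier R \<Longrightarrow> x \<in> carrier M \<Longrightarrow> h (r \<odot>\<^bsub>M\<^esub> x) = r \<odot>\<^bsub>N\<^esub> h x"
  shows "h \<in> module_hom R M N"
  using assms by (auto simp: module_hom_def)

lemma module_hom_comp:
  "h \<in> module_hom R M N \<Longrightarrow> g \<in> module_hom R N L \<Longrightarrow> g \<circ> h \<in> module_hom R M L"
  by (auto simp: module_hom_def Pi_def)

lemma module_hom_zero:
  assumes "Module.module R M" "Module.module R N" "h \<in> module_hom R M N"
  shows "h \<zero>\<^bsub>M\<^esub> = \<zero>\<^bsub>N\<^esub>"
proof -
  interpret M: Module.module R M by fact
  interpret N: Module.module R N by fact
  have "h (\<zero>\<^bsub>R\<^esub> \<odot>\<^bsub>M\<^esub> \<zero>\<^bsub>M\<^esub>) = \<zero>\<^bsub>R\<^esub> \<odot>\<^bsub>N\<^esub> h \<zero>\<^bsub>M\<^esub>"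
    by (rule module_homD[OF assms(3)]) auto
  then show ?thesis using module_homD(1)[OF assms(3)] by simp
qed

lemma module_hom_minus:
  assumes "Module.module R M" "Module.module R N" "h \<in> module_hom R M N"
    and "x \<in> carrier M" "y \<in> carrier M"
  shows "h (x \<ominus>\<^bsub>M\<^esub> y) = h x \<ominus>\<^bsub>N\<^esub> h y"
proof -
  interpret M: Module.module R M by fact
  interpret N: Module.module R N by fact
  have "h (\<ominus>\<^bsub>M\<^esub> y) = h ((\<ominus>\<^bsub>R\<^esub> \<one>\<^bsub>R\<^esub>) \<odot>\<^bsub>M\<^esub> y)"
    using assms(5) by (simp add: M.smult_l_minus)
  also have "\<dots> = \<ominus>\<^bsub>N\<^esub> h y"
    using assms(3,5) by (simp add: module_homD N.smult_l_minus)
  finally show ?thesis using assms(3-5) by (simp add: a_minus_def module_homD)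
qed

lemma (in abelian_group) add_minus_cancel:
  "x \<in> carrier G \<Longrightarrow> y \<in> carrier G \<Longrightarrow> y \<oplus> (x \<ominus> y) = x"
  by (simp add: minus_eq a_lcomm r_neg)

lemma (in abelian_group) add_diff_cancel:
  "x \<in> carrier G \<Longrightarrow> y \<in> carrier G \<Longrightarrow> x \<oplus> y \<ominus> x = y"
  by (simp add: minus_eq a_comm[of x y] a_assoc r_neg)

lemma (in abelian_group) minus_add_minus:
  assumes "x \<in> carrier G" "y \<in> carrier G" "z \<in> carrier G"
  shows "(x \<ominus> y) \<oplus> (y \<ominus> z) = x \<ominus> z"
proof -
  have "(x \<ominus> y) \<oplus> (y \<ominus> z) = x \<oplus> (\<ominus> y \<oplus> (y \<oplus> \<ominus> z))"
    using assms by (simp add: minus_eq a_assoc)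
  then show ?thesis using assms r_neg1[of y "\<ominus> z"] by (simp add: minus_eq)
qed

lemma (in abelian_group) eq_if_minus_eq_zero:
  "x \<in> carrier G \<Longrightarrow> y \<in> carrier G \<Longrightarrow> x \<ominus> y = \<zero> \<Longrightarrow> x = y"
  using add_minus_cancel[of x y] by simp

lemma free_module_simps:
  "\<zero>\<^bsub>free_module R J\<^esub> = (\<lambda>i. \<zero>\<^bsub>R\<^esub>)"
  "f \<oplus>\<^bsub>free_module R J\<^esub> g = (\<lambda>i. f i \<oplus>\<^bsub>R\<^esub> g i)"
  "r \<odot>\<^bsub>free_module R J\<^esub> f = (\<lambda>i. r \<otimes>\<^bsub>R\<^esub> f i)"
  by (simp_all add: free_module_def)

lemma (in cring) free_module_carrier_iff:
  "f \<in> carrier (free_module R J) \<longleftrightarrow>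
    (\<forall>i. f i \<in> carrier R) \<and> (\<forall>i. i \<notin> J \<longrightarrow> f i = \<zero>) \<and> finite {i. f i \<noteq> \<zero>}"
  unfolding free_module_def by simp (metis zero_closed)

lemma (in cring) module_free_module: "Module.module R (free_module R J)"
proof (rule moduleI)
  show "abelian_group (free_module R J)"
  proof (rule abelian_groupI)
    fix f g assume "f \<in> carrier (free_module R J)" "g \<in> carrier (free_module R J)"
    then show "f \<oplus>\<^bsub>free_module R J\<^esub> g \<in> carrier (free_module R J)"
      unfolding free_module_carrier_iff free_module_simps
      by (auto intro: finite_subset[of _ "{i. f i \<noteq> \<zero>} \<union> {i. g i \<noteq> \<zero>}"])
  next
    fix f assume f: "f \<in> carrier (free_module R J)"
    show "\<exists>g\<in>carrier (free_module R J). g \<oplus>\<^bsub>free_module R J\<^esub> f = \<zero>\<^bsub>free_module R J\<^esub>"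
    proof (rule bexI)
      show "(\<lambda>i. \<ominus> f i) \<oplus>\<^bsub>free_module R J\<^esub> f = \<zero>\<^bsub>free_module R J\<^esub>"
        using f by (simp add: free_module_carrier_iff free_module_simps l_neg)
      show "(\<lambda>i. \<ominus> f i) \<in> carrier (free_module R J)"
        using f unfolding free_module_carrier_iff
        by (auto elim!: finite_subset[rotated])
    qed
  qed (simp_all add: free_module_carrier_iff free_module_simps a_ac)
next
  fix r f assume "r \<in> carrier R" "f \<in> carrier (free_module R J)"
  then show "r \<odot>\<^bsub>free_module R J\<^esub> f \<in> carrier (free_module R J)"
    unfolding free_module_carrier_iff free_module_simps
    by (auto elim!: finite_subset[rotated])
qed (simp_all add: free_module_carrier_iff free_module_simps l_distr r_distr m_assoc is_cring)

text \<open>A linear relation is a submodule of a product of two modules, such as the graph of a homomorphism or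
the set of pairs whose images agree modulo a submodule. Lifting problems modulo submodules are posed
for such relations, so that no quotient module has to be formed.\<close>

definition module_rel ::
  "('r, 'x) ring_scheme \<Rightarrow> ('r, 'a, 'y) module_scheme \<Rightarrow> ('r, 'b, 'z) module_scheme \<Rightarrow>
    ('a \<Rightarrow> 'b \<Rightarrow> bool) \<Rightarrow> bool"
  where "module_rel R M N Q \<longleftrightarrow>
    (\<forall>x\<in>carrier M. \<forall>x'\<in>carrier M. \<forall>y\<in>carrier N. \<forall>y'\<in>carrier N.
      Q x y \<longrightarrow> Q x' y' \<longrightarrow> Q (x \<oplus>\<^bsub>M\<^esub> x') (y \<oplus>\<^bsub>N\<^esub> y')) \<and>
    (\<forall>r\<in>carrier R. \<forall>x\<in>carrier M. \<forall>y\<in>carrier N. Q x y \<longrightarrow> Q (r \<odot>\<^bsub>M\<^esub> x) (r \<odot>\<^bsub>N\<^esub> y))"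

lemma module_relI:
  assumes "\<And>x x' y y'. x \<in> carrier M \<Longrightarrow> x' \<in> carrier M \<Longrightarrow> y \<in> carrier N \<Longrightarrow> y' \<in> carrier N \<Longrightarrow>
      Q x y \<Longrightarrow> Q x' y' \<Longrightarrow> Q (x \<oplus>\<^bsub>M\<^esub> x') (y \<oplus>\<^bsub>N\<^esub> y')"
    "\<And>r x y. r \<in> carrier R \<Longrightarrow> x \<in> carrier M \<Longrightarrow> y \<in> carrier N \<Longrightarrow> Q x y \<Longrightarrow>
      Q (r \<odot>\<^bsub>M\<^esub> x) (r \<odot>\<^bsub>N\<^esub> y)"
  shows "module_rel R M N Q"
  using assms by (auto simp: module_rel_def)

lemma module_relD:
  assumes "module_rel R M N Q"
  shows "x \<in> carrier M \<Longrightarrow> x' \<in> carrier M \<Longrightarrow> y \<in> carrier N \<Longrightarrow> y' \<in> carrier N \<Longrightarrow>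
      Q x y \<Longrightarrow> Q x' y' \<Longrightarrow> Q (x \<oplus>\<^bsub>M\<^esub> x') (y \<oplus>\<^bsub>N\<^esub> y')"
    "r \<in> carrier R \<Longrightarrow> x \<in> carrier M \<Longrightarrow> y \<in> carrier N \<Longrightarrow> Q x y \<Longrightarrow>
      Q (r \<odot>\<^bsub>M\<^esub> x) (r \<odot>\<^bsub>N\<^esub> y)"
  using assms by (auto simp: module_rel_def)

text \<open>A homomorphism inside a total linear relation is found by choosing an image for every basis element.\<close>

lemma (in cring) free_module_rel_lift:
  fixes J :: "'i set"
  defines "F \<equiv> free_module R J"
  assumes L: "Module.module R L" and Q: "module_rel R F L Q"
    and total: "\<And>f. f \<in> carrier F \<Longrightarrow> \<exists>y\<in>carrier L. Q f y"
  shows "\<exists>h\<in>module_hom R F L. \<forall>f\<in>carrier F. Q f (h f)"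
proof -
  interpret L: Module.module R L by fact
  interpret F: Module.module R F unfolding F_def by (rule module_free_module)
  define e where "e j = (\<lambda>i::'i. if i = j then \<one> else \<zero>)" for j
  have e: "e j \<in> carrier F" if "j \<in> J" for j
    using that by (auto simp: F_def free_module_carrier_iff e_def)
  have "\<forall>j\<in>J. \<exists>y. y \<in> carrier L \<and> Q (e j) y" using total e by blast
  then obtain y where y: "\<And>j. j \<in> J \<Longrightarrow> y j \<in> carrier L" "\<And>j. j \<in> J \<Longrightarrow> Q (e j) (y j)"
    by metis
  define supp where "supp f = {i::'i. f i \<noteq> \<zero>}" for f
  define h where "h f = (\<Oplus>\<^bsub>L\<^esub>j\<in>supp f. f j \<odot>\<^bsub>L\<^esub> y j)" for f
  have Fc: "f i \<in> carrier R" "finite (supp f)" "supp f \<subseteq> J" if "f \<in> carrier F" for f i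
    using that by (auto simp: F_def free_module_carrier_iff supp_def)
  have summand: "(\<lambda>j. f j \<odot>\<^bsub>L\<^esub> y j) \<in> A \<rightarrow> carrier L" if "f \<in> carrier F" "A \<subseteq> J" for f A
    using that Fc y by auto
  have superset: "h f = (\<Oplus>\<^bsub>L\<^esub>j\<in>A. f j \<odot>\<^bsub>L\<^esub> y j)"
    if "f \<in> carrier F" "finite A" "supp f \<subseteq> A" "A \<subseteq> J" for f A
    unfolding h_def
  proof (rule L.add.finprod_mono_neutral_cong_left)
    show "f i \<odot>\<^bsub>L\<^esub> y i = \<zero>\<^bsub>L\<^esub>" if "i \<in> A - supp f" for i
      using that y \<open>A \<subseteq> J\<close> by (auto simp: supp_def)
    show "(\<lambda>j. f j \<odot>\<^bsub>L\<^esub> y j) \<in> A \<rightarrow> carrier L" by (rule summand) fact+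
  qed (use that in auto)
  have hc: "h f \<in> carrier L" if "f \<in> carrier F" for f
    unfolding h_def using summand[OF that Fc(3)[OF that]] by (rule L.finsum_closed)
  have "h \<in> module_hom R F L"
  proof (rule module_homI)
    fix f g assume f: "f \<in> carrier F" and g: "g \<in> carrier F"
    let ?A = "supp f \<union> supp g"
    have fg: "f \<oplus>\<^bsub>F\<^esub> g \<in> carrier F" using f g by simp
    have A: "finite ?A" "?A \<subseteq> J" using Fc(2,3)[OF f] Fc(2,3)[OF g] by auto
    have "supp (f \<oplus>\<^bsub>F\<^esub> g) \<subseteq> ?A"
      by (auto simp: supp_def F_def free_module_simps)
    then have "h (f \<oplus>\<^bsub>F\<^esub> g) = (\<Oplus>\<^bsub>L\<^esub>j\<in>?A. (f \<oplus>\<^bsub>F\<^esub> g) j \<odot>\<^bsub>L\<^esub> y j)"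
      by (intro superset fg A)
    also have "\<dots> = (\<Oplus>\<^bsub>L\<^esub>j\<in>?A. f j \<odot>\<^bsub>L\<^esub> y j \<oplus>\<^bsub>L\<^esub> g j \<odot>\<^bsub>L\<^esub> y j)"
      using f g A y Fc(1)
      by (intro L.finsum_cong') (auto simp: F_def free_module_simps L.smult_l_distr)
    also have "\<dots> = (\<Oplus>\<^bsub>L\<^esub>j\<in>?A. f j \<odot>\<^bsub>L\<^esub> y j) \<oplus>\<^bsub>L\<^esub> (\<Oplus>\<^bsub>L\<^esub>j\<in>?A. g j \<odot>\<^bsub>L\<^esub> y j)"
      by (intro L.finsum_addf summand f g A)
    also have "\<dots> = h f \<oplus>\<^bsub>L\<^esub> h g"
      using superset[OF f A(1) _ A(2)] superset[OF g A(1) _ A(2)] by simp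
    finally show "h (f \<oplus>\<^bsub>F\<^esub> g) = h f \<oplus>\<^bsub>L\<^esub> h g" .
  next
    fix r f assume r: "r \<in> carrier R" and f: "f \<in> carrier F"
    have "supp (r \<odot>\<^bsub>F\<^esub> f) \<subseteq> supp f"
      using r by (auto simp: supp_def F_def free_module_simps)
    then have "h (r \<odot>\<^bsub>F\<^esub> f) = (\<Oplus>\<^bsub>L\<^esub>j\<in>supp f. (r \<odot>\<^bsub>F\<^esub> f) j \<odot>\<^bsub>L\<^esub> y j)"
      using r f Fc[OF f] by (intro superset) auto
    also have "\<dots> = (\<Oplus>\<^bsub>L\<^esub>j\<in>supp f. r \<odot>\<^bsub>L\<^esub> (f j \<odot>\<^bsub>L\<^esub> y j))"
      using r y Fc[OF f]
      by (intro L.finsum_cong') (auto simp: F_def free_module_simps L.smult_assoc1)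
    also have "\<dots> = r \<odot>\<^bsub>L\<^esub> h f"
      unfolding h_def using Fc[OF f] r by (intro L.finsum_smult_ldistr[symmetric] summand f) auto
    finally show "h (r \<odot>\<^bsub>F\<^esub> f) = r \<odot>\<^bsub>L\<^esub> h f" .
  qed (rule hc)
  moreover have "Q f (h f)" if "f \<in> carrier F" for f
  proof -
    have "Q f (\<Oplus>\<^bsub>L\<^esub>j\<in>A. f j \<odot>\<^bsub>L\<^esub> y j)"
      if "finite A" "A \<subseteq> J" "f \<in> carrier F" "supp f \<subseteq> A" for A f
      using that
    proof (induction A arbitrary: f)
      case empty
      then have "f = \<zero>\<^bsub>F\<^esub>" by (auto simp: supp_def F_def free_module_simps)
      moreover have "Q (\<zero> \<odot>\<^bsub>F\<^esub> \<zero>\<^bsub>F\<^esub>) (\<zero> \<odot>\<^bsub>L\<^esub> \<zero>\<^bsub>L\<^esub>)"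
      proof -
        obtain z where "z \<in> carrier L" "Q \<zero>\<^bsub>F\<^esub> z" using total F.zero_closed by blast
        then show ?thesis using module_relD(2)[OF Q zero_closed F.zero_closed, of z] by simp
      qed
      ultimately show ?case by simp
    next
      case (insert a A)
      let ?f' = "\<lambda>i. if i = a then \<zero> else f i"
      have f': "?f' \<in> carrier F"
        using insert.prems(2) unfolding F_def free_module_carrier_iff
        by (auto elim: finite_subset[rotated])
      have a: "a \<in> J" "y a \<in> carrier L" using insert.prems y by auto
      have fa: "f a \<in> carrier R" using Fc insert.prems(2) by blast
      have "Q (f a \<odot>\<^bsub>F\<^esub> e a \<oplus>\<^bsub>F\<^esub> ?f') (f a \<odot>\<^bsub>L\<^esub> y a \<oplus>\<^bsub>L\<^esub> (\<Oplus>\<^bsub>L\<^esub>j\<in>A. ?f' j \<odot>\<^bsub>L\<^esub> y j))"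
      proof (intro module_relD(1)[OF Q])
        show "Q (f a \<odot>\<^bsub>F\<^esub> e a) (f a \<odot>\<^bsub>L\<^esub> y a)"
          using fa a by (intro module_relD(2)[OF Q] e y)
        show "Q ?f' (\<Oplus>\<^bsub>L\<^esub>j\<in>A. ?f' j \<odot>\<^bsub>L\<^esub> y j)"
          using insert.prems f' by (intro insert.IH) (auto simp: supp_def)
        show "(\<Oplus>\<^bsub>L\<^esub>j\<in>A. ?f' j \<odot>\<^bsub>L\<^esub> y j) \<in> carrier L"
          using insert.prems by (intro L.finsum_closed summand f') auto
      qed (use f' fa a e in auto)
      moreover have "f a \<odot>\<^bsub>F\<^esub> e a \<oplus>\<^bsub>F\<^esub> ?f' = f"
        using Fc(1)[OF insert.prems(2)] by (auto simp: F_def free_module_simps e_def fun_eq_iff)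
      moreover have "(\<Oplus>\<^bsub>L\<^esub>j\<in>A. ?f' j \<odot>\<^bsub>L\<^esub> y j) = (\<Oplus>\<^bsub>L\<^esub>j\<in>A. f j \<odot>\<^bsub>L\<^esub> y j)"
        using insert.hyps insert.prems summand[OF insert.prems(2), of A]
        by (intro L.finsum_cong') auto
      ultimately show ?case
        using insert.hyps insert.prems a fa summand[OF insert.prems(2), of A]
        by (simp add: L.finsum_insert)
    qed
    from this[OF Fc(2)[OF that] Fc(3)[OF that] that] show ?thesis by (simp add: h_def)
  qed
  ultimately show ?thesis by blast
qed

lemma projective_moduleE:
  fixes P :: "('r, 'p, 'y) module_scheme"
  assumes "projective_module R P"
  obtains J :: "'p set" and \<phi> Q where "Module.module R P" "\<phi> \<in> module_hom R P (free_module R J)"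
    "inj_on \<phi> (carrier P)" "submodule Q R (free_module R J)"
    "\<phi> ` carrier P \<inter> Q = {\<zero>\<^bsub>free_module R J\<^esub>}"
    "\<phi> ` carrier P <+>\<^bsub>free_module R J\<^esub> Q = carrier (free_module R J)"
  using assms unfolding projective_module_def by blast

text \<open>The projection of a free module onto a direct summand, as a relation: every element has a component,
the component is unique on the summand itself, and it depends linearly on the element.\<close>

lemma (in cring) projective_decomposition:
  fixes J :: "'p set"
  defines "F \<equiv> free_module R J"
  assumes P: "Module.module R P" and \<phi>: "\<phi> \<in> module_hom R P F" "inj_on \<phi> (carrier P)"
    and Q: "submodule Q R F" "\<phi> ` carrier P \<inter> Q = {\<zero>\<^bsub>F\<^esub>}" "\<phi> ` carrier P <+>\<^bsub>F\<^esub> Q = carrier F"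
  shows "f \<in> carrier F \<Longrightarrow> \<exists>p\<in>carrier P. \<exists>q\<in>Q. f = \<phi> p \<oplus>\<^bsub>F\<^esub> q"
    and "p \<in> carrier P \<Longrightarrow> p' \<in> carrier P \<Longrightarrow> q \<in> Q \<Longrightarrow> \<phi> p = \<phi> p' \<oplus>\<^bsub>F\<^esub> q \<Longrightarrow> p = p'"
    and "module_rel R F P (\<lambda>f p. \<exists>q\<in>Q. f = \<phi> p \<oplus>\<^bsub>F\<^esub> q)"
proof -
  interpret P: Module.module R P by fact
  interpret F: Module.module R F unfolding F_def by (rule module_free_module)
  note Q' = F.submoduleE[OF Q(1)]
  show "\<exists>p\<in>carrier P. \<exists>q\<in>Q. f = \<phi> p \<oplus>\<^bsub>F\<^esub> q" if "f \<in> carrier F"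
    using that unfolding Q(3)[symmetric] by (auto simp: set_add_def')
  show "p = p'" if p: "p \<in> carrier P" "p' \<in> carrier P" and q: "q \<in> Q" "\<phi> p = \<phi> p' \<oplus>\<^bsub>F\<^esub> q"
  proof -
    have c: "\<phi> p \<in> carrier F" "\<phi> p' \<in> carrier F" "q \<in> carrier F"
      using p q Q'(1) module_homD(1)[OF \<phi>(1)] by auto
    have "\<phi> (p \<ominus>\<^bsub>P\<^esub> p') = \<phi> p \<ominus>\<^bsub>F\<^esub> \<phi> p'"
      by (rule module_hom_minus[OF P F.module_axioms \<phi>(1) p])
    also have "\<dots> = q" using c q(2) by (simp add: F.minus_eq F.a_ac F.r_neg)
    finally have "\<phi> (p \<ominus>\<^bsub>P\<^esub> p') \<in> \<phi> ` carrier P \<inter> Q" using p q by auto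
    then have "\<phi> (p \<ominus>\<^bsub>P\<^esub> p') = \<phi> \<zero>\<^bsub>P\<^esub>"
      using Q(2) module_hom_zero[OF P F.module_axioms \<phi>(1)] by simp
    then have "p \<ominus>\<^bsub>P\<^esub> p' = \<zero>\<^bsub>P\<^esub>"
      using p by (intro inj_onD[OF \<phi>(2)]) auto
    then show ?thesis using p P.eq_if_minus_eq_zero by blast
  qed
  show "module_rel R F P (\<lambda>f p. \<exists>q\<in>Q. f = \<phi> p \<oplus>\<^bsub>F\<^esub> q)"
  proof (rule module_relI)
    fix x x' y y' assume y: "y \<in> carrier P" "y' \<in> carrier P"
      and "\<exists>q\<in>Q. x = \<phi> y \<oplus>\<^bsub>F\<^esub> q" "\<exists>q\<in>Q. x' = \<phi> y' \<oplus>\<^bsub>F\<^esub> q"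
    then obtain q q' where q: "q \<in> Q" "q' \<in> Q" "x = \<phi> y \<oplus>\<^bsub>F\<^esub> q" "x' = \<phi> y' \<oplus>\<^bsub>F\<^esub> q'" by blast
    have "q \<in> carrier F" "q' \<in> carrier F" using q Q'(1) by auto
    then have "x \<oplus>\<^bsub>F\<^esub> x' = \<phi> (y \<oplus>\<^bsub>P\<^esub> y') \<oplus>\<^bsub>F\<^esub> (q \<oplus>\<^bsub>F\<^esub> q')"
      using q y module_homD[OF \<phi>(1)] by (simp add: F.a_ac)
    then show "\<exists>q\<in>Q. x \<oplus>\<^bsub>F\<^esub> x' = \<phi> (y \<oplus>\<^bsub>P\<^esub> y') \<oplus>\<^bsub>F\<^esub> q" using Q'(5) q by blast
  next
    fix r x y assume y: "r \<in> carrier R" "y \<in> carrier P" and "\<exists>q\<in>Q. x = \<phi> y \<oplus>\<^bsub>F\<^esub> q"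
    then obtain q where q: "q \<in> Q" "x = \<phi> y \<oplus>\<^bsub>F\<^esub> q" by blast
    have "q \<in> carrier F" using q Q'(1) by auto
    then have "r \<odot>\<^bsub>F\<^esub> x = \<phi> (r \<odot>\<^bsub>P\<^esub> y) \<oplus>\<^bsub>F\<^esub> (r \<odot>\<^bsub>F\<^esub> q)"
      using q y module_homD[OF \<phi>(1)] by (simp add: F.smult_r_distr)
    then show "\<exists>q\<in>Q. r \<odot>\<^bsub>F\<^esub> x = \<phi> (r \<odot>\<^bsub>P\<^esub> y) \<oplus>\<^bsub>F\<^esub> q" using Q'(4) q y by blast
  qed
qed

text \<open>The lifting property of projective modules. The given relation is composed with the
projection onto the summand, which yields a total linear relation out of the free module; the
homomorphism found there is restricted to the summand.\<close>

lemma (in cring) projective_rel_lift: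
  assumes "projective_module R P" and L: "Module.module R L" and Rel: "module_rel R P L Rel"
    and total: "\<And>x. x \<in> carrier P \<Longrightarrow> \<exists>y\<in>carrier L. Rel x y"
  shows "\<exists>h\<in>module_hom R P L. \<forall>x\<in>carrier P. Rel x (h x)"
  using assms(1)
proof (rule projective_moduleE)
  fix J :: "'c set" and \<phi> Q
  define F where "F = free_module R J"
  assume P: "Module.module R P" and "\<phi> \<in> module_hom R P (free_module R J)"
    "inj_on \<phi> (carrier P)" "submodule Q R (free_module R J)"
    "\<phi> ` carrier P \<inter> Q = {\<zero>\<^bsub>free_module R J\<^esub>}"
    "\<phi> ` carrier P <+>\<^bsub>free_module R J\<^esub> Q = carrier (free_module R J)"
  note dec = projective_decomposition[OF this, folded F_def]
  have \<phi>: "\<phi> \<in> module_hom R P F" unfolding F_def by fact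
  interpret P: Module.module R P by fact
  interpret F: Module.module R F unfolding F_def by (rule module_free_module)
  interpret L: Module.module R L by fact
  define Rel' where "Rel' f y \<longleftrightarrow> (\<exists>p\<in>carrier P. (\<exists>q\<in>Q. f = \<phi> p \<oplus>\<^bsub>F\<^esub> q) \<and> Rel p y)" for f y
  have "module_rel R F L Rel'"
  proof (rule module_relI)
    fix x x' y y' assume c: "x \<in> carrier F" "x' \<in> carrier F" "y \<in> carrier L" "y' \<in> carrier L"
      and "Rel' x y" "Rel' x' y'"
    then obtain p p' where p: "p \<in> carrier P" "p' \<in> carrier P" "\<exists>q\<in>Q. x = \<phi> p \<oplus>\<^bsub>F\<^esub> q"
      "\<exists>q\<in>Q. x' = \<phi> p' \<oplus>\<^bsub>F\<^esub> q" "Rel p y" "Rel p' y'"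
      unfolding Rel'_def by blast
    then show "Rel' (x \<oplus>\<^bsub>F\<^esub> x') (y \<oplus>\<^bsub>L\<^esub> y')"
      unfolding Rel'_def using module_relD(1)[OF dec(3), of x x' p p'] c p
        module_relD(1)[OF Rel p(1,2) c(3,4) p(5,6)] by blast
  next
    fix r x y assume c: "r \<in> carrier R" "x \<in> carrier F" "y \<in> carrier L" and "Rel' x y"
    then obtain p where p: "p \<in> carrier P" "\<exists>q\<in>Q. x = \<phi> p \<oplus>\<^bsub>F\<^esub> q" "Rel p y"
      unfolding Rel'_def by blast
    then show "Rel' (r \<odot>\<^bsub>F\<^esub> x) (r \<odot>\<^bsub>L\<^esub> y)"
      unfolding Rel'_def using module_relD(2)[OF dec(3), of r x p] c p
        module_relD(2)[OF Rel c(1) p(1) c(3) p(3)] c(1) by blast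
  qed
  moreover have "\<exists>y\<in>carrier L. Rel' f y" if "f \<in> carrier F" for f
    using dec(1)[OF that] total unfolding Rel'_def by blast
  ultimately obtain h where h: "h \<in> module_hom R F L" "\<And>f. f \<in> carrier F \<Longrightarrow> Rel' f (h f)"
    using free_module_rel_lift[OF L, of J Rel', folded F_def] by blast
  have "Rel x ((h \<circ> \<phi>) x)" if x: "x \<in> carrier P" for x
  proof -
    have "Rel' (\<phi> x) (h (\<phi> x))" using h(2) module_homD(1)[OF \<phi> x] by blast
    then show ?thesis unfolding Rel'_def using dec(2)[OF x] by auto
  qed
  then show ?thesis using module_hom_comp[OF \<phi> h(1)] by blast
qed

lemma module_hom_id: "(\<lambda>x. x) \<in> module_hom R M M"
  by (auto simp: module_hom_def)

lemma module_hom_diff: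
  assumes "Module.module R N" "Module.module R M" "g \<in> module_hom R M N" "h \<in> module_hom R M N"
  shows "(\<lambda>x. g x \<ominus>\<^bsub>N\<^esub> h x) \<in> module_hom R M N"
proof -
  interpret N: Module.module R N by fact
  interpret M: Module.module R M by fact
  show ?thesis
  proof (rule module_homI)
    fix x y assume "x \<in> carrier M" "y \<in> carrier M"
    then show "g (x \<oplus>\<^bsub>M\<^esub> y) \<ominus>\<^bsub>N\<^esub> h (x \<oplus>\<^bsub>M\<^esub> y) = g x \<ominus>\<^bsub>N\<^esub> h x \<oplus>\<^bsub>N\<^esub> (g y \<ominus>\<^bsub>N\<^esub> h y)"
      using assms(3,4) by (simp add: module_homD N.minus_eq N.minus_add N.a_ac)
  next
    fix r x assume "r \<in> carrier R" "x \<in> carrier M"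
    then show "g (r \<odot>\<^bsub>M\<^esub> x) \<ominus>\<^bsub>N\<^esub> h (r \<odot>\<^bsub>M\<^esub> x) = r \<odot>\<^bsub>N\<^esub> (g x \<ominus>\<^bsub>N\<^esub> h x)"
      using assms(3,4) by (simp add: module_homD N.minus_eq N.smult_r_distr N.smult_r_minus)
  qed (use assms(3,4) in \<open>auto simp: module_homD\<close>)
qed

lemma (in cring) module_hom_smult:
  assumes "Module.module R N" "h \<in> module_hom R M N" "r \<in> carrier R"
  shows "(\<lambda>x. r \<odot>\<^bsub>N\<^esub> h x) \<in> module_hom R M N"
proof -
  interpret N: Module.module R N by fact
  show ?thesis
    using assms(2,3) by (intro module_homI)
      (auto simp: module_homD N.smult_r_distr N.smult_assoc1[symmetric] m_comm)
qed

section \<open>Modules annihilated by a regular sequence have no short resolutions\<close>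

locale projective_resolution_of = cring R for R :: "('r, 'x) ring_scheme" (structure) +
  fixes M :: "('r, 'b, 'y) module_scheme" and P :: "nat \<Rightarrow> ('r, 'c) module"
    and d :: "nat \<Rightarrow> 'c \<Rightarrow> 'c" and \<epsilon> :: "'c \<Rightarrow> 'b"
  assumes resolution: "projective_resolution R M P d \<epsilon>"
begin

lemma proj: "projective_module R (P i)" and mod: "Module.module R (P i)"
  and d_hom: "d i \<in> module_hom R (P (Suc i)) (P i)"
  and eps_hom: "\<epsilon> \<in> module_hom R (P 0) M" and eps_onto: "\<epsilon> ` carrier (P 0) = carrier M"
proof -
  note res = resolution[unfolded projective_resolution_def]
  show p: "projective_module R (P i)" for i using res by (rule conjunct1[THEN spec])
  then show "Module.module R (P i)" unfolding projective_module_def by (rule conjunct1)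
  show "d i \<in> module_hom R (P (Suc i)) (P i)" "\<epsilon> \<in> module_hom R (P 0) M"
    "\<epsilon> ` carrier (P 0) = carrier M"
    using res by simp_all
qed

lemma exact0: "d 0 ` carrier (P (Suc 0)) = {x \<in> carrier (P 0). \<epsilon> x = \<zero>\<^bsub>M\<^esub>}"
  and exact: "d (Suc i) ` carrier (P (Suc (Suc i))) = {x \<in> carrier (P (Suc i)). d i x = \<zero>\<^bsub>P i\<^esub>}"
  using resolution by (simp_all add: projective_resolution_def a_kernel_def')

lemma d_closed: "x \<in> carrier (P (Suc i)) \<Longrightarrow> d i x \<in> carrier (P i)"
  using module_homD(1)[OF d_hom] .

lemma d_d: "x \<in> carrier (P (Suc (Suc i))) \<Longrightarrow> d i (d (Suc i) x) = \<zero>\<^bsub>P i\<^esub>"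
  using exact[of i] by blast

lemma lift_d:
  assumes "projective_module R L" "g \<in> module_hom R L (P i)"
    and "\<And>x. x \<in> carrier L \<Longrightarrow> g x \<in> d i ` carrier (P (Suc i))"
  shows "\<exists>h\<in>module_hom R L (P (Suc i)). \<forall>x\<in>carrier L. d i (h x) = g x"
proof (rule projective_rel_lift[OF assms(1) mod])
  show "module_rel R L (P (Suc i)) (\<lambda>x y. d i y = g x)"
    by (rule module_relI)
      (simp_all only: module_homD(2,3)[OF assms(2)] module_homD(2,3)[OF d_hom])
  show "\<exists>y\<in>carrier (P (Suc i)). d i y = g x" if x: "x \<in> carrier L" for x
  proof -
    obtain y where "g x = d i y" "y \<in> carrier (P (Suc i))" using assms(3)[OF x] by (rule imageE)
    then show ?thesis by (intro bexI[of _ y] sym[of "g x"])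
  qed
qed

text \<open>If \<open>a\<close> annihilates the resolved module, multiplication by \<open>a\<close> on the resolution is homotopic to zero;
the homotopy is built degree by degree.\<close>

lemma null_homotopy:
  assumes a: "a \<in> carrier R" and null: "\<And>x. x \<in> carrier (P 0) \<Longrightarrow> a \<odot>\<^bsub>P 0\<^esub> x \<in> d 0 ` carrier (P (Suc 0))"
  shows "\<exists>s. (\<forall>k. s k \<in> module_hom R (P k) (P (Suc k))) \<and>
    (\<forall>k. \<forall>x\<in>carrier (P (Suc k)). d (Suc k) (s (Suc k) x) = a \<odot>\<^bsub>P (Suc k)\<^esub> x \<ominus>\<^bsub>P (Suc k)\<^esub> s k (d k x))"
proof -
  have smult: "(\<lambda>x. a \<odot>\<^bsub>P k\<^esub> x) \<in> module_hom R (P k) (P k)" for k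
    by (rule module_hom_smult[OF mod module_hom_id a])
  define good where "good k s \<longleftrightarrow> s \<in> module_hom R (P k) (P (Suc k)) \<and>
    (\<forall>x\<in>carrier (P (Suc k)). d k (s (d k x)) = a \<odot>\<^bsub>P k\<^esub> d k x)" for k s
  have base: "\<exists>s. good 0 s"
  proof -
    obtain s where "s \<in> module_hom R (P 0) (P (Suc 0))" "\<And>x. x \<in> carrier (P 0) \<Longrightarrow> d 0 (s x) = a \<odot>\<^bsub>P 0\<^esub> x"
      using lift_d[OF proj smult null] by blast
    then show ?thesis unfolding good_def using d_closed by (intro exI[of _ s]) simp
  qed
  define chained where "chained k s s' \<longleftrightarrow> (\<forall>x\<in>carrier (P (Suc k)).
    d (Suc k) (s' x) = a \<odot>\<^bsub>P (Suc k)\<^esub> x \<ominus>\<^bsub>P (Suc k)\<^esub> s (d k x))" for k s s'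
  have "\<exists>s'. good (Suc k) s' \<and> chained k s s'" if good: "good k s" for k s
  proof -
    interpret Pk: Module.module R "P k" by (rule mod)
    interpret P': Module.module R "P (Suc k)" by (rule mod)
    have s: "s \<in> module_hom R (P k) (P (Suc k))" using good by (simp add: good_def)
    let ?g = "\<lambda>x. a \<odot>\<^bsub>P (Suc k)\<^esub> x \<ominus>\<^bsub>P (Suc k)\<^esub> s (d k x)"
    have g: "?g \<in> module_hom R (P (Suc k)) (P (Suc k))"
      using module_hom_diff[OF mod mod smult module_hom_comp[OF d_hom s]] by (simp add: o_def)
    have "?g x \<in> d (Suc k) ` carrier (P (Suc (Suc k)))" if x: "x \<in> carrier (P (Suc k))" for x
    proof -
      have "d k (?g x) = d k (a \<odot>\<^bsub>P (Suc k)\<^esub> x) \<ominus>\<^bsub>P k\<^esub> d k (s (d k x))"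
        using x a s by (intro module_hom_minus[OF mod mod d_hom]) (auto simp: module_homD d_closed)
      also have "\<dots> = \<zero>\<^bsub>P k\<^esub>"
        using good x a d_closed[OF x] by (simp add: good_def module_homD[OF d_hom] Pk.minus_eq Pk.r_neg)
      finally show ?thesis using exact module_homD(1)[OF g x] by blast
    qed
    then obtain s' where s': "s' \<in> module_hom R (P (Suc k)) (P (Suc (Suc k)))"
      "\<And>x. x \<in> carrier (P (Suc k)) \<Longrightarrow> d (Suc k) (s' x) = ?g x"
      using lift_d[OF proj g] by blast
    have "d (Suc k) (s' (d (Suc k) x)) = a \<odot>\<^bsub>P (Suc k)\<^esub> d (Suc k) x"
      if x: "x \<in> carrier (P (Suc (Suc k)))" for x
      using s'(2)[OF d_closed[OF x]] module_hom_zero[OF mod mod s] a d_closed[OF x]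
      by (simp add: d_d[OF x] P'.minus_eq)
    then have "good (Suc k) s'" using s'(1) unfolding good_def by blast
    moreover have "chained k s s'" using s'(2) unfolding chained_def by blast
    ultimately show ?thesis by blast
  qed
  then have "\<exists>s. \<forall>k. good k (s k) \<and> chained k (s k) (s (Suc k))"
    using base by (intro dependent_nat_choice)
  then show ?thesis unfolding good_def chained_def by blast
qed

text \<open>Vanishing of \<open>Ext\<^sup>i(M, N / NN j)\<close>, in the language of cocycles modulo \<open>NN j\<close>, where \<open>NN j\<close> plays the
role of the submodule generated by the multiples of the first \<open>j\<close> elements of a regular sequence on
\<open>N\<close>, and the sequence annihilates \<open>M\<close>. Multiplication by \<open>f j\<close> is injective on \<open>N / NN j\<close> and zero
on \<open>Ext\<close>, so \<open>Ext\<^sup>i\<close> of \<open>N / NN j\<close> is controlled by \<open>Ext\<close> of \<open>N / NN (Suc j)\<close> in degree \<open>i - 1\<close>. In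
degree \<open>0\<close> there is nothing to be a coboundary of, and the cocycle vanishes.\<close>

lemma cocycle_is_coboundary:
  fixes N :: "('r, 'n, 'z) module_scheme" and f :: "nat \<Rightarrow> 'r" and NN :: "nat \<Rightarrow> 'n set"
  assumes N: "Module.module R N" and f: "\<And>j. j \<le> n \<Longrightarrow> f j \<in> carrier R"
    and sub: "\<And>j. submodule (NN j) R N"
    and reg: "\<And>j y. j \<le> n \<Longrightarrow> y \<in> carrier N \<Longrightarrow> f j \<odot>\<^bsub>N\<^esub> y \<in> NN j \<Longrightarrow> y \<in> NN j"
    and next1: "\<And>j y w. j \<le> n \<Longrightarrow> y \<in> NN j \<Longrightarrow> w \<in> carrier N \<Longrightarrow> y \<oplus>\<^bsub>N\<^esub> f j \<odot>\<^bsub>N\<^esub> w \<in> NN (Suc j)"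
    and next2: "\<And>j y. j \<le> n \<Longrightarrow> y \<in> NN (Suc j) \<Longrightarrow> \<exists>w\<in>carrier N. y \<ominus>\<^bsub>N\<^esub> f j \<odot>\<^bsub>N\<^esub> w \<in> NN j"
    and null: "\<And>j x. j \<le> n \<Longrightarrow> x \<in> carrier (P 0) \<Longrightarrow> f j \<odot>\<^bsub>P 0\<^esub> x \<in> d 0 ` carrier (P (Suc 0))"
    and "\<phi> \<in> module_hom R (P i) N" "\<And>x. x \<in> carrier (P (Suc i)) \<Longrightarrow> \<phi> (d i x) \<in> NN j" "i + j \<le> n"
  shows "case i of 0 \<Rightarrow> (\<forall>x\<in>carrier (P 0). \<phi> x \<in> NN j)
    | Suc i' \<Rightarrow> (\<exists>\<psi>\<in>module_hom R (P i') N. \<forall>x\<in>carrier (P i). \<phi> x \<ominus>\<^bsub>N\<^esub> \<psi> (d i' x) \<in> NN j)"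
  using assms(8-)
proof (induction i arbitrary: \<phi> j)
  case (0 \<phi> j)
  show ?case
  proof (simp, intro ballI)
    fix x assume x: "x \<in> carrier (P 0)"
    obtain y where "y \<in> carrier (P (Suc 0))" "f j \<odot>\<^bsub>P 0\<^esub> x = d 0 y"
      using null[of j x] x 0 by auto
    then have "f j \<odot>\<^bsub>N\<^esub> \<phi> x \<in> NN j"
      using 0(2)[of y] 0(3) f[of j] x module_homD(3)[OF 0(1), of "f j" x] by simp
    then show "\<phi> x \<in> NN j" using reg[of j "\<phi> x"] 0 x module_homD(1)[OF 0(1) x] by simp
  qed
next
  case (Suc i \<phi> j)
  interpret N: Module.module R N by (rule N)
  interpret P1: Module.module R "P (Suc i)" by (rule mod)
  note sub' = N.submoduleE[OF sub]
  have subm: "x \<ominus>\<^bsub>N\<^esub> y \<in> NN k" if "x \<in> NN k" "y \<in> NN k" for x y k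
    unfolding N.minus_eq using that sub'(3,5) by blast
  have zero: "\<zero>\<^bsub>N\<^esub> \<in> NN k" for k
    using subgroup.one_closed[OF submodule.axioms(1)[OF sub]] by simp
  have j: "j \<le> n" "f j \<in> carrier R" using Suc.prems f by auto
  obtain s where s: "\<And>k. s k \<in> module_hom R (P k) (P (Suc k))"
    "\<And>k x. x \<in> carrier (P (Suc k)) \<Longrightarrow>
      d (Suc k) (s (Suc k) x) = f j \<odot>\<^bsub>P (Suc k)\<^esub> x \<ominus>\<^bsub>P (Suc k)\<^esub> s k (d k x)"
    using null_homotopy[OF j(2) null[OF j(1)]] by blast
  define \<psi>0 where "\<psi>0 = (\<lambda>x. \<phi> (s i x))"
  have \<psi>0: "\<psi>0 \<in> module_hom R (P i) N"
    using module_hom_comp[OF s(1) Suc.prems(1)] by (simp add: \<psi>0_def o_def)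
  \<comment> \<open>The homotopy shows that \<open>f j\<close> times \<open>\<phi>\<close> is a coboundary modulo \<open>NN j\<close>.\<close>
  have homotopy: "f j \<odot>\<^bsub>N\<^esub> \<phi> x \<ominus>\<^bsub>N\<^esub> \<psi>0 (d i x) \<in> NN j" if x: "x \<in> carrier (P (Suc i))" for x
  proof -
    have "\<phi> (d (Suc i) (s (Suc i) x)) \<in> NN j"
      using Suc.prems(2) module_homD(1)[OF s(1) x] by blast
    moreover have "s i (d i x) \<in> carrier (P (Suc i))"
      using module_homD(1)[OF s(1) d_closed[OF x]] .
    ultimately show ?thesis
      using x j module_hom_minus[OF mod N Suc.prems(1), of "f j \<odot>\<^bsub>P (Suc i)\<^esub> x" "s i (d i x)"]
      by (simp add: s(2) \<psi>0_def module_homD[OF Suc.prems(1)])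
  qed
  have c: "\<phi> x \<in> carrier N" "\<psi>0 (d i x) \<in> carrier N" if "x \<in> carrier (P (Suc i))" for x
    using that module_homD(1)[OF Suc.prems(1)] module_homD(1)[OF \<psi>0] d_closed by auto
  have "\<psi>0 (d i x) \<in> NN (Suc j)" if x: "x \<in> carrier (P (Suc i))" for x
  proof -
    have "\<ominus>\<^bsub>N\<^esub> (f j \<odot>\<^bsub>N\<^esub> \<phi> x \<ominus>\<^bsub>N\<^esub> \<psi>0 (d i x)) \<oplus>\<^bsub>N\<^esub> f j \<odot>\<^bsub>N\<^esub> \<phi> x \<in> NN (Suc j)"
      using c[OF x] by (intro next1 j sub'(3) homotopy x)
    then show ?thesis using c[OF x] j by (simp add: N.minus_eq N.minus_add N.a_ac N.r_neg)
  qed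
  then have IH: "case i of 0 \<Rightarrow> (\<forall>x\<in>carrier (P 0). \<psi>0 x \<in> NN (Suc j))
    | Suc i' \<Rightarrow> (\<exists>\<psi>\<in>module_hom R (P i') N. \<forall>x\<in>carrier (P i). \<psi>0 x \<ominus>\<^bsub>N\<^esub> \<psi> (d i' x) \<in> NN (Suc j))"
    using Suc.prems(3) by (intro Suc.IH[OF \<psi>0]) auto
  \<comment> \<open>Subtracting a coboundary does not change \<open>\<psi>0\<close> after \<open>d i\<close>, but moves its values into \<open>NN (Suc j)\<close>.\<close>
  have "\<exists>\<rho>\<in>module_hom R (P i) N. (\<forall>x\<in>carrier (P i). \<rho> x \<in> NN (Suc j)) \<and>
      (\<forall>x\<in>carrier (P (Suc i)). \<rho> (d i x) = \<psi>0 (d i x))"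
  proof (cases i)
    case 0
    then show ?thesis using IH \<psi>0 by auto
  next
    case (Suc i')
    then obtain \<psi> where \<psi>: "\<psi> \<in> module_hom R (P i') N"
      "\<And>x. x \<in> carrier (P i) \<Longrightarrow> \<psi>0 x \<ominus>\<^bsub>N\<^esub> \<psi> (d i' x) \<in> NN (Suc j)"
      using IH by auto
    have "(\<lambda>x. \<psi>0 x \<ominus>\<^bsub>N\<^esub> \<psi> (d i' x)) \<in> module_hom R (P i) N"
      using module_hom_diff[OF N mod \<psi>0] module_hom_comp[OF d_hom \<psi>(1)] by (simp add: Suc o_def)
    moreover have "\<psi>0 (d i x) \<ominus>\<^bsub>N\<^esub> \<psi> (d i' (d i x)) = \<psi>0 (d i x)" if "x \<in> carrier (P (Suc i))" for x
      using that c[OF that] d_d[of x i'] module_hom_zero[OF mod N \<psi>(1)] by (simp add: Suc N.minus_eq)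
    ultimately show ?thesis using \<psi>(2) by (intro bexI) auto
  qed
  then obtain \<rho> where \<rho>: "\<rho> \<in> module_hom R (P i) N" "\<And>x. x \<in> carrier (P i) \<Longrightarrow> \<rho> x \<in> NN (Suc j)"
    "\<And>x. x \<in> carrier (P (Suc i)) \<Longrightarrow> \<rho> (d i x) = \<psi>0 (d i x)" by blast
  \<comment> \<open>Values in \<open>NN (Suc j)\<close> are divisible by \<open>f j\<close> modulo \<open>NN j\<close>, and the quotient can be chosen linearly.\<close>
  have "\<exists>\<omega>\<in>module_hom R (P i) N. \<forall>x\<in>carrier (P i). \<rho> x \<ominus>\<^bsub>N\<^esub> f j \<odot>\<^bsub>N\<^esub> \<omega> x \<in> NN j"
  proof (rule projective_rel_lift[OF proj N, of _ "\<lambda>x w. \<rho> x \<ominus>\<^bsub>N\<^esub> f j \<odot>\<^bsub>N\<^esub> w \<in> NN j"])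
    show "module_rel R (P i) N (\<lambda>x w. \<rho> x \<ominus>\<^bsub>N\<^esub> f j \<odot>\<^bsub>N\<^esub> w \<in> NN j)"
    proof (rule module_relI)
      fix x x' w w' assume h: "x \<in> carrier (P i)" "x' \<in> carrier (P i)" "w \<in> carrier N" "w' \<in> carrier N"
        "\<rho> x \<ominus>\<^bsub>N\<^esub> f j \<odot>\<^bsub>N\<^esub> w \<in> NN j" "\<rho> x' \<ominus>\<^bsub>N\<^esub> f j \<odot>\<^bsub>N\<^esub> w' \<in> NN j"
      have "\<rho> (x \<oplus>\<^bsub>P i\<^esub> x') \<ominus>\<^bsub>N\<^esub> f j \<odot>\<^bsub>N\<^esub> (w \<oplus>\<^bsub>N\<^esub> w') =
          (\<rho> x \<ominus>\<^bsub>N\<^esub> f j \<odot>\<^bsub>N\<^esub> w) \<oplus>\<^bsub>N\<^esub> (\<rho> x' \<ominus>\<^bsub>N\<^esub> f j \<odot>\<^bsub>N\<^esub> w')"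
        using h(1-4) j module_homD[OF \<rho>(1)]
        by (simp add: N.minus_eq N.minus_add N.smult_r_distr N.a_ac)
      then show "\<rho> (x \<oplus>\<^bsub>P i\<^esub> x') \<ominus>\<^bsub>N\<^esub> f j \<odot>\<^bsub>N\<^esub> (w \<oplus>\<^bsub>N\<^esub> w') \<in> NN j"
        using sub'(5) h(5,6) by simp
    next
      fix r x w assume h: "r \<in> carrier R" "x \<in> carrier (P i)" "w \<in> carrier N"
        "\<rho> x \<ominus>\<^bsub>N\<^esub> f j \<odot>\<^bsub>N\<^esub> w \<in> NN j"
      have "f j \<odot>\<^bsub>N\<^esub> (r \<odot>\<^bsub>N\<^esub> w) = r \<odot>\<^bsub>N\<^esub> (f j \<odot>\<^bsub>N\<^esub> w)"
        using h(1,3) j by (simp add: N.smult_assoc1[symmetric] m_comm)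
      then have "\<rho> (r \<odot>\<^bsub>P i\<^esub> x) \<ominus>\<^bsub>N\<^esub> f j \<odot>\<^bsub>N\<^esub> (r \<odot>\<^bsub>N\<^esub> w) = r \<odot>\<^bsub>N\<^esub> (\<rho> x \<ominus>\<^bsub>N\<^esub> f j \<odot>\<^bsub>N\<^esub> w)"
        using h(1-3) j module_homD[OF \<rho>(1)]
        by (simp add: N.minus_eq N.smult_r_distr N.smult_r_minus)
      then show "\<rho> (r \<odot>\<^bsub>P i\<^esub> x) \<ominus>\<^bsub>N\<^esub> f j \<odot>\<^bsub>N\<^esub> (r \<odot>\<^bsub>N\<^esub> w) \<in> NN j"
        using sub'(4) h(1,4) by simp
    qed
  qed (use \<rho>(2) next2 j in blast)
  then obtain \<omega> where \<omega>: "\<omega> \<in> module_hom R (P i) N"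
    "\<And>x. x \<in> carrier (P i) \<Longrightarrow> \<rho> x \<ominus>\<^bsub>N\<^esub> f j \<odot>\<^bsub>N\<^esub> \<omega> x \<in> NN j" by blast
  have "\<phi> x \<ominus>\<^bsub>N\<^esub> \<omega> (d i x) \<in> NN j" if x: "x \<in> carrier (P (Suc i))" for x
  proof -
    have w: "\<omega> (d i x) \<in> carrier N" using module_homD(1)[OF \<omega>(1) d_closed[OF x]] .
    have *: "(f j \<odot>\<^bsub>N\<^esub> \<phi> x \<ominus>\<^bsub>N\<^esub> \<psi>0 (d i x)) \<oplus>\<^bsub>N\<^esub> (\<psi>0 (d i x) \<ominus>\<^bsub>N\<^esub> f j \<odot>\<^bsub>N\<^esub> \<omega> (d i x)) \<in> NN j"
      using homotopy[OF x] \<omega>(2)[OF d_closed[OF x]] unfolding \<rho>(3)[OF x] by (rule sub'(5))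
    have fc: "f j \<odot>\<^bsub>N\<^esub> \<phi> x \<in> carrier N" "f j \<odot>\<^bsub>N\<^esub> \<omega> (d i x) \<in> carrier N"
      by (rule N.smult_closed[OF j(2) c(1)[OF x]], rule N.smult_closed[OF j(2) w])
    then have "(f j \<odot>\<^bsub>N\<^esub> \<phi> x \<ominus>\<^bsub>N\<^esub> \<psi>0 (d i x)) \<oplus>\<^bsub>N\<^esub> (\<psi>0 (d i x) \<ominus>\<^bsub>N\<^esub> f j \<odot>\<^bsub>N\<^esub> \<omega> (d i x)) =
        f j \<odot>\<^bsub>N\<^esub> \<phi> x \<ominus>\<^bsub>N\<^esub> f j \<odot>\<^bsub>N\<^esub> \<omega> (d i x)"
      using c(2)[OF x] by (intro N.minus_add_minus)
    moreover have "f j \<odot>\<^bsub>N\<^esub> \<phi> x \<ominus>\<^bsub>N\<^esub> f j \<odot>\<^bsub>N\<^esub> \<omega> (d i x) = f j \<odot>\<^bsub>N\<^esub> (\<phi> x \<ominus>\<^bsub>N\<^esub> \<omega> (d i x))"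
      unfolding N.minus_eq N.smult_r_distr[OF j(2) c(1)[OF x] N.a_inv_closed[OF w]]
        N.smult_r_minus[OF j(2) w] ..
    ultimately have "f j \<odot>\<^bsub>N\<^esub> (\<phi> x \<ominus>\<^bsub>N\<^esub> \<omega> (d i x)) \<in> NN j" using * by (simp only:)
    then show ?thesis by (rule reg[OF j(1) N.minus_closed[OF c(1)[OF x] w]])
  qed
  then have "\<forall>x\<in>carrier (P (Suc i)). \<phi> x \<ominus>\<^bsub>N\<^esub> \<omega> (d i x) \<in> NN j" by (rule ballI)
  then show ?case unfolding nat.case using \<omega>(1) by (rule bexI)
qed

end

primrec sequence_ideal :: "('r, 'x) ring_scheme \<Rightarrow> (nat \<Rightarrow> 'r) \<Rightarrow> nat \<Rightarrow> 'r set" where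
  "sequence_ideal R f 0 = {\<zero>\<^bsub>R\<^esub>}"
| "sequence_ideal R f (Suc j) =
    {a \<oplus>\<^bsub>R\<^esub> f j \<otimes>\<^bsub>R\<^esub> s | a s. a \<in> sequence_ideal R f j \<and> s \<in> carrier R}"

lemma (in cring) sequence_ideal:
  assumes f: "\<And>j. f j \<in> carrier R"
  shows "a \<in> sequence_ideal R f j \<Longrightarrow> a \<in> carrier R"
    "\<zero> \<in> sequence_ideal R f j"
    "a \<in> sequence_ideal R f j \<Longrightarrow> b \<in> sequence_ideal R f j \<Longrightarrow> a \<oplus> b \<in> sequence_ideal R f j"
    "r \<in> carrier R \<Longrightarrow> a \<in> sequence_ideal R f j \<Longrightarrow> r \<otimes> a \<in> sequence_ideal R f j"
proof -
  show c: "a \<in> carrier R" if "a \<in> sequence_ideal R f j" for a j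
    using that by (induction j arbitrary: a) (auto simp: f)
  show "\<zero> \<in> sequence_ideal R f j"
  proof (induction j)
    case (Suc j)
    have "\<zero> = \<zero> \<oplus> f j \<otimes> \<zero>" by (simp add: f)
    then show ?case using Suc unfolding sequence_ideal.simps by blast
  qed simp
  show "a \<oplus> b \<in> sequence_ideal R f j" if "a \<in> sequence_ideal R f j" "b \<in> sequence_ideal R f j"
    using that
  proof (induction j arbitrary: a b)
    case (Suc j)
    then obtain a' s b' t where h: "a' \<in> sequence_ideal R f j" "s \<in> carrier R" "a = a' \<oplus> f j \<otimes> s"
      "b' \<in> sequence_ideal R f j" "t \<in> carrier R" "b = b' \<oplus> f j \<otimes> t" by auto
    then have "a \<oplus> b = (a' \<oplus> b') \<oplus> f j \<otimes> (s \<oplus> t)"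
      using c[OF h(1)] c[OF h(4)] f by (simp add: r_distr a_ac)
    then show ?case using Suc.IH[OF h(1,4)] h(2,5) by auto
  qed simp
  show "r \<otimes> a \<in> sequence_ideal R f j" if "r \<in> carrier R" "a \<in> sequence_ideal R f j"
    using that
  proof (induction j arbitrary: a)
    case (Suc j)
    then obtain a' s where h: "a' \<in> sequence_ideal R f j" "s \<in> carrier R" "a = a' \<oplus> f j \<otimes> s" by auto
    then have "r \<otimes> a = r \<otimes> a' \<oplus> f j \<otimes> (r \<otimes> s)"
      using c[OF h(1)] f Suc.prems(1) by (simp add: r_distr m_lcomm)
    then show ?case using Suc.IH[OF Suc.prems(1) h(1)] h(2) Suc.prems(1) by auto
  qed simp
qed

context projective_resolution_of
begin

context
  fixes n :: nat and f :: "nat \<Rightarrow> 'r"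
  assumes f: "\<And>j. f j \<in> carrier R"
    and reg: "\<And>j s. j \<le> n \<Longrightarrow> s \<in> carrier R \<Longrightarrow> f j \<otimes> s \<in> sequence_ideal R f j \<Longrightarrow> s \<in> sequence_ideal R f j"
    and annihilates: "\<And>j x. j \<le> n \<Longrightarrow> x \<in> carrier M \<Longrightarrow> f j \<odot>\<^bsub>M\<^esub> x = \<zero>\<^bsub>M\<^esub>"
begin

text \<open>A sequence that is regular on \<open>R\<close> is regular on every free module, coordinate by coordinate. The
quotient in \<open>y = a + f j w\<close> is taken to be zero where \<open>y\<close> is, to keep the support finite.\<close>

lemma cocycle_is_coboundary_free:
  fixes J :: "'i set"
  assumes "\<phi> \<in> module_hom R (P i) (free_module R J)"
    and "\<And>x. x \<in> carrier (P (Suc i)) \<Longrightarrow> \<phi> (d i x) = \<zero>\<^bsub>free_module R J\<^esub>" and "i \<le> n"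
  shows "i = 0 \<Longrightarrow> x \<in> carrier (P 0) \<Longrightarrow> \<phi> x = \<zero>\<^bsub>free_module R J\<^esub>"
    and "i = Suc i' \<Longrightarrow> \<exists>\<psi>\<in>module_hom R (P i') (free_module R J). \<forall>x\<in>carrier (P i). \<phi> x = \<psi> (d i' x)"
proof -
  define F where "F = free_module R J"
  interpret F: Module.module R F unfolding F_def by (rule module_free_module)
  interpret P0: Module.module R "P 0" by (rule mod)
  note I = sequence_ideal[of f, OF f]
  define NN where "NN j = {y \<in> carrier F. \<forall>k. y k \<in> sequence_ideal R f j}" for j
  have Fc: "y k \<in> carrier R" if "y \<in> carrier F" for y k
    using that by (simp add: F_def free_module_carrier_iff)
  have ops: "(x \<oplus>\<^bsub>F\<^esub> y) k = x k \<oplus> y k" "(r \<odot>\<^bsub>F\<^esub> x) k = r \<otimes> x k" "\<zero>\<^bsub>F\<^esub> k = \<zero>" for x y k r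
    by (simp_all add: F_def free_module_simps)
  have minus: "(x \<ominus>\<^bsub>F\<^esub> y) k = x k \<ominus> y k" if "x \<in> carrier F" "y \<in> carrier F" for x y k
  proof -
    have "y k \<oplus> (x \<ominus>\<^bsub>F\<^esub> y) k = x k"
      using arg_cong[OF F.add_minus_cancel[OF that], of "\<lambda>g. g k"] by (simp only: ops)
    then show ?thesis
      using add_diff_cancel[of "y k" "(x \<ominus>\<^bsub>F\<^esub> y) k"] Fc that by simp
  qed
  have sub: "submodule (NN j) R F" for j
  proof (rule F.submoduleI)
    fix x assume x: "x \<in> NN j"
    have "(\<ominus> \<one>) \<odot>\<^bsub>F\<^esub> x \<in> NN j" using x I(4) by (auto simp: NN_def ops)
    then show "\<ominus>\<^bsub>F\<^esub> x \<in> NN j" using x by (simp add: F.smult_l_minus NN_def)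
  qed (use I in \<open>auto simp: NN_def ops\<close>)
  have 1: "y \<in> NN j" if "j \<le> n" "y \<in> carrier F" "f j \<odot>\<^bsub>F\<^esub> y \<in> NN j" for j y
    using that reg Fc by (simp add: NN_def ops)
  have 2: "y \<oplus>\<^bsub>F\<^esub> f j \<odot>\<^bsub>F\<^esub> w \<in> NN (Suc j)" if "y \<in> NN j" "w \<in> carrier F" for j y w
  proof -
    have "y k \<oplus> f j \<otimes> w k \<in> sequence_ideal R f (Suc j)" for k
      using that(1) Fc[OF that(2)] by (auto simp: NN_def)
    then show ?thesis using that f by (simp add: NN_def ops)
  qed
  have 3: "\<exists>w\<in>carrier F. y \<ominus>\<^bsub>F\<^esub> f j \<odot>\<^bsub>F\<^esub> w \<in> NN j" if y: "y \<in> NN (Suc j)" for j y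
  proof -
    have "\<exists>s. s \<in> carrier R \<and> (y k = \<zero> \<longrightarrow> s = \<zero>) \<and> y k \<ominus> f j \<otimes> s \<in> sequence_ideal R f j" for k
    proof (cases "y k = \<zero>")
      case True
      then show ?thesis using I(2) f by (intro exI[of _ \<zero>]) (simp add: minus_eq)
    next
      case False
      have "y k \<in> sequence_ideal R f (Suc j)" using y by (simp add: NN_def)
      then obtain a s where "y k = a \<oplus> f j \<otimes> s" "a \<in> sequence_ideal R f j" "s \<in> carrier R"
        by auto
      then show ?thesis using False f I(1) by (intro exI[of _ s]) (simp add: minus_eq a_assoc r_neg)
    qed
    then obtain w where w: "\<And>k. w k \<in> carrier R" "\<And>k. y k = \<zero> \<Longrightarrow> w k = \<zero>"
      "\<And>k. y k \<ominus> f j \<otimes> w k \<in> sequence_ideal R f j" by metis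
    have yF: "y \<in> carrier F" using y by (simp add: NN_def)
    have "{k. w k \<noteq> \<zero>} \<subseteq> {k. y k \<noteq> \<zero>}" using w(2) by auto
    then have wF: "w \<in> carrier F"
      using yF w finite_subset unfolding F_def free_module_carrier_iff by auto
    then show ?thesis
      using w(3) yF f by (intro bexI[of _ w]) (simp_all add: NN_def minus ops)
  qed
  have 4: "f j \<odot>\<^bsub>P 0\<^esub> x \<in> d 0 ` carrier (P (Suc 0))" if "j \<le> n" "x \<in> carrier (P 0)" for j x
    using that f annihilates module_homD[OF eps_hom] by (simp add: exact0)
  have NN0: "NN 0 = {\<zero>\<^bsub>F\<^esub>}"
    using F.zero_closed by (auto simp: NN_def ops fun_eq_iff)
  have key: "case i of 0 \<Rightarrow> (\<forall>x\<in>carrier (P 0). \<phi> x \<in> NN 0)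
    | Suc i' \<Rightarrow> (\<exists>\<psi>\<in>module_hom R (P i') F. \<forall>x\<in>carrier (P i). \<phi> x \<ominus>\<^bsub>F\<^esub> \<psi> (d i' x) \<in> NN 0)"
  proof (rule cocycle_is_coboundary[where n = n and f = f])
    show "Module.module R F" "\<phi> \<in> module_hom R (P i) F" "i + 0 \<le> n"
      using assms(1,3) F.module_axioms by (simp_all add: F_def)
    show "\<phi> (d i x) \<in> NN 0" if "x \<in> carrier (P (Suc i))" for x
      using assms(2)[OF that] by (simp add: NN0 F_def)
  qed (rule f, rule sub, (rule 1; assumption), (rule 2; assumption), (rule 3; assumption),
    (rule 4; assumption))
  show "\<phi> x = \<zero>\<^bsub>free_module R J\<^esub>" if "i = 0" "x \<in> carrier (P 0)"
    using key that by (simp add: NN0 F_def)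
  show "\<exists>\<psi>\<in>module_hom R (P i') (free_module R J). \<forall>x\<in>carrier (P i). \<phi> x = \<psi> (d i' x)"
    if i: "i = Suc i'"
  proof -
    obtain \<psi> where \<psi>: "\<psi> \<in> module_hom R (P i') F"
      "\<And>x. x \<in> carrier (P i) \<Longrightarrow> \<phi> x \<ominus>\<^bsub>F\<^esub> \<psi> (d i' x) = \<zero>\<^bsub>F\<^esub>"
      using key i by (auto simp: NN0)
    have "\<phi> x = \<psi> (d i' x)" if "x \<in> carrier (P i)" for x
    proof (rule F.eq_if_minus_eq_zero)
      show "\<phi> x \<in> carrier F" using module_homD(1)[OF assms(1) that] by (simp add: F_def)
      show "\<psi> (d i' x) \<in> carrier F" using module_homD(1)[OF \<psi>(1)] d_closed that i by simp
    qed (rule \<psi>(2)[OF that])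
    then show ?thesis using \<psi>(1) by (auto simp: F_def)
  qed
qed

text \<open>A projective module is a summand of a free one, and the primitive found in the free module is projected
back to the summand.\<close>

lemma cocycle_is_coboundary_projective:
  fixes L :: "('r, 'l, 'w) module_scheme"
  assumes L: "projective_module R L" and \<phi>: "\<phi> \<in> module_hom R (P i) L"
    and cocycle: "\<And>x. x \<in> carrier (P (Suc i)) \<Longrightarrow> \<phi> (d i x) = \<zero>\<^bsub>L\<^esub>" and "i \<le> n"
  shows "i = 0 \<Longrightarrow> x \<in> carrier (P 0) \<Longrightarrow> \<phi> x = \<zero>\<^bsub>L\<^esub>"
    and "i = Suc i' \<Longrightarrow> \<exists>\<psi>\<in>module_hom R (P i') L. \<forall>x\<in>carrier (P i). \<phi> x = \<psi> (d i' x)"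
proof -
  obtain J :: "'l set" and \<alpha> Q where L': "Module.module R L" and emb: "\<alpha> \<in> module_hom R L (free_module R J)"
    "inj_on \<alpha> (carrier L)" "submodule Q R (free_module R J)"
    "\<alpha> ` carrier L \<inter> Q = {\<zero>\<^bsub>free_module R J\<^esub>}"
    "\<alpha> ` carrier L <+>\<^bsub>free_module R J\<^esub> Q = carrier (free_module R J)"
    using L by (rule projective_moduleE) (rule that)
  note dec = projective_decomposition[OF L' emb]
  define F where "F = free_module R J"
  interpret F: Module.module R F unfolding F_def by (rule module_free_module)
  interpret L: Module.module R L by (rule L')
  have \<alpha>: "\<alpha> \<in> module_hom R L F" unfolding F_def by (rule emb)
  have \<alpha>0: "\<alpha> \<zero>\<^bsub>L\<^esub> = \<zero>\<^bsub>F\<^esub>" by (rule module_hom_zero[OF L' F.module_axioms \<alpha>])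
  have c: "(\<alpha> \<circ> \<phi>) (d i x) = \<zero>\<^bsub>free_module R J\<^esub>" if "x \<in> carrier (P (Suc i))" for x
    using cocycle[OF that] \<alpha>0 by (simp add: F_def)
  note free = cocycle_is_coboundary_free[OF module_hom_comp[OF \<phi> emb(1)] _ \<open>i \<le> n\<close>]
  show "\<phi> x = \<zero>\<^bsub>L\<^esub>" if "i = 0" "x \<in> carrier (P 0)"
    using free(1)[OF c that] \<alpha>0 module_homD(1)[OF \<phi>, of x] that
    by (intro inj_onD[OF emb(2)]) (auto simp: F_def)
  show "\<exists>\<psi>\<in>module_hom R (P i') L. \<forall>x\<in>carrier (P i). \<phi> x = \<psi> (d i' x)" if i: "i = Suc i'"
  proof -
    obtain \<psi> where \<psi>: "\<psi> \<in> module_hom R (P i') F" "\<And>x. x \<in> carrier (P i) \<Longrightarrow> \<alpha> (\<phi> x) = \<psi> (d i' x)"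
      using free(2)[OF c i] by (auto simp: F_def)
    define Rel where "Rel x p \<longleftrightarrow> (\<exists>q\<in>Q. \<psi> x = \<alpha> p \<oplus>\<^bsub>F\<^esub> q)" for x p
    note lin = dec(3)[folded F_def]
    have "module_rel R (P i') L Rel"
    proof (rule module_relI)
      fix x x' y y' assume "x \<in> carrier (P i')" "x' \<in> carrier (P i')" "y \<in> carrier L" "y' \<in> carrier L"
        "Rel x y" "Rel x' y'"
      then show "Rel (x \<oplus>\<^bsub>P i'\<^esub> x') (y \<oplus>\<^bsub>L\<^esub> y')"
        using module_relD(1)[OF lin, of "\<psi> x" "\<psi> x'" y y'] module_homD(1,2)[OF \<psi>(1)]
        unfolding Rel_def by simp
    next
      fix r x y assume "r \<in> carrier R" "x \<in> carrier (P i')" "y \<in> carrier L" "Rel x y"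
      then show "Rel (r \<odot>\<^bsub>P i'\<^esub> x) (r \<odot>\<^bsub>L\<^esub> y)"
        using module_relD(2)[OF lin, of r "\<psi> x" y] module_homD(1,3)[OF \<psi>(1)]
        unfolding Rel_def by simp
    qed
    moreover have "\<exists>y\<in>carrier L. Rel x y" if "x \<in> carrier (P i')" for x
      using dec(1)[folded F_def, OF module_homD(1)[OF \<psi>(1) that]] unfolding Rel_def .
    ultimately obtain h where h: "h \<in> module_hom R (P i') L" "\<And>x. x \<in> carrier (P i') \<Longrightarrow> Rel x (h x)"
      using projective_rel_lift[OF proj L', of i' Rel] by blast
    have "\<phi> x = h (d i' x)" if x: "x \<in> carrier (P i)" for x
    proof -
      have dx: "d i' x \<in> carrier (P i')" using x d_closed i by simp
      obtain q where "q \<in> Q" "\<alpha> (\<phi> x) = \<alpha> (h (d i' x)) \<oplus>\<^bsub>F\<^esub> q"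
        using h(2)[OF dx] \<psi>(2)[OF x] by (auto simp: Rel_def)
      then show ?thesis
        using dec(2)[folded F_def, OF module_homD(1)[OF \<phi> x] module_homD(1)[OF h(1) dx]] by blast
    qed
    then show ?thesis using h(1) by blast
  qed
qed

text \<open>If the resolution ends at \<open>P n\<close>, the identity of \<open>P n\<close> is a cocycle, hence factors through \<open>P (n - 1)\<close>.
Continuing downwards the whole augmented complex splits, and in degree \<open>0\<close>, where a cocycle vanishes,
this means that \<open>P 1\<close> maps onto \<open>P 0\<close>.\<close>

theorem zero_if_short_resolution:
  assumes short: "carrier (P (Suc n)) = {\<zero>\<^bsub>P (Suc n)\<^esub>}"
  shows "carrier M = {\<zero>\<^bsub>M\<^esub>}"
proof -
  have retract: "(\<lambda>x. x \<ominus>\<^bsub>P i\<^esub> d i (\<tau> x)) \<in> module_hom R (P i) (P i)"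
    if "\<tau> \<in> module_hom R (P i) (P (Suc i))" for i \<tau>
    using module_hom_diff[OF mod mod module_hom_id module_hom_comp[OF that d_hom]] by (simp add: o_def)
  have vanish: "d i z \<ominus>\<^bsub>P i\<^esub> d i (\<tau> (d i z)) = \<zero>\<^bsub>P i\<^esub>"
    if "z \<in> carrier (P (Suc i))" "d i (\<tau> (d i z)) = d i z" for i z \<tau>
  proof -
    interpret Pi: Module.module R "P i" by (rule mod)
    show ?thesis using that d_closed[OF that(1)] by (simp add: Pi.minus_eq Pi.r_neg)
  qed
  \<comment> \<open>The inclusion of the image of \<open>d i\<close> into \<open>P i\<close> splits. Going down from \<open>n\<close>, the identity minus
    the splitting of the step before is a cocycle, and its primitive is the next splitting.\<close>
  have split: "\<exists>\<tau>\<in>module_hom R (P i) (P (Suc i)). \<forall>z\<in>carrier (P (Suc i)). d i (\<tau> (d i z)) = d i z"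
    if "i \<le> n" for i
    using that
  proof (induction i rule: inc_induct)
    case base
    interpret P': Module.module R "P (Suc n)" by (rule mod)
    have "(\<lambda>x. \<zero>\<^bsub>P (Suc n)\<^esub>) \<in> module_hom R (P n) (P (Suc n))"
      by (auto simp: module_hom_def)
    moreover have "d n z = d n \<zero>\<^bsub>P (Suc n)\<^esub>" if "z \<in> carrier (P (Suc n))" for z
      using that short by simp
    ultimately show ?case
      by (intro bexI[of _ "\<lambda>x. \<zero>\<^bsub>P (Suc n)\<^esub>"] ballI) (simp_all only:)
  next
    case (step i)
    interpret Pi: Module.module R "P i" by (rule mod)
    obtain \<tau> where \<tau>: "\<tau> \<in> module_hom R (P (Suc i)) (P (Suc (Suc i)))"
      "\<And>z. z \<in> carrier (P (Suc (Suc i))) \<Longrightarrow> d (Suc i) (\<tau> (d (Suc i) z)) = d (Suc i) z"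
      using step.IH by blast
    have "Suc i \<le> n" using step.hyps by simp
    then obtain \<psi> where \<psi>: "\<psi> \<in> module_hom R (P i) (P (Suc i))"
      "\<And>x. x \<in> carrier (P (Suc i)) \<Longrightarrow> x \<ominus>\<^bsub>P (Suc i)\<^esub> d (Suc i) (\<tau> x) = \<psi> (d i x)"
      using cocycle_is_coboundary_projective(2)[OF proj retract[OF \<tau>(1)], of i] vanish[where \<tau> = \<tau>] \<tau>(2)
      by blast
    have "d i (\<psi> (d i x)) = d i x" if x: "x \<in> carrier (P (Suc i))" for x
    proof -
      have \<tau>x: "\<tau> x \<in> carrier (P (Suc (Suc i)))" by (rule module_homD(1)[OF \<tau>(1) x])
      have "d i (\<psi> (d i x)) = d i x \<ominus>\<^bsub>P i\<^esub> d i (d (Suc i) (\<tau> x))"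
        unfolding \<psi>(2)[OF x, symmetric]
        by (rule module_hom_minus[OF mod mod d_hom x d_closed[OF \<tau>x]])
      then show ?thesis using d_d[OF \<tau>x] d_closed[OF x] by (simp add: Pi.minus_eq)
    qed
    then show ?case using \<psi>(1) by blast
  qed
  obtain \<tau> where \<tau>: "\<tau> \<in> module_hom R (P 0) (P (Suc 0))"
    "\<And>z. z \<in> carrier (P (Suc 0)) \<Longrightarrow> d 0 (\<tau> (d 0 z)) = d 0 z"
    using split[of 0] by blast
  interpret P0: Module.module R "P 0" by (rule mod)
  have "\<epsilon> x = \<zero>\<^bsub>M\<^esub>" if x: "x \<in> carrier (P 0)" for x
  proof -
    have \<tau>x: "\<tau> x \<in> carrier (P (Suc 0))" by (rule module_homD(1)[OF \<tau>(1) x])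
    have "x \<ominus>\<^bsub>P 0\<^esub> d 0 (\<tau> x) = \<zero>\<^bsub>P 0\<^esub>"
      using cocycle_is_coboundary_projective(1)[OF proj retract[OF \<tau>(1)] _ _ refl x]
        vanish[where \<tau> = \<tau>] \<tau>(2) by blast
    then have "x = d 0 (\<tau> x)" by (rule P0.eq_if_minus_eq_zero[OF x d_closed[OF \<tau>x]])
    then show ?thesis using exact0 \<tau>x by blast
  qed
  then have "\<epsilon> ` carrier (P 0) = (\<lambda>_. \<zero>\<^bsub>M\<^esub>) ` carrier (P 0)"
    by (intro image_cong refl)
  then show ?thesis
    unfolding eps_onto using image_constant[OF P0.zero_closed] by simp
qed

end

end

section \<open>Projective dimension of subquotients of free modules\<close>

text \<open>All modules of this section are subquotients of the module of finitely supported sequences. With the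
convolution product these sequences are the polynomials in one variable, so that scalar multiplication
is multiplication by a constant, and the module laws are ring laws.\<close>

definition scal :: "'r::comm_ring_1 \<Rightarrow> (nat \<Rightarrow>\<^sub>0 'r) \<Rightarrow> (nat \<Rightarrow>\<^sub>0 'r)"
  where "scal r c = single 0 r * c"

lemma lookup_scal [simp]: "lookup (scal r c) j = r * lookup c j"
  unfolding scal_def mult_map_scale_conv_mult[symmetric]
  by (simp add: Poly_Mapping.map.rep_eq when_def)

lemma scal_add_right: "scal r (x + y) = scal r x + scal r y"
  by (simp add: scal_def distrib_left)

lemma scal_add_left: "scal (r + s) x = scal r x + scal s x"
  by (rule poly_mapping_eqI) (simp add: lookup_add distrib_right)

lemma scal_scal: "scal r (scal s x) = scal (r * s) x"
  by (rule poly_mapping_eqI) (simp add: mult.assoc)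

lemma scal_one [simp]: "scal 1 x = x" and scal_zero_left [simp]: "scal 0 x = 0"
  and scal_zero_right [simp]: "scal r 0 = 0" and scal_minus_one: "scal (- 1) x = - x"
  by (auto intro: poly_mapping_eqI)

lemma scal_diff: "scal r (x - y) = scal r x - scal r y"
  by (simp add: scal_def right_diff_distrib)

lemma scal_sum: "scal r (sum f A) = (\<Sum>i\<in>A. scal r (f i))"
  by (simp add: scal_def sum_distrib_left)

definition lincomb :: "(nat \<Rightarrow> (nat \<Rightarrow>\<^sub>0 'r::comm_ring_1)) \<Rightarrow> (nat \<Rightarrow>\<^sub>0 'r) \<Rightarrow> (nat \<Rightarrow>\<^sub>0 'r)"
  where "lincomb y c = (\<Sum>j\<in>keys c. scal (lookup c j) (y j))"

lemma scal_single: "scal r (single 0 p) = single 0 (r * p)"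
  by (simp add: scal_def mult_single)

lemma lincomb_superset:
  "finite A \<Longrightarrow> keys c \<subseteq> A \<Longrightarrow>
    lincomb y c = (\<Sum>j\<in>A. scal (lookup c j) (y j))"
  unfolding lincomb_def by (rule sum.mono_neutral_left) (auto simp: in_keys_iff)

lemma lincomb_add: "lincomb y (c + c') = lincomb y c + lincomb y c'"
proof -
  let ?A = "keys c \<union> keys c'"
  have "lincomb y (c + c') = (\<Sum>j\<in>?A. scal (lookup (c + c') j) (y j))"
    by (intro lincomb_superset) (auto simp: keys_add)
  moreover have "lincomb y c = (\<Sum>j\<in>?A. scal (lookup c j) (y j))"
    "lincomb y c' = (\<Sum>j\<in>?A. scal (lookup c' j) (y j))"
    by (intro lincomb_superset; auto)+
  ultimately show ?thesis by (simp add: lookup_add scal_add_left sum.distrib)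
qed

lemma lincomb_scal: "lincomb y (scal r c) = scal r (lincomb y c)"
proof -
  have "lincomb y (scal r c) =
      (\<Sum>j\<in>keys c. scal (lookup (scal r c) j) (y j))"
    by (intro lincomb_superset) (auto simp: in_keys_iff)
  then show ?thesis by (simp add: lincomb_def scal_sum scal_scal)
qed

lemma lincomb_zero [simp]: "lincomb y 0 = 0"
  by (simp add: lincomb_def)

lemma lincomb_single [simp]: "lincomb y (single j 1) = y j"
  by (simp add: lincomb_def)

lemma lincomb_uminus: "lincomb y (- c) = - lincomb y c"
  by (metis lincomb_scal scal_minus_one)

lemma lincomb_sum: "lincomb y (sum f A) = (\<Sum>i\<in>A. lincomb y (f i))"
  by (induction A rule: infinite_finite_induct) (auto simp: lincomb_add)

lemma lincomb_lincomb: "lincomb y (lincomb y' c) = lincomb (\<lambda>j. lincomb y (y' j)) c"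
  by (simp add: lincomb_def[of y' c] lincomb_sum lincomb_scal lincomb_def[of _ c])

lemma lincomb_fun_add: "lincomb (\<lambda>j. y j + y' j) c = lincomb y c + lincomb y' c"
  by (simp add: lincomb_def scal_add_right sum.distrib)

lemma lookup_lincomb:
  "lookup (lincomb y c) i =
    (\<Sum>j\<in>keys c. lookup c j * lookup (y j) i)"
  by (simp add: lincomb_def lookup_sum)

lemma lincomb_basis [simp]: "lincomb (\<lambda>j. single j 1) c = c"
proof (rule poly_mapping_eqI)
  fix i
  have "lookup (lincomb (\<lambda>j. single j 1) c) i =
      (\<Sum>j\<in>keys c. if j = i then lookup c j else 0)"
    unfolding lookup_lincomb by (rule sum.cong) (auto simp: lookup_single when_def)
  also have "\<dots> = lookup c i"
    by (auto simp: in_keys_iff)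
  finally show "lookup (lincomb (\<lambda>j. single j 1) c) i =
    lookup c i" .
qed

text \<open>The sequences at even and at odd positions are two complementary copies of the module of all sequences.
They serve to form direct sums.\<close>

definition emb1 :: "(nat \<Rightarrow>\<^sub>0 'r::comm_ring_1) \<Rightarrow> (nat \<Rightarrow>\<^sub>0 'r)"
  where "emb1 = lincomb (\<lambda>j. single (2 * j) 1)"

definition emb2 :: "(nat \<Rightarrow>\<^sub>0 'r::comm_ring_1) \<Rightarrow> (nat \<Rightarrow>\<^sub>0 'r)"
  where "emb2 = lincomb (\<lambda>j. single (2 * j + 1) 1)"

definition proj1 :: "(nat \<Rightarrow>\<^sub>0 'r::comm_ring_1) \<Rightarrow> (nat \<Rightarrow>\<^sub>0 'r)"
  where "proj1 = lincomb (\<lambda>i. if even i then single (i div 2) 1 else 0)"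

definition proj2 :: "(nat \<Rightarrow>\<^sub>0 'r::comm_ring_1) \<Rightarrow> (nat \<Rightarrow>\<^sub>0 'r)"
  where "proj2 = lincomb (\<lambda>i. if even i then 0 else single (i div 2) 1)"

lemma lincomb_const_zero [simp]: "lincomb (\<lambda>j. 0) c = 0"
  by (simp add: lincomb_def)

lemma proj_emb [simp]:
  "proj1 (emb1 c) = c" "proj2 (emb1 c) = 0" "proj1 (emb2 c) = 0" "proj2 (emb2 c) = c"
  by (simp_all add: proj1_def proj2_def emb1_def emb2_def lincomb_lincomb)

lemma emb_proj: "emb1 (proj1 c) + emb2 (proj2 c) = c"
proof -
  have "emb1 (proj1 c) + emb2 (proj2 c) = lincomb (\<lambda>i. single i 1) c"
    unfolding emb1_def emb2_def proj1_def proj2_def lincomb_lincomb lincomb_fun_add[symmetric]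
    by (rule arg_cong[where f = "\<lambda>y. lincomb y c"]) (auto simp: fun_eq_iff)
  then show ?thesis by simp
qed

lemmas emb_proj_linear =
  lincomb_add[of "\<lambda>j. single (2 * j) 1", folded emb1_def]
  lincomb_scal[of "\<lambda>j. single (2 * j) 1", folded emb1_def]
  lincomb_zero[of "\<lambda>j. single (2 * j) 1", folded emb1_def]
  lincomb_add[of "\<lambda>j. single (2 * j + 1) 1", folded emb2_def]
  lincomb_scal[of "\<lambda>j. single (2 * j + 1) 1", folded emb2_def]
  lincomb_zero[of "\<lambda>j. single (2 * j + 1) 1", folded emb2_def]
  lincomb_add[of "\<lambda>i. if even i then single (i div 2) 1 else 0", folded proj1_def]
  lincomb_scal[of "\<lambda>i. if even i then single (i div 2) 1 else 0", folded proj1_def]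
  lincomb_zero[of "\<lambda>i. if even i then single (i div 2) 1 else 0", folded proj1_def]
  lincomb_add[of "\<lambda>i. if even i then 0 else single (i div 2) 1", folded proj2_def]
  lincomb_scal[of "\<lambda>i. if even i then 0 else single (i div 2) 1", folded proj2_def]
  lincomb_zero[of "\<lambda>i. if even i then 0 else single (i div 2) 1", folded proj2_def]

lemma lookup_proj1 [simp]: "lookup (proj1 c) j = lookup c (2 * j)"
proof -
  have "lookup (proj1 c) j =
      (\<Sum>i\<in>keys c. if i = 2 * j then lookup c i else 0)"
    unfolding proj1_def lookup_lincomb
    by (rule sum.cong) (auto simp: lookup_single when_def)
  then show ?thesis by (auto simp: in_keys_iff)
qed

lemma lookup_proj2 [simp]: "lookup (proj2 c) j = lookup c (2 * j + 1)"
proof -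
  have "lookup (proj2 c) j =
      (\<Sum>i\<in>keys c. if i = 2 * j + 1 then lookup c i else 0)"
    unfolding proj2_def lookup_lincomb
    by (rule sum.cong) (auto simp: lookup_single when_def elim!: oddE)
  then show ?thesis by (auto simp: in_keys_iff)
qed

definition interleave :: "(nat \<Rightarrow> 'a) \<Rightarrow> (nat \<Rightarrow> 'a) \<Rightarrow> nat \<Rightarrow> 'a"
  where "interleave y y' i = (if even i then y (i div 2) else y' (i div 2))"

lemma lincomb_interleave:
  "lincomb (interleave y y') c = lincomb y (proj1 c) + lincomb y' (proj2 c)"
  unfolding proj1_def proj2_def lincomb_lincomb lincomb_fun_add[symmetric]
  by (rule arg_cong[where f = "\<lambda>y. lincomb y c"]) (auto simp: fun_eq_iff interleave_def)

text \<open>The ring of coefficients is a subset of a type, because the polynomial rings in question depend on the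
number of stages.\<close>

locale coefficient_ring =
  fixes S :: "'r::comm_ring_1 set"
  assumes zero_in [simp]: "0 \<in> S" and one_in [simp]: "1 \<in> S"
    and add_in: "a \<in> S \<Longrightarrow> b \<in> S \<Longrightarrow> a + b \<in> S"
    and mult_in: "a \<in> S \<Longrightarrow> b \<in> S \<Longrightarrow> a * b \<in> S"
    and uminus_in: "a \<in> S \<Longrightarrow> - a \<in> S"
begin

definition free_on :: "nat set \<Rightarrow> (nat \<Rightarrow>\<^sub>0 'r) set"
  where "free_on J = {c. \<forall>j. lookup c j \<in> S \<and> (j \<notin> J \<longrightarrow> lookup c j = 0)}"

definition submod :: "(nat \<Rightarrow>\<^sub>0 'r) set \<Rightarrow> bool"
  where "submod U \<longleftrightarrow> 0 \<in> U \<and> (\<forall>u\<in>U. \<forall>v\<in>U. u + v \<in> U) \<and> (\<forall>r\<in>S. \<forall>u\<in>U. scal r u \<in> U)"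

lemma submodD:
  assumes "submod U"
  shows "0 \<in> U" "u \<in> U \<Longrightarrow> v \<in> U \<Longrightarrow> u + v \<in> U" "r \<in> S \<Longrightarrow> u \<in> U \<Longrightarrow> scal r u \<in> U"
    "u \<in> U \<Longrightarrow> - u \<in> U" "u \<in> U \<Longrightarrow> v \<in> U \<Longrightarrow> u - v \<in> U"
proof -
  show 0: "0 \<in> U" "u \<in> U \<Longrightarrow> v \<in> U \<Longrightarrow> u + v \<in> U" "r \<in> S \<Longrightarrow> u \<in> U \<Longrightarrow> scal r u \<in> U" for u v r
    using assms by (auto simp: submod_def)
  show m: "u \<in> U \<Longrightarrow> - u \<in> U" for u
    using 0(3)[of "-1" u] by (simp add: uminus_in scal_minus_one)
  show "u \<in> U \<Longrightarrow> v \<in> U \<Longrightarrow> u - v \<in> U"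
    using 0(2)[of u "- v"] m[of v] by simp
qed

lemma submod_zero [simp]: "submod {0}"
  by (simp add: submod_def)

lemma submod_free_on: "submod (free_on J)"
  by (auto simp: submod_def free_on_def lookup_add add_in mult_in)

lemma submod_lincomb_vimage: "submod U \<Longrightarrow> submod {c \<in> free_on J. lincomb y c \<in> U}"
  using submod_free_on[of J]
  by (auto simp: submod_def lincomb_add lincomb_scal)

lemma submod_vimage:
  assumes "submod U" "h 0 = 0" "\<And>x y. h (x + y) = h x + h y" "\<And>r x. h (scal r x) = scal r (h x)"
  shows "submod {x. h x \<in> U}"
  using assms by (auto simp: submod_def)

lemma submod_Int: "submod U \<Longrightarrow> submod V \<Longrightarrow> submod (U \<inter> V)"
  by (auto simp: submod_def)

definition linear_rel :: "((nat \<Rightarrow>\<^sub>0 'r) \<Rightarrow> (nat \<Rightarrow>\<^sub>0 'r) \<Rightarrow> bool) \<Rightarrow> bool"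
  where "linear_rel Q \<longleftrightarrow> Q 0 0 \<and> (\<forall>u v u' v'. Q u u' \<longrightarrow> Q v v' \<longrightarrow> Q (u + v) (u' + v')) \<and>
    (\<forall>r\<in>S. \<forall>u u'. Q u u' \<longrightarrow> Q (scal r u) (scal r u'))"

lemma linear_rel_lincomb:
  assumes Q: "linear_rel Q" and y: "\<And>j. j \<in> J \<Longrightarrow> Q (y j) (y' j)" and c: "c \<in> free_on J"
  shows "Q (lincomb y c) (lincomb y' c)"
proof -
  have "Q (\<Sum>j\<in>A. scal (lookup c j) (y j)) (\<Sum>j\<in>A. scal (lookup c j) (y' j))"
    if "finite A" "A \<subseteq> J" for A
    using that
  proof (induction A)
    case (insert j A)
    then have "Q (scal (lookup c j) (y j)) (scal (lookup c j) (y' j))"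
      using Q y c by (auto simp: linear_rel_def free_on_def)
    then show ?case using insert Q by (auto simp: linear_rel_def)
  qed (use Q in \<open>auto simp: linear_rel_def\<close>)
  moreover have "keys c \<subseteq> J"
    using c by (auto simp: free_on_def in_keys_iff)
  ultimately show ?thesis by (simp add: lincomb_def)
qed

lemma lincomb_in: "submod U \<Longrightarrow> (\<And>j. j \<in> J \<Longrightarrow> y j \<in> U) \<Longrightarrow> c \<in> free_on J \<Longrightarrow> lincomb y c \<in> U"
  using linear_rel_lincomb[of "\<lambda>u _. u \<in> U" J y y c]
  by (auto simp: linear_rel_def dest: submodD)

text \<open>\<open>syzygies_end d K\<close> says that \<open>K\<close> has a free resolution with \<open>d\<close> terms, and \<open>pd_le d U W\<close> that \<open>U / W\<close>
has a free resolution \<open>0 \<rightarrow> F\<^sub>d \<rightarrow> \<dots> \<rightarrow> F\<^sub>0 \<rightarrow> U / W \<rightarrow> 0\<close>. The first map is given by a family \<open>y\<close> that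
generates \<open>U\<close> modulo \<open>W\<close>, and its kernel is the preimage of \<open>W\<close> under \<open>lincomb y\<close>. The two predicates
are written alike, so that \<open>syzygies_end (Suc d) K\<close> is literally \<open>pd_le d K {0}\<close>.\<close>

primrec syzygies_end :: "nat \<Rightarrow> (nat \<Rightarrow>\<^sub>0 'r) set \<Rightarrow> bool" where
  "syzygies_end 0 K \<longleftrightarrow> K = {0}"
| "syzygies_end (Suc d) K \<longleftrightarrow> (\<exists>J y. (\<forall>j\<in>J. y j \<in> K) \<and>
    (\<forall>u\<in>K. \<exists>c\<in>free_on J. u - lincomb y c \<in> {0}) \<and>
    syzygies_end d {c \<in> free_on J. lincomb y c \<in> {0}})"

definition pd_le :: "nat \<Rightarrow> (nat \<Rightarrow>\<^sub>0 'r) set \<Rightarrow> (nat \<Rightarrow>\<^sub>0 'r) set \<Rightarrow> bool"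
  where "pd_le d U W \<longleftrightarrow> (\<exists>J y. (\<forall>j\<in>J. y j \<in> U) \<and>
    (\<forall>u\<in>U. \<exists>c\<in>free_on J. u - lincomb y c \<in> W) \<and>
    syzygies_end d {c \<in> free_on J. lincomb y c \<in> W})"

lemma syzygies_end_Suc: "syzygies_end (Suc d) K \<longleftrightarrow> pd_le d K {0}"
  by (simp add: pd_le_def)

lemma pd_leI:
  assumes "\<And>j. j \<in> J \<Longrightarrow> y j \<in> U" "\<And>u. u \<in> U \<Longrightarrow> \<exists>c\<in>free_on J. u - lincomb y c \<in> W"
    "syzygies_end d {c \<in> free_on J. lincomb y c \<in> W}"
  shows "pd_le d U W"
  using assms unfolding pd_le_def by blast

lemma pd_leE:
  assumes "pd_le d U W"
  obtains J y where "\<And>j. j \<in> J \<Longrightarrow> y j \<in> U" "\<And>u. u \<in> U \<Longrightarrow> \<exists>c\<in>free_on J. u - lincomb y c \<in> W"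
    "syzygies_end d {c \<in> free_on J. lincomb y c \<in> W}"
  using assms unfolding pd_le_def by blast

lemma free_on_empty: "free_on {} = {0}"
  by (auto simp: free_on_def intro: poly_mapping_eqI)

lemma syzygies_end_mono: "syzygies_end d K \<Longrightarrow> syzygies_end (Suc d) K"
proof (induction d arbitrary: K)
  case 0
  then show ?case
    by (auto simp: free_on_empty intro!: exI[of _ "{}"])
next
  case (Suc d)
  then have "pd_le d K {0}" by (simp only: syzygies_end_Suc)
  then have "pd_le (Suc d) K {0}"
    by (rule pd_leE) (rule pd_leI[OF _ _ Suc.IH])
  then show ?case by (simp only: syzygies_end_Suc)
qed

lemma pd_le_mono: "pd_le d U W \<Longrightarrow> d \<le> e \<Longrightarrow> pd_le e U W"
proof (induction e)
  case (Suc e)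
  show ?case
  proof (cases "d = Suc e")
    case False
    with Suc have "pd_le e U W" by simp
    then show ?thesis
      by (rule pd_leE) (rule pd_leI[OF _ _ syzygies_end_mono])
  qed (use Suc in simp)
qed auto

text \<open>Invariance under an isomorphism \<open>U / W \<cong> U' / W'\<close>, which is given by a linear relation. Generators are
moved along the relation, and then both covers have the same kernel.\<close>

lemma pd_le_transfer:
  assumes "pd_le d U W" and Q: "linear_rel Q" and U: "submod U" and U': "submod U'"
    and t: "\<And>u. u \<in> U \<Longrightarrow> \<exists>u'\<in>U'. Q u u'" and t': "\<And>u'. u' \<in> U' \<Longrightarrow> \<exists>u\<in>U. Q u u'"
    and W: "\<And>u u'. u \<in> U \<Longrightarrow> u' \<in> U' \<Longrightarrow> Q u u' \<Longrightarrow> u \<in> W \<longleftrightarrow> u' \<in> W'"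
  shows "pd_le d U' W'"
proof -
  obtain J y where y: "\<And>j. j \<in> J \<Longrightarrow> y j \<in> U"
    and s: "\<And>u. u \<in> U \<Longrightarrow> \<exists>c\<in>free_on J. u - lincomb y c \<in> W"
    and e: "syzygies_end d {c \<in> free_on J. lincomb y c \<in> W}"
    by (rule pd_leE[OF assms(1)]) blast
  have "\<forall>j\<in>J. \<exists>v. v \<in> U' \<and> Q (y j) v" using y t by blast
  then obtain y' where y': "\<And>j. j \<in> J \<Longrightarrow> y' j \<in> U'" "\<And>j. j \<in> J \<Longrightarrow> Q (y j) (y' j)"
    by metis
  have ev: "Q (lincomb y c) (lincomb y' c)" "lincomb y c \<in> U" "lincomb y' c \<in> U'"
    if "c \<in> free_on J" for c
    using linear_rel_lincomb[OF Q _ that] lincomb_in[OF U _ that] lincomb_in[OF U' _ that] y y'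
    by auto
  have "\<exists>c\<in>free_on J. u' - lincomb y' c \<in> W'" if u': "u' \<in> U'" for u'
  proof -
    obtain u where u: "u \<in> U" "Q u u'" using t' u' by blast
    obtain c where c: "c \<in> free_on J" "u - lincomb y c \<in> W" using s u by blast
    have "Q (u + scal (-1) (lincomb y c)) (u' + scal (-1) (lincomb y' c))"
      using Q u(2) ev(1)[OF c(1)] uminus_in[OF one_in] unfolding linear_rel_def by blast
    then have "Q (u - lincomb y c) (u' - lincomb y' c)"
      by (simp add: scal_minus_one)
    then have "u' - lincomb y' c \<in> W'"
      using W submodD(5)[OF U u(1) ev(2)[OF c(1)]] submodD(5)[OF U' u' ev(3)[OF c(1)]] c(2) by blast
    then show ?thesis using c(1) by blast
  qed
  moreover have "{c \<in> free_on J. lincomb y c \<in> W} = {c \<in> free_on J. lincomb y' c \<in> W'}"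
    using ev W by blast
  ultimately show ?thesis
    using y'(1) e by (intro pd_leI[of J y']) auto
qed

lemma pd_le_free: "pd_le 0 (free_on J) {0}"
  unfolding pd_le_def
proof (intro exI[of _ J] exI[of _ "\<lambda>j. single j 1"] conjI ballI)
  fix j assume "j \<in> J"
  then show "single j 1 \<in> free_on J"
    by (auto simp: free_on_def lookup_single when_def)
next
  fix u assume "u \<in> free_on J"
  then show "\<exists>c\<in>free_on J. u - lincomb (\<lambda>j. single j 1) c \<in> {0}"
    by (intro bexI[of _ u]) auto
next
  show "syzygies_end 0 {c \<in> free_on J. lincomb (\<lambda>j. single j 1) c \<in> {0}}"
    using submodD(1)[OF submod_free_on[of J]] by auto
qed

lemma submodI:
  "0 \<in> U \<Longrightarrow> (\<And>u v. u \<in> U \<Longrightarrow> v \<in> U \<Longrightarrow> u + v \<in> U) \<Longrightarrow>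
    (\<And>r u. r \<in> S \<Longrightarrow> u \<in> U \<Longrightarrow> scal r u \<in> U) \<Longrightarrow> submod U"
  by (auto simp: submod_def)

lemma free_on_interleave_iff:
  "c \<in> free_on {i. interleave (\<lambda>j. j \<in> J) (\<lambda>j. j \<in> J') i} \<longleftrightarrow> proj1 c \<in> free_on J \<and> proj2 c \<in> free_on J'"
    (is "?l \<longleftrightarrow> ?r")
proof
  assume ?l
  then show ?r by (auto simp: free_on_def interleave_def)
next
  assume r: ?r
  show ?l unfolding free_on_def
  proof (intro CollectI allI)
    fix i
    show "lookup c i \<in> S \<and>
      (i \<notin> {i. interleave (\<lambda>j. j \<in> J) (\<lambda>j. j \<in> J') i} \<longrightarrow> lookup c i = 0)"
      using r by (cases "even i") (auto simp: free_on_def interleave_def elim!: evenE oddE)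
  qed
qed

text \<open>The horseshoe lemma: generators of \<open>V / W\<close> and lifts of generators of \<open>U / V\<close> together generate
\<open>U / W\<close>, and the kernels form an extension of the same kind, of length one less.\<close>

lemma pd_le_extension:
  assumes "submod W" "submod V" "submod U" "W \<subseteq> V" "V \<subseteq> U" "pd_le d V W" "pd_le d U V"
  shows "pd_le d U W"
  using assms
proof (induction d arbitrary: U V W rule: less_induct)
  case (less d)
  note sub = less.prems(1-5)
  obtain J1 y1 where y1: "\<And>j. j \<in> J1 \<Longrightarrow> y1 j \<in> V"
    and s1: "\<And>u. u \<in> V \<Longrightarrow> \<exists>c\<in>free_on J1. u - lincomb y1 c \<in> W"
    and e1: "syzygies_end d {c \<in> free_on J1. lincomb y1 c \<in> W}"
    by (rule pd_leE[OF less.prems(6)]) blast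
  obtain J2 y2 where y2: "\<And>j. j \<in> J2 \<Longrightarrow> y2 j \<in> U"
    and s2: "\<And>u. u \<in> U \<Longrightarrow> \<exists>c\<in>free_on J2. u - lincomb y2 c \<in> V"
    and e2: "syzygies_end d {c \<in> free_on J2. lincomb y2 c \<in> V}"
    by (rule pd_leE[OF less.prems(7)]) blast
  define J where "J = {i. interleave (\<lambda>j. j \<in> J1) (\<lambda>j. j \<in> J2) i}"
  define y where "y = interleave y1 y2"
  have F: "c \<in> free_on J \<longleftrightarrow> proj1 c \<in> free_on J1 \<and> proj2 c \<in> free_on J2" for c
    unfolding J_def by (rule free_on_interleave_iff)
  have ev: "lincomb y c = lincomb y1 (proj1 c) + lincomb y2 (proj2 c)" for c
    unfolding y_def by (rule lincomb_interleave)
  have in1: "lincomb y1 c \<in> V" if "c \<in> free_on J1" for c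
    using lincomb_in[OF sub(2) _ that] y1 by blast
  have in2: "lincomb y2 c \<in> U" if "c \<in> free_on J2" for c
    using lincomb_in[OF sub(3) _ that] y2 by blast
  define K where "K = {c \<in> free_on J. lincomb y c \<in> W}"
  define K1 where "K1 = {c \<in> free_on J1. lincomb y1 c \<in> W}"
  define K2 where "K2 = {c \<in> free_on J2. lincomb y2 c \<in> V}"
  note K_sub = submod_lincomb_vimage[OF sub(1), of J y, folded K_def]
    submod_lincomb_vimage[OF sub(1), of J1 y1, folded K1_def]
    submod_lincomb_vimage[OF sub(2), of J2 y2, folded K2_def]
  have K2: "proj2 c \<in> K2" if "c \<in> K" for c
  proof -
    have "lincomb y2 (proj2 c) = lincomb y c - lincomb y1 (proj1 c)" by (simp add: ev)
    then show ?thesis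
      using that in1[of "proj1 c"] submodD(5)[OF sub(2)] sub(4) by (auto simp: K_def K2_def F)
  qed
  have K1: "proj1 c \<in> K1" if "c \<in> K" "proj2 c = 0" for c
    using that by (auto simp: K_def K1_def F ev)
  have K1': "emb1 c \<in> K" if "c \<in> K1" for c
    using that submodD(1)[OF submod_free_on] by (auto simp: K_def K1_def F ev)
  have "syzygies_end d K"
  proof (cases d)
    case 0
    then have 1: "K1 = {0}" "K2 = {0}" using e1 e2 by (auto simp: K1_def K2_def)
    have "c = 0" if "c \<in> K" for c
      using K2[OF that] K1[OF that] 1 emb_proj[of c] by (simp add: emb_proj_linear)
    then show ?thesis using 0 submodD(1)[OF K_sub(1)] by auto
  next
    case (Suc d')
    define L where "L = {c \<in> K. proj2 c = 0}"
    have L: "submod L"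
      using submod_Int[OF K_sub(1) submod_vimage[OF submod_zero, of proj2]]
      by (simp add: L_def Int_def emb_proj_linear)
    have "pd_le d' L {0}"
    proof (rule pd_le_transfer[where U = K1 and Q = "\<lambda>u v. v = emb1 u"])
      show "pd_le d' K1 {0}" using e1 Suc by (simp only: K1_def syzygies_end_Suc)
      show "\<exists>u\<in>K1. u' = emb1 u" if "u' \<in> L" for u'
        using that K1[of u'] emb_proj[of u'] by (auto simp: L_def emb_proj_linear intro!: bexI[of _ "proj1 u'"])
      show "u \<in> {0} \<longleftrightarrow> u' \<in> {0}" if "u' = emb1 u" for u u' :: "nat \<Rightarrow>\<^sub>0 'r"
      proof -
        have "u = 0" if "emb1 u = 0"
          using arg_cong[OF that, of proj1] by (simp add: emb_proj_linear)
        then show ?thesis using that by (auto simp: emb_proj_linear)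
      qed
    qed (use K_sub L in \<open>auto simp: linear_rel_def emb_proj_linear L_def intro: K1'\<close>)
    moreover have "pd_le d' K L"
    proof (rule pd_le_transfer[where U = K2 and Q = "\<lambda>u v. u = proj2 v"])
      show "pd_le d' K2 {0}" using e2 Suc by (simp only: K2_def syzygies_end_Suc)
      show "\<exists>u'\<in>K. u = proj2 u'" if u: "u \<in> K2" for u
      proof -
        have "- lincomb y2 u \<in> V" using u submodD(4)[OF sub(2)] by (auto simp: K2_def)
        then obtain c where c: "c \<in> free_on J1" "- lincomb y2 u - lincomb y1 c \<in> W"
          using s1 by blast
        have "- (- lincomb y2 u - lincomb y1 c) \<in> W" using c(2) submodD(4)[OF sub(1)] by blast
        then have "emb1 c + emb2 u \<in> K"
          using c u by (auto simp: K_def F ev emb_proj_linear K2_def add.commute)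
        then show ?thesis by (intro bexI[of _ "emb1 c + emb2 u"]) (auto simp: emb_proj_linear)
      qed
      show "u \<in> {0} \<longleftrightarrow> u' \<in> L" if "u' \<in> K" "u = proj2 u'" for u u'
        using that by (auto simp: L_def)
    qed (auto simp: linear_rel_def emb_proj_linear K_sub intro: K2)
    ultimately have "pd_le d' K {0}"
      using less.IH[of d' "{0}" L K] Suc L K_sub(1) submodD(1)[OF L] by (auto simp: L_def)
    then show ?thesis using Suc by (simp only: syzygies_end_Suc)
  qed
  moreover have "y j \<in> U" if "j \<in> J" for j
    using that y1 y2 sub(5) by (auto simp: y_def J_def interleave_def)
  moreover have "\<exists>c\<in>free_on J. u - lincomb y c \<in> W" if u: "u \<in> U" for u
  proof -
    obtain c2 where c2: "c2 \<in> free_on J2" "u - lincomb y2 c2 \<in> V" using s2 u by blast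
    obtain c1 where c1: "c1 \<in> free_on J1" "u - lincomb y2 c2 - lincomb y1 c1 \<in> W" using s1 c2 by blast
    show ?thesis
      using c1 c2 by (intro bexI[of _ "emb1 c1 + emb2 c2"]) (auto simp: F ev emb_proj_linear algebra_simps)
  qed
  ultimately show ?case
    unfolding K_def by (intro pd_leI[of J y])
qed

text \<open>A cover of \<open>U / W\<close> is also one of \<open>U / V\<close>, and its kernel grows by a module isomorphic to \<open>V / W\<close>.\<close>

lemma pd_le_quotient:
  assumes sub: "submod W" "submod V" "submod U" "W \<subseteq> V" "V \<subseteq> U"
    and V: "pd_le d V W" and U: "pd_le (Suc d) U W"
  shows "pd_le (Suc d) U V"
proof -
  obtain J y where y: "\<And>j. j \<in> J \<Longrightarrow> y j \<in> U"
    and s: "\<And>u. u \<in> U \<Longrightarrow> \<exists>c\<in>free_on J. u - lincomb y c \<in> W"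
    and e: "syzygies_end (Suc d) {c \<in> free_on J. lincomb y c \<in> W}"
    by (rule pd_leE[OF U]) blast
  define B where "B = {c \<in> free_on J. lincomb y c \<in> W}"
  define C where "C = {c \<in> free_on J. lincomb y c \<in> V}"
  note BC = submod_lincomb_vimage[OF sub(1), of J y, folded B_def]
    submod_lincomb_vimage[OF sub(2), of J y, folded C_def]
  have "pd_le d C B"
  proof (rule pd_le_transfer[OF V, where Q = "\<lambda>v c. v - lincomb y c \<in> W"])
    show "linear_rel (\<lambda>v c. v - lincomb y c \<in> W)"
      unfolding linear_rel_def
    proof (intro conjI allI ballI impI)
      show "0 - lincomb y 0 \<in> W" using submodD(1)[OF sub(1)] by simp
      show "u + v - lincomb y (u' + v') \<in> W" if "u - lincomb y u' \<in> W" "v - lincomb y v' \<in> W" for u v u' v'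
        using submodD(2)[OF sub(1) that] by (simp add: lincomb_add algebra_simps)
      show "scal r u - lincomb y (scal r u') \<in> W" if "r \<in> S" "u - lincomb y u' \<in> W" for r u u'
        using submodD(3)[OF sub(1) that] by (simp add: lincomb_scal scal_diff)
    qed
    show "\<exists>c\<in>C. v - lincomb y c \<in> W" if v: "v \<in> V" for v
    proof -
      obtain c where c: "c \<in> free_on J" "v - lincomb y c \<in> W" using s v sub(5) by blast
      have "v - (v - lincomb y c) \<in> V" using submodD(5)[OF sub(2) v] c sub(4) by blast
      then show ?thesis using c by (auto simp: C_def)
    qed
    show "\<exists>u\<in>V. u - lincomb y c \<in> W" if "c \<in> C" for c
      using that submodD(1)[OF sub(1)] by (intro bexI[of _ "lincomb y c"]) (auto simp: C_def)
    show "v \<in> W \<longleftrightarrow> c \<in> B" if "v \<in> V" "c \<in> C" "v - lincomb y c \<in> W" for v c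
      using that submodD(5)[OF sub(1) _ that(3), of v] submodD(2)[OF sub(1) that(3), of "lincomb y c"]
      by (auto simp: B_def C_def)
  qed (use sub BC in auto)
  moreover have "pd_le d B {0}" using e by (simp only: syzygies_end_Suc B_def)
  ultimately have "pd_le d C {0}"
    using pd_le_extension[of "{0}" B C d] BC submodD(1)[OF BC(1)] sub(4) by (auto simp: B_def C_def)
  then have "syzygies_end (Suc d) C" by (simp only: syzygies_end_Suc)
  moreover have "\<exists>c\<in>free_on J. u - lincomb y c \<in> V" if "u \<in> U" for u
    using s[OF that] sub(4) by blast
  ultimately show ?thesis
    unfolding C_def by (intro pd_leI[of J y] y)
qed

text \<open>The pullback \<open>E\<close> of a free cover \<open>F \<rightarrow> U / V\<close> along \<open>U \<rightarrow> U / V\<close> is an extension of \<open>U / W\<close> by the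
kernel of the cover, so its dimension is at most \<open>Suc d\<close>. On the other hand \<open>E\<close> is the direct sum of
\<open>V / W\<close> and \<open>F\<close>, because \<open>F\<close> is free; dividing by \<open>F\<close> gives the claim.\<close>

lemma pd_le_sub:
  assumes sub: "submod W" "submod V" "submod U" "W \<subseteq> V" "V \<subseteq> U"
    and UW: "pd_le (Suc d) U W" and UV: "pd_le (Suc (Suc d)) U V"
  shows "pd_le (Suc d) V W"
proof -
  obtain J y where y: "\<And>j. j \<in> J \<Longrightarrow> y j \<in> U"
    and s: "\<And>u. u \<in> U \<Longrightarrow> \<exists>c\<in>free_on J. u - lincomb y c \<in> V"
    and e: "syzygies_end (Suc (Suc d)) {c \<in> free_on J. lincomb y c \<in> V}"
    by (rule pd_leE[OF UV]) blast
  define C where "C = {c \<in> free_on J. lincomb y c \<in> V}"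
  note C = submod_lincomb_vimage[OF sub(2), of J y, folded C_def]
  have pC: "pd_le (Suc d) C {0}" using e by (simp only: syzygies_end_Suc C_def)
  have yF: "lincomb y c \<in> U" if "c \<in> free_on J" for c using lincomb_in[OF sub(3) _ that] y by blast
  define diff where "diff e = proj1 e - lincomb y (proj2 e)" for e
  have diff: "diff 0 = 0" "diff (a + b) = diff a + diff b" "diff (scal r a) = scal r (diff a)" for a b r
    by (auto simp: diff_def emb_proj_linear lincomb_add lincomb_scal scal_diff)
  define E where "E = {e. proj1 e \<in> U \<and> proj2 e \<in> free_on J \<and> diff e \<in> V}"
  define E0 where "E0 = {e. proj1 e \<in> W \<and> proj2 e = 0}"
  define E1 where "E1 = {e. proj1 e \<in> W \<and> proj2 e \<in> C}"
  define E2 where "E2 = {e. proj1 e \<in> U \<and> proj2 e \<in> free_on J \<and> diff e \<in> W}"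
  have vimage: "submod {e. proj1 e \<in> X \<and> proj2 e \<in> Y}" if "submod X" "submod Y" for X Y
    using submod_Int[OF submod_vimage[OF that(1), of proj1] submod_vimage[OF that(2), of proj2]]
    by (simp add: Int_def emb_proj_linear)
  have "submod E0" "submod E1"
    using vimage[OF sub(1) submod_zero] vimage[OF sub(1) C] by (simp_all add: E0_def E1_def)
  moreover have "submod E" "submod E2"
    using submod_Int[OF vimage[OF sub(3) submod_free_on[of J]] submod_vimage[OF sub(2) diff]]
      submod_Int[OF vimage[OF sub(3) submod_free_on[of J]] submod_vimage[OF sub(1) diff]]
    by (simp_all add: E_def E2_def Int_def conj_assoc)
  ultimately have E: "submod E" "submod E0" "submod E1" "submod E2" by blast+
  have E01: "E0 \<subseteq> E1" using submodD(1)[OF C] by (auto simp: E0_def E1_def)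
  have E1E: "E1 \<subseteq> E"
  proof
    fix e assume "e \<in> E1"
    then show "e \<in> E"
      using sub(4,5) submodD(5)[OF sub(2), of "proj1 e" "lincomb y (proj2 e)"]
      by (auto simp: E_def E1_def diff_def C_def)
  qed
  have E02: "E0 \<subseteq> E2"
    using sub(4,5) submodD(1)[OF submod_free_on[of J]] by (auto simp: E0_def E2_def diff_def)
  have E2E: "E2 \<subseteq> E" using sub(4) by (auto simp: E2_def E_def)
  have "pd_le (Suc d) E1 E0"
  proof (rule pd_le_transfer[OF pC, where Q = "\<lambda>c e. c = proj2 e"])
    show "\<exists>e\<in>E1. c = proj2 e" if "c \<in> C" for c
      using that submodD(1)[OF sub(1)] by (intro bexI[of _ "emb2 c"]) (auto simp: E1_def)
  qed (use C E in \<open>auto simp: linear_rel_def emb_proj_linear E0_def E1_def\<close>)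
  moreover have "pd_le (Suc d) E E1"
  proof (rule pd_le_transfer[OF UW, where Q = "\<lambda>u e. u = proj1 e"])
    show "\<exists>e\<in>E. u = proj1 e" if u: "u \<in> U" for u
    proof -
      obtain c where "c \<in> free_on J" "u - lincomb y c \<in> V" using s u by blast
      then show ?thesis using u
        by (intro bexI[of _ "emb1 u + emb2 c"]) (auto simp: E_def diff_def emb_proj_linear)
    qed
    show "u \<in> W \<longleftrightarrow> e \<in> E1" if "e \<in> E" "u = proj1 e" for u e
    proof -
      have "lincomb y (proj2 e) \<in> V" if "proj1 e \<in> W"
        using submodD(5)[OF sub(2), of "proj1 e" "diff e"] that \<open>e \<in> E\<close> sub(4) by (auto simp: diff_def E_def)
      then show ?thesis using that by (auto simp: E1_def E_def C_def)
    qed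
  qed (use sub E in \<open>auto simp: linear_rel_def emb_proj_linear E_def\<close>)
  ultimately have EE0: "pd_le (Suc d) E E0"
    using pd_le_extension[OF E(2,3,1) E01 E1E] by blast
  have "pd_le 0 E2 E0"
  proof (rule pd_le_transfer[OF pd_le_free[of J], where Q = "\<lambda>c e. c = proj2 e"])
    show "\<exists>e\<in>E2. c = proj2 e" if "c \<in> free_on J" for c
      using that yF submodD(1)[OF sub(1)]
      by (intro bexI[of _ "emb1 (lincomb y c) + emb2 c"]) (auto simp: E2_def diff_def emb_proj_linear)
  qed (use E submod_free_on[of J] in \<open>auto simp: linear_rel_def emb_proj_linear E2_def E0_def diff_def\<close>)
  then have "pd_le d E2 E0" by (rule pd_le_mono) simp
  then have EE2: "pd_le (Suc d) E E2"
    using pd_le_quotient[OF E(2,4,1) E02 E2E _ EE0] by blast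
  show ?thesis
  proof (rule pd_le_transfer[OF EE2, where Q = "\<lambda>e v. diff e - v \<in> W"])
    show "linear_rel (\<lambda>e v. diff e - v \<in> W)"
      unfolding linear_rel_def
    proof (intro conjI allI ballI impI)
      show "diff 0 - 0 \<in> W" using submodD(1)[OF sub(1)] by (simp add: diff)
      show "diff (u + v) - (u' + v') \<in> W" if "diff u - u' \<in> W" "diff v - v' \<in> W" for u v u' v'
        using submodD(2)[OF sub(1) that] by (simp add: diff algebra_simps)
      show "diff (scal r u) - scal r u' \<in> W" if "r \<in> S" "diff u - u' \<in> W" for r u u'
        using submodD(3)[OF sub(1) that] by (simp add: diff scal_diff)
    qed
    show "\<exists>v\<in>V. diff e - v \<in> W" if "e \<in> E" for e
      using that submodD(1)[OF sub(1)] by (intro bexI[of _ "diff e"]) (auto simp: E_def)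
    show "\<exists>e\<in>E. diff e - v \<in> W" if "v \<in> V" for v
      using that submodD(1)[OF sub(1)] submodD(1)[OF submod_free_on[of J]] sub(5)
      by (intro bexI[of _ "emb1 v"]) (auto simp: E_def diff_def)
    show "e \<in> E2 \<longleftrightarrow> v \<in> W" if "e \<in> E" "v \<in> V" "diff e - v \<in> W" for e v
      using that submodD(2)[OF sub(1) that(3), of v] submodD(5)[OF sub(1) _ that(3), of "diff e"]
      by (auto simp: E2_def E_def)
  qed (use E sub in auto)
qed

lemma syzygies_end_resolution:
  assumes "syzygies_end d K" "submod K"
  shows "\<exists>J y. (\<forall>i\<ge>d. J i = {}) \<and> lincomb (y 0) ` free_on (J 0) = K \<and>
    (\<forall>i. lincomb (y (Suc i)) ` free_on (J (Suc i)) = {c \<in> free_on (J i). lincomb (y i) c = 0})"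
  using assms
proof (induction d arbitrary: K)
  case 0
  then show ?case by (intro exI[of _ "\<lambda>_. {}"]) (auto simp: free_on_empty)
next
  case (Suc d)
  then have "pd_le d K {0}" by (simp only: syzygies_end_Suc)
  then obtain J0 y0 where y0: "\<And>j. j \<in> J0 \<Longrightarrow> y0 j \<in> K"
    and s: "\<And>u. u \<in> K \<Longrightarrow> \<exists>c\<in>free_on J0. u - lincomb y0 c \<in> {0}"
    and e: "syzygies_end d {c \<in> free_on J0. lincomb y0 c \<in> {0}}"
    by (rule pd_leE) blast
  obtain J y where Jy: "\<forall>i\<ge>d. J i = {}"
      "lincomb (y 0) ` free_on (J 0) = {c \<in> free_on J0. lincomb y0 c \<in> {0}}"
      "\<forall>i. lincomb (y (Suc i)) ` free_on (J (Suc i)) = {c \<in> free_on (J i). lincomb (y i) c = 0}"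
    using Suc.IH[OF e submod_lincomb_vimage] by auto
  have "lincomb y0 ` free_on J0 = K"
  proof (intro equalityI subsetI)
    fix u assume "u \<in> K"
    then obtain c where "c \<in> free_on J0" "u - lincomb y0 c = 0" using s by auto
    then show "u \<in> lincomb y0 ` free_on J0" by (intro image_eqI[of _ _ c]) simp_all
  qed (use lincomb_in[OF Suc.prems(2), of J0 y0] y0 in blast)
  moreover have "case_nat J0 J i = {}" if "Suc d \<le> i" for i
    using that Jy(1) by (cases i) auto
  moreover have "lincomb (case_nat y0 y (Suc i)) ` free_on (case_nat J0 J (Suc i)) =
      {c \<in> free_on (case_nat J0 J i). lincomb (case_nat y0 y i) c = 0}" for i
    using Jy(2,3) by (cases i) simp_all
  ultimately show ?case
    by (intro exI[of _ "case_nat J0 J"] exI[of _ "case_nat y0 y"]) simp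
qed

lemma pd_le_resolution:
  assumes "pd_le d U W" "submod W"
  shows "\<exists>J y. (\<forall>i>d. J i = {}) \<and> (\<forall>j\<in>J 0. y 0 j \<in> U) \<and>
    (\<forall>u\<in>U. \<exists>c\<in>free_on (J 0). u - lincomb (y 0) c \<in> W) \<and>
    lincomb (y 1) ` free_on (J 1) = {c \<in> free_on (J 0). lincomb (y 0) c \<in> W} \<and>
    (\<forall>i. lincomb (y (Suc (Suc i))) ` free_on (J (Suc (Suc i))) =
      {c \<in> free_on (J (Suc i)). lincomb (y (Suc i)) c = 0})"
proof -
  obtain J0 y0 where y0: "\<And>j. j \<in> J0 \<Longrightarrow> y0 j \<in> U"
    and s: "\<And>u. u \<in> U \<Longrightarrow> \<exists>c\<in>free_on J0. u - lincomb y0 c \<in> W"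
    and e: "syzygies_end d {c \<in> free_on J0. lincomb y0 c \<in> W}"
    by (rule pd_leE[OF assms(1)]) blast
  obtain J y where Jy: "\<forall>i\<ge>d. J i = {}"
      "lincomb (y 0) ` free_on (J 0) = {c \<in> free_on J0. lincomb y0 c \<in> W}"
      "\<forall>i. lincomb (y (Suc i)) ` free_on (J (Suc i)) = {c \<in> free_on (J i). lincomb (y i) c = 0}"
    using syzygies_end_resolution[OF e submod_lincomb_vimage[OF assms(2)]] by auto
  show ?thesis
  proof (intro exI[of _ "case_nat J0 J"] exI[of _ "case_nat y0 y"] conjI allI impI)
    fix i assume "i > d"
    then show "case_nat J0 J i = {}" using Jy(1) by (cases i) auto
  next
    show "\<forall>j\<in>case_nat J0 J 0. case_nat y0 y 0 j \<in> U" using y0 by simp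
    show "\<forall>u\<in>U. \<exists>c\<in>free_on (case_nat J0 J 0). u - lincomb (case_nat y0 y 0) c \<in> W"
      using s by simp
  qed (simp_all add: Jy(2,3))
qed

lemma submod_single:
  assumes "0 \<in> I" "\<And>u w. u \<in> I \<Longrightarrow> w \<in> I \<Longrightarrow> u + w \<in> I"
    "\<And>r u. r \<in> S \<Longrightarrow> u \<in> I \<Longrightarrow> r * u \<in> I"
  shows "submod (single 0 ` I)"
proof (rule submodI)
  show "0 \<in> single (0::nat) ` I"
    using assms(1) by (intro image_eqI[of _ _ 0]) simp_all
  show "u + w \<in> single 0 ` I" if "u \<in> single 0 ` I" "w \<in> single 0 ` I" for u w
    using that assms(2) by (auto simp: single_add[symmetric])
  show "scal r u \<in> single 0 ` I" if "r \<in> S" "u \<in> single 0 ` I" for r u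
    using that assms(3) by (auto simp: scal_single)
qed

end

section \<open>Polynomial rings and monomial maps\<close>

lemma mpoly_ring_simps [simp]:
  "mult (mpoly_ring V) = (*)" "one (mpoly_ring V) = 1" "zero (mpoly_ring V) = 0" "add (mpoly_ring V) = (+)"
  by (simp_all add: mpoly_ring_def)

lemma mpoly_carrier_iff:
  "p \<in> carrier (mpoly_ring V) \<longleftrightarrow> (\<forall>m\<in>keys p. keys m \<subseteq> V)"
  by (simp add: mpoly_ring_def)

lemma keys_uminus_eq [simp]: "keys (- p) = keys (p :: 'a \<Rightarrow>\<^sub>0 'b::ab_group_add)"
  by (auto simp: in_keys_iff)

lemma keys_add_nat: "keys (m + m') = keys m \<union> keys (m' :: 'a \<Rightarrow>\<^sub>0 nat)"
  by (auto simp: in_keys_iff lookup_add)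

lemma mpoly_carrier_closed:
  fixes p q :: "('v, 'k::field) mpoly"
  shows "0 \<in> carrier (mpoly_ring V :: (('v, 'k) mpoly) ring)"
    "1 \<in> carrier (mpoly_ring V :: (('v, 'k) mpoly) ring)"
    "p \<in> carrier (mpoly_ring V) \<Longrightarrow> q \<in> carrier (mpoly_ring V) \<Longrightarrow> p + q \<in> carrier (mpoly_ring V)"
    "p \<in> carrier (mpoly_ring V) \<Longrightarrow> q \<in> carrier (mpoly_ring V) \<Longrightarrow> p * q \<in> carrier (mpoly_ring V)"
    "p \<in> carrier (mpoly_ring V) \<Longrightarrow> - p \<in> carrier (mpoly_ring V)"
    "p \<in> carrier (mpoly_ring V) \<Longrightarrow> q \<in> carrier (mpoly_ring V) \<Longrightarrow> p - q \<in> carrier (mpoly_ring V)"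
    "keys m \<subseteq> V \<Longrightarrow> single m c \<in> carrier (mpoly_ring V :: (('v, 'k) mpoly) ring)"
    "v \<in> V \<Longrightarrow> mpoly_var v \<in> carrier (mpoly_ring V :: (('v, 'k) mpoly) ring)"
proof -
  show add: "p + q \<in> carrier (mpoly_ring V)" if "p \<in> carrier (mpoly_ring V)" "q \<in> carrier (mpoly_ring V)"
    for p q :: "('v, 'k) mpoly"
    using that keys_add[of p q] unfolding mpoly_carrier_iff by blast
  show uminus: "- p \<in> carrier (mpoly_ring V)" if "p \<in> carrier (mpoly_ring V)"
    for p :: "('v, 'k) mpoly"
    using that by (simp add: mpoly_carrier_iff)
  show "p - q \<in> carrier (mpoly_ring V)" if "p \<in> carrier (mpoly_ring V)" "q \<in> carrier (mpoly_ring V)"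
    using add[OF that(1) uminus[OF that(2)]] by simp
  show "p * q \<in> carrier (mpoly_ring V)" if pq: "p \<in> carrier (mpoly_ring V)" "q \<in> carrier (mpoly_ring V)"
    unfolding mpoly_carrier_iff
  proof
    fix m assume "m \<in> keys (p * q)"
    then obtain a b where "m = a + b" "a \<in> keys p" "b \<in> keys q"
      using keys_mult[of p q] by blast
    then show "keys m \<subseteq> V" using pq by (auto simp: mpoly_carrier_iff keys_add_nat)
  qed
qed (auto simp: mpoly_carrier_iff mpoly_var_def)

lemma cring_mpoly_ring: "cring (mpoly_ring V :: (('v, 'k::field) mpoly) ring)"
proof (rule cringI)
  show "abelian_group (mpoly_ring V :: (('v, 'k) mpoly) ring)"
  proof (rule abelian_groupI)
    fix x :: "('v, 'k) mpoly" assume "x \<in> carrier (mpoly_ring V)"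
    then show "\<exists>y\<in>carrier (mpoly_ring V). y \<oplus>\<^bsub>mpoly_ring V\<^esub> x = \<zero>\<^bsub>mpoly_ring V\<^esub>"
      by (intro bexI[of _ "- x"]) (simp_all add: mpoly_carrier_closed)
  qed (simp_all add: mpoly_carrier_closed ac_simps)
  show "Group.comm_monoid (mpoly_ring V :: (('v, 'k) mpoly) ring)"
    by (rule comm_monoidI) (simp_all add: mpoly_carrier_closed ac_simps)
qed (simp add: distrib_right)

lemma mpoly_ring_a_inv:
  fixes p :: "('v, 'k::field) mpoly"
  assumes "p \<in> carrier (mpoly_ring V)"
  shows "\<ominus>\<^bsub>mpoly_ring V\<^esub> p = - p"
proof -
  interpret cring "mpoly_ring V :: (('v, 'k) mpoly) ring" by (rule cring_mpoly_ring)
  show ?thesis using assms by (intro minus_equality) (simp_all add: mpoly_carrier_closed)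
qed

lemma monomial_expansion:
  fixes p :: "'a \<Rightarrow>\<^sub>0 'b::comm_monoid_add"
  shows "(\<Sum>m\<in>keys p. single m (lookup p m)) = p"
proof (rule poly_mapping_eqI)
  fix k
  have "lookup (\<Sum>m\<in>keys p. single m (lookup p m)) k =
      (\<Sum>m\<in>keys p. if m = k then lookup p m else 0)"
    unfolding lookup_sum by (rule sum.cong) (auto simp: lookup_single when_def)
  then show "lookup (\<Sum>m\<in>keys p. single m (lookup p m)) k =
    lookup p k" by (auto simp: in_keys_iff)
qed

lemma mpoly_induct [case_names monomial add]:
  fixes p :: "'a \<Rightarrow>\<^sub>0 'b::comm_monoid_add"
  assumes "\<And>m c. P (single m c)" "\<And>p q. P p \<Longrightarrow> P q \<Longrightarrow> P (p + q)"
  shows "P p"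
proof -
  have z: "P 0" using assms(1)[of undefined 0] by simp
  have "P (\<Sum>m\<in>A. single m (lookup p m))" if "finite A" for A
    using that by (induction A) (auto intro: assms z)
  from this[of "keys p"] show ?thesis by (simp add: monomial_expansion)
qed

definition monomial_subst :: "('e \<Rightarrow> 'r::comm_monoid_mult) \<Rightarrow> ('e \<Rightarrow>\<^sub>0 nat) \<Rightarrow> 'r"
  where "monomial_subst f m = (\<Prod>e\<in>keys m. f e ^ lookup m e)"

lemma monomial_subst_superset:
  "finite A \<Longrightarrow> keys m \<subseteq> A \<Longrightarrow>
    monomial_subst f m = (\<Prod>e\<in>A. f e ^ lookup m e)"
  unfolding monomial_subst_def by (rule prod.mono_neutral_left) (auto simp: in_keys_iff)

lemma monomial_subst_add: "monomial_subst f (m + m') = monomial_subst f m * monomial_subst f m'"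
proof -
  let ?A = "keys m \<union> keys m'"
  have "monomial_subst f (m + m') = (\<Prod>e\<in>?A. f e ^ lookup (m + m') e)"
    "monomial_subst f m = (\<Prod>e\<in>?A. f e ^ lookup m e)"
    "monomial_subst f m' = (\<Prod>e\<in>?A. f e ^ lookup m' e)"
    by (intro monomial_subst_superset; simp add: keys_add)+
  then show ?thesis by (simp add: lookup_add power_add prod.distrib)
qed

lemma monomial_subst_single: "monomial_subst f (single e (Suc 0)) = f e"
  unfolding monomial_subst_def by simp

lemma monomial_subst_zero [simp]: "monomial_subst f 0 = 1"
  unfolding monomial_subst_def by simp

context
  fixes f :: "'e \<Rightarrow> ('v, 'k::field) mpoly"
begin

lemma mpoly_const_simps:
  "mpoly_const (0::'k) = (0 :: ('v, 'k) mpoly)" "mpoly_const (1::'k) = (1 :: ('v, 'k) mpoly)"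
  "mpoly_const (a + b :: 'k) = (mpoly_const a + mpoly_const b :: ('v, 'k) mpoly)"
  "mpoly_const (a * b :: 'k) = (mpoly_const a * mpoly_const b :: ('v, 'k) mpoly)"
  by (simp_all add: mpoly_const_def single_add mult_single)

lemma mpoly_subst_eq:
  "finite A \<Longrightarrow> keys p \<subseteq> A \<Longrightarrow>
    mpoly_subst f p = (\<Sum>m\<in>A. mpoly_const (lookup p m) * monomial_subst f m)"
  unfolding mpoly_subst_def monomial_subst_def
  by (rule sum.mono_neutral_left) (auto simp: in_keys_iff mpoly_const_simps)

lemma mpoly_subst_single: "mpoly_subst f (single m c) = mpoly_const c * monomial_subst f m"
  using mpoly_subst_eq[of "{m}" "single m c"] by simp

lemma mpoly_subst_add: "mpoly_subst f (p + q) = mpoly_subst f p + mpoly_subst f q"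
proof -
  let ?A = "keys p \<union> keys q"
  show ?thesis
    using mpoly_subst_eq[of ?A p] mpoly_subst_eq[of ?A q] mpoly_subst_eq[of ?A "p + q"] keys_add[of p q]
    by (simp add: lookup_add mpoly_const_simps distrib_right sum.distrib)
qed

lemma mpoly_subst_zero [simp]: "mpoly_subst f 0 = 0"
  by (simp add: mpoly_subst_def)

lemma mpoly_subst_uminus: "mpoly_subst f (- p) = - mpoly_subst f p"
  using mpoly_subst_add[of p "- p"] by (simp add: eq_neg_iff_add_eq_0 add.commute)

lemma mpoly_subst_diff: "mpoly_subst f (p - q) = mpoly_subst f p - mpoly_subst f q"
  using mpoly_subst_add[of p "- q"] by (simp add: mpoly_subst_uminus)

lemma mpoly_subst_mult: "mpoly_subst f (p * q) = mpoly_subst f p * mpoly_subst f q"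
proof (induction p rule: mpoly_induct)
  case (monomial m c)
  show ?case
  proof (induction q rule: mpoly_induct)
    case (monomial m' c')
    then show ?case
      by (simp add: mult_single mpoly_subst_single mpoly_const_simps monomial_subst_add ac_simps)
  qed (simp add: distrib_left mpoly_subst_add)
qed (simp add: distrib_right mpoly_subst_add)

lemma mpoly_subst_var [simp]: "mpoly_subst f (mpoly_var e) = f e"
  unfolding mpoly_var_def mpoly_subst_single by (simp add: monomial_subst_single mpoly_const_simps)

end

text \<open>The exponent vector of the image of the monomial \<open>m\<close>, if every variable \<open>e\<close> is replaced by the monomial
with exponent vector \<open>W e\<close>.\<close>

definition weight :: "('e \<Rightarrow> ('v \<Rightarrow>\<^sub>0 nat)) \<Rightarrow> ('e \<Rightarrow>\<^sub>0 nat) \<Rightarrow> ('v \<Rightarrow>\<^sub>0 nat)"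
  where "weight W m = (\<Sum>e\<in>keys m. \<Sum>i<lookup m e. W e)"

lemma lookup_weight:
  "finite A \<Longrightarrow> keys m \<subseteq> A \<Longrightarrow> lookup (weight W m) v =
    (\<Sum>e\<in>A. lookup m e * lookup (W e) v)"
  unfolding weight_def lookup_sum
  by simp (rule sum.mono_neutral_left, auto simp: in_keys_iff)

lemma weight_add: "weight W (m + m') = weight W m + weight W m'"
proof (rule poly_mapping_eqI)
  fix v
  let ?A = "keys m \<union> keys m'"
  show "lookup (weight W (m + m')) v = lookup (weight W m + weight W m') v"
    using lookup_weight[of ?A m W v] lookup_weight[of ?A m' W v] lookup_weight[of ?A "m + m'" W v]
    by (simp add: keys_add_nat lookup_add distrib_right sum.distrib)
qed

lemma weight_single [simp]: "weight W (single e (Suc 0)) = W e"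
  by (simp add: weight_def)

lemma weight_pos_iff:
  "lookup (weight W m) v > 0 \<longleftrightarrow> (\<exists>e\<in>keys m. lookup (W e) v > 0)"
proof -
  have "lookup (weight W m) v \<noteq> 0 \<longleftrightarrow>
      (\<exists>e\<in>keys m. lookup m e * lookup (W e) v \<noteq> 0)"
    by (subst lookup_weight[OF finite_keys order_refl]) (simp add: sum_eq_0_iff)
  then show ?thesis by (auto simp: in_keys_iff)
qed

lemma power_single: "single w (1::'k::field) ^ n = single (\<Sum>i<n. w :: 'v \<Rightarrow>\<^sub>0 nat) 1"
  by (induction n) (simp_all add: mult_single add.commute)

lemma prod_single:
  "(\<Prod>i\<in>A. single (w i :: 'v \<Rightarrow>\<^sub>0 nat) (1::'k::field)) = single (\<Sum>i\<in>A. w i) 1"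
  by (induction A rule: infinite_finite_induct) (simp_all add: mult_single)

lemma monomial_subst_weight:
  "monomial_subst (\<lambda>e. single (W e) (1::'k::field)) m = single (weight W m) 1"
  by (simp add: monomial_subst_def weight_def power_single prod_single)

lemma mpoly_subst_weight:
  "mpoly_subst (\<lambda>e. single (W e) 1) p =
    (\<Sum>m\<in>keys p. single (weight W m) (lookup p m))"
  by (subst mpoly_subst_eq[OF finite_keys order_refl])
    (simp add: monomial_subst_weight mpoly_const_def mult_single)

text \<open>The kernel of a map that sends monomials to monomials is spanned by the binomials in it: as the
coefficients cancel in every fibre, a monomial of \<open>p\<close> has a partner with the same image, and
subtracting their binomial makes \<open>p\<close> shorter. All monomials used occur in \<open>p\<close>, so side conditions on
the monomials of \<open>p\<close> are kept.\<close>

lemma monomial_map_kernel_induct: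
  fixes p :: "'m \<Rightarrow>\<^sub>0 'k::ab_group_add"
  assumes "(\<Sum>m\<in>keys p. single (\<phi> m) (lookup p m)) = 0"
    and "0 \<in> B" "\<And>x y. x \<in> B \<Longrightarrow> y \<in> B \<Longrightarrow> x + y \<in> B"
    and "\<And>m m' c. m \<in> keys p \<Longrightarrow> m' \<in> keys p \<Longrightarrow> \<phi> m = \<phi> m' \<Longrightarrow>
      single m c - single m' c \<in> B"
  shows "p \<in> B"
  using assms(1,4)
proof (induction "card (keys p)" arbitrary: p rule: less_induct)
  case less
  show ?case
  proof (cases "p = 0")
    case False
    then obtain m where m: "m \<in> keys p" by (metis keys_eq_empty equals0I)
    define c where "c = lookup p m"
    have "\<exists>m'\<in>keys p. m' \<noteq> m \<and> \<phi> m = \<phi> m'"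
    proof (rule ccontr)
      assume no: "\<not> ?thesis"
      have "0 = (\<Sum>m'\<in>keys p. lookup (single (\<phi> m') (lookup p m')) (\<phi> m))"
        using arg_cong[OF less.prems(1), of "\<lambda>q. lookup q (\<phi> m)"] by (simp add: lookup_sum)
      also have "\<dots> = (\<Sum>m'\<in>keys p. if m' = m then c else 0)"
        using no by (intro sum.cong) (auto simp: lookup_single when_def c_def)
      also have "\<dots> = c" using m by simp
      finally show False using m by (simp add: c_def in_keys_iff)
    qed
    then obtain m' where m': "m' \<in> keys p" "m' \<noteq> m" "\<phi> m = \<phi> m'" by blast
    define b where "b = single m c - single m' c"
    define q where "q = p - b"
    have "lookup q m = 0"
      using m' by (simp add: q_def b_def lookup_minus lookup_single c_def when_def)
    moreover have "lookup q x = 0" if "x \<notin> keys p" for x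
      using that m m' by (auto simp: q_def b_def lookup_minus lookup_single when_def in_keys_iff)
    ultimately have keys: "keys q \<subseteq> keys p - {m}"
      by (auto simp: in_keys_iff)
    have ext: "(\<Sum>x\<in>keys q. single (\<phi> x) (lookup q x)) =
        (\<Sum>x\<in>keys p. single (\<phi> x) (lookup q x))"
      using keys by (intro sum.mono_neutral_left) (auto simp: in_keys_iff)
    also have "\<dots> = (\<Sum>x\<in>keys p. single (\<phi> x) (lookup p x)) -
        (\<Sum>x\<in>keys p. single (\<phi> x) (lookup b x))"
      by (simp add: q_def lookup_minus single_diff sum_subtractf)
    also have "(\<Sum>x\<in>keys p. single (\<phi> x) (lookup b x)) =
        (\<Sum>x\<in>keys p. (if x = m then single (\<phi> m) c else 0) -
          (if x = m' then single (\<phi> m') c else 0))"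
      using m'(2) by (intro sum.cong) (auto simp: b_def lookup_minus lookup_single when_def single_uminus)
    also have "\<dots> = 0" using m m' by (simp add: sum_subtractf)
    finally have "(\<Sum>x\<in>keys q. single (\<phi> x) (lookup q x)) = 0"
      using less.prems(1) by simp
    moreover have "card (keys q) < card (keys p)"
      using keys m by (intro psubset_card_mono) auto
    moreover have "single x a - single y a \<in> B"
      if "x \<in> keys q" "y \<in> keys q" "\<phi> x = \<phi> y" for x y a
      using that keys by (intro less.prems(2)) blast+
    ultimately have "q \<in> B" using less.hyps[of q] by blast
    moreover have "b \<in> B" unfolding b_def using m m' by (intro less.prems(2)) auto
    ultimately show ?thesis using assms(3)[of q b] by (simp add: q_def)
  qed (use assms(2) in simp)
qed

section \<open>Ideals generated by a sequence of polynomials\<close>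

context
  fixes V :: "'v set" and h :: "nat \<Rightarrow> (('v, 'k::field) mpoly)"
  assumes h: "\<And>j. h j \<in> carrier (mpoly_ring V)"
begin

interpretation cring "mpoly_ring V :: (('v, 'k) mpoly) ring" by (rule cring_mpoly_ring)

lemma sequence_ideal_mpoly:
  "a \<in> sequence_ideal (mpoly_ring V) h j \<Longrightarrow> a \<in> carrier (mpoly_ring V)"
  "0 \<in> sequence_ideal (mpoly_ring V) h j"
  "a \<in> sequence_ideal (mpoly_ring V) h j \<Longrightarrow> b \<in> sequence_ideal (mpoly_ring V) h j \<Longrightarrow>
    a + b \<in> sequence_ideal (mpoly_ring V) h j"
  "r \<in> carrier (mpoly_ring V) \<Longrightarrow> a \<in> sequence_ideal (mpoly_ring V) h j \<Longrightarrow>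
    r * a \<in> sequence_ideal (mpoly_ring V) h j"
  "a \<in> sequence_ideal (mpoly_ring V) h j \<Longrightarrow> - a \<in> sequence_ideal (mpoly_ring V) h j"
  "a \<in> sequence_ideal (mpoly_ring V) h j \<Longrightarrow> b \<in> sequence_ideal (mpoly_ring V) h j \<Longrightarrow>
    a - b \<in> sequence_ideal (mpoly_ring V) h j"
proof -
  note I = sequence_ideal[of h, OF h, simplified mpoly_ring_simps]
  show "a \<in> sequence_ideal (mpoly_ring V) h j \<Longrightarrow> a \<in> carrier (mpoly_ring V)"
    "0 \<in> sequence_ideal (mpoly_ring V) h j"
    "r \<in> carrier (mpoly_ring V) \<Longrightarrow> a \<in> sequence_ideal (mpoly_ring V) h j \<Longrightarrow>
      r * a \<in> sequence_ideal (mpoly_ring V) h j" by (fact I)+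
  show add: "a + b \<in> sequence_ideal (mpoly_ring V) h j"
    if "a \<in> sequence_ideal (mpoly_ring V) h j" "b \<in> sequence_ideal (mpoly_ring V) h j" for a b
    using that by (rule I)
  show uminus: "- a \<in> sequence_ideal (mpoly_ring V) h j" if "a \<in> sequence_ideal (mpoly_ring V) h j" for a
  proof -
    have "- 1 * a \<in> sequence_ideal (mpoly_ring V) h j"
      by (rule I(4)[OF _ that]) (intro mpoly_carrier_closed)
    then show ?thesis by simp
  qed
  show "a - b \<in> sequence_ideal (mpoly_ring V) h j"
    if "a \<in> sequence_ideal (mpoly_ring V) h j" "b \<in> sequence_ideal (mpoly_ring V) h j"
    using add[OF that(1) uminus[OF that(2)]] by simp
qed

lemma sequence_ideal_mpoly_Suc:
  "w \<in> sequence_ideal (mpoly_ring V) h (Suc j) \<longleftrightarrow>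
    (\<exists>a s. w = a + h j * s \<and> a \<in> sequence_ideal (mpoly_ring V) h j \<and> s \<in> carrier (mpoly_ring V))"
  by simp

lemma sequence_ideal_generator:
  assumes "i < j" "s \<in> carrier (mpoly_ring V)"
  shows "h i * s \<in> sequence_ideal (mpoly_ring V) h j"
  using assms(1)
proof (induction j)
  case (Suc j)
  show ?case
  proof (cases "i = j")
    case True
    then show ?thesis unfolding sequence_ideal_mpoly_Suc
      using sequence_ideal_mpoly(2) assms(2) by (intro exI[of _ 0] exI[of _ s]) simp
  next
    case False
    then have "h i * s \<in> sequence_ideal (mpoly_ring V) h j" using Suc by simp
    then show ?thesis unfolding sequence_ideal_mpoly_Suc
      using mpoly_carrier_closed(1) by (intro exI[of _ "h i * s"] exI[of _ 0]) simp
  qed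
qed simp

lemma sequence_ideal_mono:
  "i \<le> j \<Longrightarrow> w \<in> sequence_ideal (mpoly_ring V) h i \<Longrightarrow> w \<in> sequence_ideal (mpoly_ring V) h j"
proof (induction j)
  case (Suc j)
  show ?case
  proof (cases "i = Suc j")
    case False
    then have "w \<in> sequence_ideal (mpoly_ring V) h j" using Suc by simp
    then show ?thesis unfolding sequence_ideal_mpoly_Suc
      using mpoly_carrier_closed(1) by (intro exI[of _ w] exI[of _ 0]) simp
  qed (use Suc in simp)
qed simp

end

definition free_of :: "'v \<Rightarrow> (('v, 'k::field) mpoly) \<Rightarrow> bool"
  where "free_of v p \<longleftrightarrow> (\<forall>m\<in>keys p. lookup m v = 0)"

lemma free_of_closed:
  fixes p q :: "('v, 'k::field) mpoly"
  shows "free_of v 0" "free_of v p \<Longrightarrow> free_of v q \<Longrightarrow> free_of v (p + q)"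
  "free_of v p \<Longrightarrow> free_of v q \<Longrightarrow> free_of v (p - q)"
  "free_of v p \<Longrightarrow> free_of v q \<Longrightarrow> free_of v (p * q)"
  "free_of v p \<Longrightarrow> free_of v (- p)" "u \<noteq> v \<Longrightarrow> free_of v (mpoly_var u)"
proof -
  show add: "free_of v (p + q)" if "free_of v p" "free_of v q" for p q :: "('v, 'k) mpoly"
    using that keys_add[of p q] unfolding free_of_def by blast
  show uminus: "free_of v p \<Longrightarrow> free_of v (- p)" for p :: "('v, 'k) mpoly"
    by (simp add: free_of_def)
  show "free_of v (p - q)" if "free_of v p" "free_of v q"
    using add[OF that(1) uminus[OF that(2)]] by simp
  show "free_of v (p * q)" if "free_of v p" "free_of v q"
    unfolding free_of_def
  proof
    fix m assume "m \<in> keys (p * q)"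
    then obtain a b where "m = a + b" "a \<in> keys p" "b \<in> keys q"
      using keys_mult[of p q] by blast
    then show "lookup m v = 0" using that by (simp add: free_of_def lookup_add)
  qed
qed (simp_all add: free_of_def mpoly_var_def lookup_single when_def)

lemma var_times_single:
  "mpoly_var v * single m c = single (single v 1 + m) c"
  by (simp add: mpoly_var_def mult_single)

lemma monomial_split:
  fixes m :: "'v \<Rightarrow>\<^sub>0 nat"
  assumes "e \<in> keys m"
  obtains m' where "m = single e 1 + m'"
proof
  show "m = single e 1 + (m - single e 1)"
    using assms by (intro poly_mapping_eqI) (auto simp: lookup_add lookup_minus lookup_single when_def in_keys_iff)
qed

text \<open>Division by the variable \<open>v\<close> with remainder. The last part, that the degree in \<open>v\<close> drops, is for
inductions on this degree.\<close>

lemma split_variable: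
  fixes p :: "('v, 'k::field) mpoly"
  assumes "p \<in> carrier (mpoly_ring V)"
  shows "\<exists>a b. p = a + mpoly_var v * b \<and> free_of v a \<and> a \<in> carrier (mpoly_ring V) \<and> b \<in> carrier (mpoly_ring V) \<and>
    (\<forall>D. (\<forall>m\<in>keys p. lookup m v < Suc D) \<longrightarrow>
      (\<forall>m\<in>keys b. lookup m v < D))"
proof -
  define bound where "bound D q \<longleftrightarrow> (\<forall>m\<in>keys q. lookup m v < D)" for D and q :: "('v, 'k) mpoly"
  define S where "S = (carrier (mpoly_ring V) :: (('v, 'k) mpoly) set)"
  note S = mpoly_carrier_closed[where V = V and 'k = 'k, folded S_def]
  have "\<exists>a b. (\<Sum>m\<in>A. single m (lookup p m)) = a + mpoly_var v * b \<and>
      free_of v a \<and> a \<in> S \<and> b \<in> S \<and> (\<forall>D. bound (Suc D) p \<longrightarrow> bound D b)"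
    if "finite A" "A \<subseteq> keys p" for A
    using that
  proof (induction A)
    case empty
    show ?case
      by (intro exI[of _ 0]) (simp add: free_of_closed S bound_def)
  next
    case (insert m A)
    then obtain a b where ab: "(\<Sum>m\<in>A. single m (lookup p m)) = a + mpoly_var v * b"
      "free_of v a" "a \<in> S" "b \<in> S" "\<And>D. bound (Suc D) p \<Longrightarrow> bound D b" by auto
    define c where "c = lookup p m"
    have mV: "keys m \<subseteq> V" using assms insert.prems by (auto simp: mpoly_carrier_iff)
    have sum: "(\<Sum>m\<in>insert m A. single m (lookup p m)) =
        single m c + (a + mpoly_var v * b)"
      using insert.hyps ab(1) by (simp add: c_def)
    show ?case
    proof (cases "v \<in> keys m")
      case False
      then have "free_of v (single m c)" by (simp add: free_of_def in_keys_iff)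
      then show ?thesis unfolding sum using ab(2-) S(7)[OF mV, of c] S(3)
        by (intro exI[of _ "single m c + a"] exI[of _ b])
          (simp add: free_of_closed add.assoc)
    next
      case True
      then obtain m' where m': "m = single v 1 + m'" by (rule monomial_split)
      have "keys m' \<subseteq> V" using mV by (simp add: m' keys_add_nat)
      then have "single m' c \<in> S" by (rule S(7))
      moreover have "bound D (single m' c + b)" if "bound (Suc D) p" for D
      proof -
        have "lookup m v < Suc D" using that insert.prems by (auto simp: bound_def)
        then have "bound D (single m' c)" by (simp add: bound_def m' lookup_add)
        then show ?thesis using ab(5)[OF that] keys_add[of "single m' c" b]
          unfolding bound_def by blast
      qed
      moreover have "single m c = mpoly_var v * single m' c"
        by (simp add: var_times_single m')
      ultimately show ?thesis unfolding sum using ab(2-4) S(3)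
        by (intro exI[of _ a] exI[of _ "single m' c + b"]) (simp add: distrib_left)
    qed
  qed
  from this[OF finite_keys order_refl] show ?thesis
    unfolding monomial_expansion S_def bound_def by blast
qed

lemma mpoly_var_nonzero [simp]: "mpoly_var v \<noteq> (0 :: ('v, 'k::field) mpoly)"
proof
  assume "mpoly_var v = (0 :: ('v, 'k) mpoly)"
  then have "keys (mpoly_var v :: ('v, 'k) mpoly) = {}" by (simp only: keys_zero)
  then show False by (simp add: mpoly_var_def)
qed

lemma split_variable_unique:
  fixes a b :: "(nat, 'k::field) mpoly"
  assumes "a + mpoly_var v * b = a' + mpoly_var v * b'" "free_of v a" "free_of v a'"
  shows "a = a'" "b = b'"
proof -
  have eq: "a - a' = mpoly_var v * (b' - b)"
    using assms(1) by (simp add: algebra_simps)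
  have "a - a' = 0"
  proof (rule ccontr)
    assume "a - a' \<noteq> 0"
    then obtain m where m: "m \<in> keys (a - a')" by (metis keys_eq_empty equals0I)
    then have "m \<in> keys (mpoly_var v * (b' - b))" by (simp add: eq)
    then obtain m1 m2 where "m = m1 + m2" "m1 \<in> keys (mpoly_var v :: (nat, 'k) mpoly)"
      using keys_mult[of "mpoly_var v" "b' - b"] by blast
    then have "lookup m v > 0" by (simp add: mpoly_var_def lookup_add)
    then show False using m free_of_closed(3)[OF assms(2,3)] by (auto simp: free_of_def)
  qed
  then show "a = a'" by simp
  then have "mpoly_var v * (b' - b) = 0" using eq by simp
  then show "b = b'" by simp
qed

text \<open>An ideal generated by polynomials that do not involve \<open>v\<close> contains, with a polynomial, its remainder and
quotient on division by \<open>v\<close>. This makes \<open>v\<close> a nonzerodivisor modulo the ideal.\<close>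

lemma sequence_ideal_split_variable:
  fixes h :: "nat \<Rightarrow> ((nat, 'k::field) mpoly)"
  assumes h: "\<And>j. h j \<in> carrier (mpoly_ring V)" and "\<And>i. i < j \<Longrightarrow> free_of v (h i)"
    and "a + mpoly_var v * b \<in> sequence_ideal (mpoly_ring V) h j" "free_of v a"
  shows "a \<in> sequence_ideal (mpoly_ring V) h j \<and> b \<in> sequence_ideal (mpoly_ring V) h j"
  using assms(2-4)
proof (induction j arbitrary: a b)
  case 0
  then have "a + mpoly_var v * b = 0 + mpoly_var v * 0" by simp
  from split_variable_unique[OF this 0(3) free_of_closed(1)] show ?case by simp
next
  case (Suc j)
  obtain w s where ws: "a + mpoly_var v * b = w + h j * s" "w \<in> sequence_ideal (mpoly_ring V) h j"
    "s \<in> carrier (mpoly_ring V)"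
    using Suc.prems(2) unfolding sequence_ideal_mpoly_Suc[of h, OF h] by blast
  obtain s0 s1 where s: "s = s0 + mpoly_var v * s1" "free_of v s0" "s0 \<in> carrier (mpoly_ring V)" "s1 \<in> carrier (mpoly_ring V)"
    using split_variable[OF ws(3), of v] by blast
  obtain w0 w1 where w: "w = w0 + mpoly_var v * w1" "free_of v w0"
    using split_variable[OF sequence_ideal_mpoly(1)[of h, OF h ws(2)], of v] by blast
  have IH: "w0 \<in> sequence_ideal (mpoly_ring V) h j \<and> w1 \<in> sequence_ideal (mpoly_ring V) h j"
    using Suc.IH[of w0 w1] Suc.prems(1) ws(2) w by simp
  have "a + mpoly_var v * b = (w0 + h j * s0) + mpoly_var v * (w1 + h j * s1)"
    unfolding ws(1) w s by (simp add: algebra_simps)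
  moreover have "free_of v (w0 + h j * s0)"
    using w(2) s(2) Suc.prems(1) by (intro free_of_closed) auto
  ultimately have "a = w0 + h j * s0" "b = w1 + h j * s1"
    using split_variable_unique Suc.prems(3) by blast+
  then show ?case using IH s(3,4) unfolding sequence_ideal_mpoly_Suc[of h, OF h] by blast
qed

section \<open>The minors of a ladder\<close>

text \<open>The graph of a ladder, with vertices numbered in the order of their appearance: the first column is
\<open>0\<close>, the first row is \<open>1\<close>, and from \<open>2\<close> on columns and rows alternate, stage \<open>k\<close> adding the vertex
\<open>k + 2\<close>. The edge \<open>x\<^bsub>2k\<^esub>\<close> joins \<open>k\<close> and \<open>k + 1\<close>; the edge \<open>x\<^bsub>2k+1\<^esub>\<close> joins \<open>v k\<close> and \<open>k + 2\<close>. The edge with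
number \<open>a k\<close> joins \<open>v k\<close> and \<open>k\<close>, the edge with number \<open>z k\<close> joins \<open>v (k - 1)\<close> and \<open>v k\<close>. The two
alternatives in \<open>step\<close> are the two values of a bit; at stage \<open>2\<close> only the first one occurs.\<close>

locale ladder_sequence =
  fixes a z v :: "nat \<Rightarrow> nat"
  assumes a1: "a (Suc 0) = 0" and v1: "v (Suc 0) = 0"
    and step: "\<And>k. 1 \<le> k \<Longrightarrow>
      (a (Suc k) = 2 * k \<and> z (Suc k) = a k \<and> v (Suc k) = k) \<or>
      (2 \<le> k \<and> a (Suc k) = 2 * k - 1 \<and> z (Suc k) = z k \<and> v (Suc k) = v (k - 1))"
begin

lemma v_less: "1 \<le> k \<Longrightarrow> v k < k"
proof (induction k rule: less_induct)
  case (less k)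
  then obtain j where k: "k = Suc j" by (cases k) auto
  show ?case
  proof (cases "j = 0")
    case True
    then show ?thesis using k v1 by simp
  next
    case False
    have "v (j - 1) < j - 1" if "2 \<le> j" using that k by (intro less.IH) auto
    then show ?thesis using step[of j] False k by auto
  qed
qed

lemma a_z_less: "1 \<le> k \<Longrightarrow> a k < 2 * k \<and> a k \<noteq> 1 \<and> (2 \<le> k \<longrightarrow> z k < 2 * k \<and> z k \<noteq> 1)"
proof (induction k rule: nat_induct_at_least)
  case base
  then show ?case using a1 by simp
next
  case (Suc k)
  then show ?case using step[of k] by auto
qed

definition end1 :: "nat \<Rightarrow> nat"
  where "end1 e = (if even e then e div 2 else v (e div 2))"

definition end2 :: "nat \<Rightarrow> nat"
  where "end2 e = (if even e then e div 2 + 1 else e div 2 + 2)"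

text \<open>The vertices are relabelled by \<open>\<iota>\<close>, so that the same computation serves the numbering of the vertices
and the rows and columns of the array.\<close>

definition edge_weight :: "(nat \<Rightarrow> 'v) \<Rightarrow> nat \<Rightarrow> ('v \<Rightarrow>\<^sub>0 nat)"
  where "edge_weight \<iota> e = single (\<iota> (end1 e)) 1 + single (\<iota> (end2 e)) 1"

lemma edge_weight_even:
  "edge_weight \<iota> (2 * k) = single (\<iota> k) 1 + single (\<iota> (k + 1)) 1"
  by (simp add: edge_weight_def end1_def end2_def)

lemma edge_weight_odd:
  "edge_weight \<iota> (2 * k + 1) = single (\<iota> (v k)) 1 + single (\<iota> (k + 2)) 1"
  by (simp add: edge_weight_def end1_def end2_def)

lemma edge_weight_pred:
  assumes "1 \<le> k"
  shows "edge_weight \<iota> (2 * k - 1) = single (\<iota> (v (k - 1))) 1 + single (\<iota> (k + 1)) 1"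
proof -
  obtain j where "k = Suc j" using assms by (cases k) auto
  then show ?thesis using edge_weight_odd[of \<iota> j] by simp
qed

lemma edge_weight_a: "1 \<le> k \<Longrightarrow> edge_weight \<iota> (a k) = single (\<iota> (v k)) 1 + single (\<iota> k) 1"
proof (induction k rule: nat_induct_at_least)
  case base
  then show ?case using a1 v1 edge_weight_even[of \<iota> 0] by simp
next
  case (Suc k)
  from step[OF Suc.hyps] show ?case
  proof (elim disjE conjE)
    assume "a (Suc k) = 2 * k" "v (Suc k) = k"
    then show ?thesis by (simp add: edge_weight_even)
  next
    assume "a (Suc k) = 2 * k - 1" "v (Suc k) = v (k - 1)"
    then show ?thesis using Suc.hyps by (simp only: edge_weight_pred) simp
  qed
qed

lemma edge_weight_z:
  "2 \<le> k \<Longrightarrow> edge_weight \<iota> (z k) = single (\<iota> (v (k - 1))) 1 + single (\<iota> (v k)) 1"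
proof (induction k rule: nat_induct_at_least)
  case base
  have "a 2 = 2 \<and> z 2 = 0 \<and> v 2 = 1" using step[of 1] a1 by (simp add: numeral_2_eq_2)
  then show ?case using v1 edge_weight_even[of \<iota> 0] by simp
next
  case (Suc k)
  have k: "1 \<le> k" using Suc.hyps by simp
  from step[OF k] show ?case
  proof (elim disjE conjE)
    assume "z (Suc k) = a k" "v (Suc k) = k"
    then show ?thesis using edge_weight_a[OF k, of \<iota>] by simp
  next
    assume "z (Suc k) = z k" "v (Suc k) = v (k - 1)"
    then show ?thesis using Suc.IH by (simp add: add.commute)
  qed
qed

lemma edge_weight_f:
  "1 \<le> k \<Longrightarrow> edge_weight \<iota> (a k) + edge_weight \<iota> (2 * k + 2) = edge_weight \<iota> (2 * k) + edge_weight \<iota> (2 * k + 1)"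
  using edge_weight_even[of \<iota> "k + 1"]
  by (simp add: edge_weight_a edge_weight_even edge_weight_odd[simplified] add.assoc add.commute add.left_commute)

lemma edge_weight_g:
  "2 \<le> k \<Longrightarrow> edge_weight \<iota> (z k) + edge_weight \<iota> (2 * k + 2) = edge_weight \<iota> (2 * k - 1) + edge_weight \<iota> (2 * k + 1)"
  using edge_weight_even[of \<iota> "k + 1"] edge_weight_pred[of k \<iota>]
  by (simp add: edge_weight_z edge_weight_odd[simplified] add.assoc add.commute add.left_commute)

text \<open>The parametrisation of the toric variety of stage \<open>k\<close>, extended to all variables: an edge of a later
stage is sent to a new variable of its own. Even numbers stand for vertices and odd ones for these new
variables. The number \<open>1\<close> is not an edge.\<close>

definition stage_weight :: "nat \<Rightarrow> nat \<Rightarrow> (nat \<Rightarrow>\<^sub>0 nat)"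
  where "stage_weight k e = (if e \<le> 2 * k + 2 \<and> e \<noteq> 1 then edge_weight (\<lambda>x. 2 * x) e
    else single (2 * e + 1) 1)"

lemma stage_weight_edge: "e \<le> 2 * k + 2 \<Longrightarrow> e \<noteq> 1 \<Longrightarrow> stage_weight k e = edge_weight (\<lambda>x. 2 * x) e"
  by (simp add: stage_weight_def)

lemma lookup_edge_weight_double:
  "lookup (edge_weight (\<lambda>x. 2 * x) e) (2 * x) = of_bool (end1 e = x) + of_bool (end2 e = x)"
  by (simp add: edge_weight_def lookup_add lookup_single when_def)

text \<open>The vertex \<open>s + 2\<close> that is added at stage \<open>s\<close> lies on the two new edges only.\<close>

lemma stage_weight_top:
  assumes "1 \<le> s"
  shows "lookup (stage_weight s e) (2 * (s + 2)) = of_bool (e = 2 * s + 1 \<or> e = 2 * s + 2)"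
proof (cases "e \<le> 2 * s + 2 \<and> e \<noteq> 1")
  case True
  have w: "lookup (stage_weight s e) (2 * (s + 2)) = of_bool (end1 e = s + 2) + of_bool (end2 e = s + 2)"
    unfolding stage_weight_edge[OF conjunct1[OF True] conjunct2[OF True]] by (rule lookup_edge_weight_double)
  show ?thesis
  proof (cases "even e")
    case e: True
    then obtain j where j: "e = 2 * j" by (rule evenE)
    then have e12: "end1 e = j" "end2 e = j + 1" by (simp_all add: end1_def end2_def)
    have "2 * j \<noteq> 2 * s + 1" by presburger
    then have eq: "(e = 2 * s + 1 \<or> e = 2 * s + 2) \<longleftrightarrow> j = s + 1" using j by auto
    show ?thesis unfolding w e12 eq using True j by auto
  next
    case False
    then obtain j where j: "e = 2 * j + 1" by (rule oddE)
    then have e12: "end1 e = v j" "end2 e = j + 2" by (simp_all add: end1_def end2_def)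
    have vj: "v j < j" "j \<le> s" using True v_less[of j] j by auto
    have "(e = 2 * s + 1 \<or> e = 2 * s + 2) \<longleftrightarrow> j = s" unfolding j by presburger
    then show ?thesis unfolding w e12 using vj by simp
  qed
next
  case False
  have "2 * e + 1 \<noteq> 2 * (s + 2)" by presburger
  moreover have "\<not> (e = 2 * s + 1 \<or> e = 2 * s + 2)" using False assms by presburger
  ultimately show ?thesis
    unfolding stage_weight_def if_not_P[OF False] lookup_single when_def by simp
qed

text \<open>The vertex \<open>s + 1\<close> lies on three edges of stage \<open>s\<close>: the corner of the new stage and the two edges of
the stage before. For \<open>s = 1\<close> the edge \<open>2 * s - 1\<close> does not exist.\<close>

lemma stage_weight_subtop:
  assumes "1 \<le> s"
  shows "lookup (stage_weight s e) (2 * (s + 1)) =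
    of_bool (e = 2 * s + 2 \<or> e = 2 * s \<or> (2 \<le> s \<and> e = 2 * s - 1))"
proof (cases "e \<le> 2 * s + 2 \<and> e \<noteq> 1")
  case True
  have w: "lookup (stage_weight s e) (2 * (s + 1)) = of_bool (end1 e = s + 1) + of_bool (end2 e = s + 1)"
    unfolding stage_weight_edge[OF conjunct1[OF True] conjunct2[OF True]] by (rule lookup_edge_weight_double)
  show ?thesis
  proof (cases "even e")
    case e: True
    then obtain j where "e = 2 * j" by (rule evenE)
    moreover have "2 * j \<noteq> 2 * s - 1" using assms by presburger
    ultimately show ?thesis unfolding w end1_def end2_def by auto
  next
    case False
    then obtain j where j: "e = 2 * j + 1" by (rule oddE)
    then have e12: "end1 e = v j" "end2 e = j + 2" by (simp_all add: end1_def end2_def)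
    have vj: "v j < j" "j \<le> s" "1 \<le> j" using True v_less[of j] j by auto
    have "(e = 2 * s + 2 \<or> e = 2 * s \<or> (2 \<le> s \<and> e = 2 * s - 1)) \<longleftrightarrow> j + 1 = s"
      unfolding j using vj by presburger
    then show ?thesis unfolding w e12 using vj by simp
  qed
next
  case False
  have "2 * e + 1 \<noteq> 2 * (s + 1)" by presburger
  moreover have "\<not> (e = 2 * s + 2 \<or> e = 2 * s \<or> (2 \<le> s \<and> e = 2 * s - 1))"
    using False assms by presburger
  ultimately show ?thesis
    unfolding stage_weight_def if_not_P[OF False] lookup_single when_def by simp
qed

text \<open>The two minors that are closed by stage \<open>k\<close>, by \<open>edge_weight_f\<close> and \<open>edge_weight_g\<close>. At stage \<open>1\<close> there
is only one, and \<open>minor_g\<close> is zero.\<close>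

definition minor_f :: "nat \<Rightarrow> (nat, 'k::field) mpoly"
  where "minor_f k = mpoly_var (a k) * mpoly_var (2 * k + 2) - mpoly_var (2 * k) * mpoly_var (2 * k + 1)"

definition minor_g :: "nat \<Rightarrow> (nat, 'k::field) mpoly"
  where "minor_g k = (if 2 \<le> k
    then mpoly_var (z k) * mpoly_var (2 * k + 2) - mpoly_var (2 * k - 1) * mpoly_var (2 * k + 1) else 0)"

end

lemma mpoly_var_mult: "mpoly_var u * mpoly_var w = (single (single u 1 + single w 1) 1 :: ('v, 'k::field) mpoly)"
  by (simp add: mpoly_var_def mult_single)

text \<open>The argument \<open>K\<close> is the number of stages, and the parameter \<open>field_type\<close> serves to fix the field of
coefficients. All ideals live in the polynomial ring \<open>S\<close> on the edges of the last stage.\<close>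

locale ladder_algebra = ladder_sequence +
  fixes K :: nat and field_type :: "'k::field itself"
begin

definition edges :: "nat set"
  where "edges = {0} \<union> {2..2 * K + 2}"

abbreviation S :: "((nat, 'k) mpoly) set"
  where "S \<equiv> carrier (mpoly_ring edges)"

lemmas S_closed = mpoly_carrier_closed[where V = edges and 'k = 'k]

lemma var_in_S: "e \<le> 2 * K + 2 \<Longrightarrow> e \<noteq> 1 \<Longrightarrow> mpoly_var e \<in> S"
  by (intro S_closed) (auto simp: edges_def)

lemma minor_f_in_S: "1 \<le> k \<Longrightarrow> k \<le> K \<Longrightarrow> minor_f k \<in> S"
  unfolding minor_f_def using a_z_less[of k] by (intro S_closed(4,6) var_in_S) auto

lemma minor_g_in_S: "1 \<le> k \<Longrightarrow> k \<le> K \<Longrightarrow> minor_g k \<in> S"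
proof (cases "2 \<le> k")
  case True
  assume "k \<le> K"
  then show ?thesis
    using a_z_less[of k] True unfolding minor_g_def
    by (simp only: if_True, intro S_closed(4,6) var_in_S) auto
qed (simp add: minor_g_def S_closed(1))

text \<open>All minors in one sequence. It continues with zeros, so that every member lies in \<open>S\<close>.\<close>

definition gen :: "nat \<Rightarrow> (nat, 'k) mpoly"
  where "gen j = (if j < 2 * K then if even j then minor_f (j div 2 + 1) else minor_g (j div 2 + 1) else 0)"

lemma gen_in_S: "gen j \<in> S"
  by (auto simp: gen_def intro!: minor_f_in_S minor_g_in_S S_closed(1))

definition G :: "nat \<Rightarrow> ((nat, 'k) mpoly) set"
  where "G k = sequence_ideal (mpoly_ring edges) gen (2 * k)"

lemmas G_closed = sequence_ideal_mpoly[of gen edges, OF gen_in_S, where j = "2 * k" for k, folded G_def]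

lemma G_0: "G 0 = {0}"
  by (simp add: G_def)

lemma G_Suc:
  assumes "Suc k \<le> K"
  shows "w \<in> G (Suc k) \<longleftrightarrow> (\<exists>u p q. w = u + minor_f (Suc k) * p + minor_g (Suc k) * q \<and> u \<in> G k \<and> p \<in> S \<and> q \<in> S)"
proof -
  have "gen (2 * k) = minor_f (Suc k)" "gen (Suc (2 * k)) = minor_g (Suc k)"
    using assms by (simp_all add: gen_def)
  then show ?thesis
    using sequence_ideal_mpoly_Suc[of gen edges, OF gen_in_S, of w "Suc (2 * k)"]
      sequence_ideal_mpoly_Suc[of gen edges, OF gen_in_S, of _ "2 * k"]
    unfolding G_def by simp blast
qed

lemma G_mono: "i \<le> j \<Longrightarrow> G i \<subseteq> G j"
  using sequence_ideal_mono[of gen edges, OF gen_in_S, of "2 * i" "2 * j"] by (auto simp: G_def)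

lemma gen_in_G:
  assumes "1 \<le> k" "k \<le> K" "p \<in> S"
  shows "minor_f k * p \<in> G k" "minor_g k * p \<in> G k"
proof -
  obtain j where k: "k = Suc j" using assms(1) by (cases k) auto
  then have "gen (2 * j) = minor_f k" "gen (2 * j + 1) = minor_g k"
    using assms(2) by (simp_all add: gen_def)
  then show "minor_f k * p \<in> G k" "minor_g k * p \<in> G k"
    using sequence_ideal_generator[of gen edges, OF gen_in_S, of "2 * j" "2 * k" p]
      sequence_ideal_generator[of gen edges, OF gen_in_S, of "2 * j + 1" "2 * k" p] assms(3) k
    by (simp_all add: G_def)
qed

lemma keys_monomial_decomp:
  fixes m :: "'v \<Rightarrow>\<^sub>0 nat"
  assumes "e \<in> keys m"
  shows "\<exists>m'. m = single e 1 + m' \<and> keys m' \<subseteq> keys m"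
proof -
  obtain m' where "m = single e 1 + m'" using assms by (rule monomial_split)
  then show ?thesis by (auto simp: keys_add_nat)
qed

lemma weight_separating:
  assumes "\<And>e'. lookup (W e') x = of_bool (e' = e)"
  shows "lookup (weight W m) x = lookup m e"
proof -
  have "lookup (weight W m) x =
      (\<Sum>e'\<in>keys m. if e' = e then lookup m e' else 0)"
    unfolding lookup_weight[OF finite_keys order_refl] assms by (rule sum.cong) auto
  then show ?thesis by (auto simp: in_keys_iff)
qed

lemma edge_weight_0: "edge_weight \<iota> 0 = single (\<iota> 0) 1 + single (\<iota> 1) 1"
  using edge_weight_even[of \<iota> 0] by simp

lemma edge_weight_2: "edge_weight \<iota> 2 = single (\<iota> 1) 1 + single (\<iota> 2) 1"
  using edge_weight_even[of \<iota> 1] by (simp add: numeral_2_eq_2)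

lemma weight_injective_0:
  assumes "weight (stage_weight 0) m1 = weight (stage_weight 0) m2"
  shows "m1 = m2"
proof (rule poly_mapping_eqI)
  fix e
  have "\<exists>x. \<forall>e'. lookup (stage_weight 0 e') x = of_bool (e' = e)"
  proof -
    have small: "e' = 0 \<or> e' = 2 \<or> \<not> (e' \<le> 2 * 0 + 2 \<and> e' \<noteq> 1)" for e' :: nat by auto
    have w: "stage_weight 0 0 = edge_weight (\<lambda>x. 2 * x) 0" "stage_weight 0 2 = edge_weight (\<lambda>x. 2 * x) 2"
      by (simp_all add: stage_weight_def)
    have w': "stage_weight 0 e' = single (2 * e' + 1) 1" if "e' \<noteq> 0" "e' \<noteq> 2" for e'
      using small[of e'] that by (auto simp: stage_weight_def)
    have odd: "2 * e' + 1 \<noteq> 4" "2 * e' + 1 \<noteq> 0" "2 * e' + 1 \<noteq> 2" for e' :: nat by presburger+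
    consider "e = 0" | "e = 2" | "e \<noteq> 0" "e \<noteq> 2" by blast
    then show ?thesis
    proof cases
      case 1
      have "lookup (stage_weight 0 e') 0 = of_bool (e' = e)" for e'
        by (cases "e' = 0 \<or> e' = 2")
          (auto simp: 1 w w' edge_weight_0 edge_weight_2 lookup_add lookup_single when_def)
      then show ?thesis by blast
    next
      case 2
      have "lookup (stage_weight 0 e') 4 = of_bool (e' = e)" for e'
        using odd(1)[of e'] by (cases "e' = 0 \<or> e' = 2")
          (auto simp: 2 w w' edge_weight_0 edge_weight_2 lookup_add lookup_single when_def)
      then show ?thesis by blast
    next
      case 3
      have "2 * e + 1 \<noteq> 4" "2 * e + 1 \<noteq> 2" by presburger+
      then have "lookup (stage_weight 0 e') (2 * e + 1) = of_bool (e' = e)" for e'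
        using 3 by (cases "e' = 0 \<or> e' = 2")
          (auto simp: w w' edge_weight_0 edge_weight_2 lookup_add lookup_single when_def)
      then show ?thesis by blast
    qed
  qed
  then obtain x where "\<And>e'. lookup (stage_weight 0 e') x = of_bool (e' = e)" by blast
  from weight_separating[of "stage_weight 0", OF this] assms
  show "lookup m1 e = lookup m2 e" by metis
qed

lemma stage_weight_relations:
  assumes "1 \<le> j" "j \<le> k"
  shows "stage_weight k (a j) + stage_weight k (2 * j + 2) = stage_weight k (2 * j) + stage_weight k (2 * j + 1)"
    and "2 \<le> j \<Longrightarrow>
      stage_weight k (z j) + stage_weight k (2 * j + 2) = stage_weight k (2 * j - 1) + stage_weight k (2 * j + 1)"
proof -
  have az: "a j < 2 * j" "a j \<noteq> 1" "2 \<le> j \<Longrightarrow> z j < 2 * j" "2 \<le> j \<Longrightarrow> z j \<noteq> 1"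
    using a_z_less[OF assms(1)] by auto
  have n: "2 * j \<noteq> 1" "2 * j + 2 \<noteq> 1" "2 * j + 1 \<noteq> 1" "2 \<le> j \<Longrightarrow> 2 * j - 1 \<noteq> 1" using assms by auto
  have le: "a j \<le> 2 * k + 2" "2 * j + 2 \<le> 2 * k + 2" "2 * j \<le> 2 * k + 2" "2 * j + 1 \<le> 2 * k + 2"
    "2 * j - 1 \<le> 2 * k + 2" "2 \<le> j \<Longrightarrow> z j \<le> 2 * k + 2" using az assms by auto
  show "stage_weight k (a j) + stage_weight k (2 * j + 2) = stage_weight k (2 * j) + stage_weight k (2 * j + 1)"
    using edge_weight_f[OF assms(1)] stage_weight_edge le n az by metis
  show "stage_weight k (z j) + stage_weight k (2 * j + 2) = stage_weight k (2 * j - 1) + stage_weight k (2 * j + 1)"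
    if "2 \<le> j" using edge_weight_g[OF that] stage_weight_edge le n az that by metis
qed

text \<open>The minors generate the binomials of the toric ideal. Let \<open>X\<close> and \<open>Y\<close> be the two edges of the last stage
\<open>s\<close>. If one of them divides both monomials, it is cancelled. If \<open>X\<close> divides \<open>m1\<close> and only \<open>Y\<close> divides
\<open>m2\<close>, compare degrees at the vertex \<open>s + 1\<close>, which lies on \<open>X\<close>: some edge \<open>e\<close> at this vertex divides
\<open>m2\<close>, and a minor replaces the product of \<open>e\<close> and \<open>Y\<close> by a multiple of \<open>X\<close>. If neither divides the
monomials, they belong to the stage before.\<close>

lemma same_weight_congruent:
  assumes "k \<le> K" "keys m1 \<subseteq> edges" "keys m2 \<subseteq> edges"
    and "weight (stage_weight k) m1 = weight (stage_weight k) m2"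
  shows "single m1 1 - single m2 1 \<in> G k"
  using assms
proof (induction k arbitrary: m1 m2)
  case 0
  then show ?case using weight_injective_0[of m1 m2] by (simp add: G_0)
next
  case (Suc k)
  define s where "s = Suc k"
  have s: "1 \<le> s" "s \<le> K" using Suc.prems by (simp_all add: s_def)
  define W where "W = stage_weight s"
  define X where "X = 2 * s + 2"
  define Y where "Y = 2 * s + 1"
  define top where "top m = lookup (weight W m) (2 * (s + 2))" for m
  have W_top: "lookup (W e) (2 * (s + 2)) = of_bool (e = Y \<or> e = X)" for e
    unfolding W_def X_def Y_def by (rule stage_weight_top[OF s(1)])
  have W_sub: "lookup (W e) (2 * (s + 1)) = of_bool (e = X \<or> e = 2 * s \<or> (2 \<le> s \<and> e = 2 * s - 1))" for e
    unfolding W_def X_def by (rule stage_weight_subtop[OF s(1)])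
  have top_pos: "top m > 0 \<longleftrightarrow> X \<in> keys m \<or> Y \<in> keys m" for m
    unfolding top_def weight_pos_iff W_top by auto
  have XY: "X \<in> edges" "Y \<in> edges" "X \<noteq> Y" using s by (auto simp: X_def Y_def edges_def)
  have XYS: "mpoly_var X \<in> S" "mpoly_var Y \<in> S" using XY by (auto intro: S_closed)
  have "single m1 1 - single m2 1 \<in> G s"
    if "top m1 = d" "keys m1 \<subseteq> edges" "keys m2 \<subseteq> edges" "weight W m1 = weight W m2"
    for d m1 m2
    using that
  proof (induction d arbitrary: m1 m2)
    case 0
    have old: "weight (stage_weight k) m = weight W m" if "top m = 0" for m
      unfolding weight_def
    proof (intro sum.cong refl)
      fix e i assume "e \<in> keys m"
      then have "e \<noteq> X" "e \<noteq> Y" using top_pos[of m] that by auto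
      then show "stage_weight k e = W e" by (auto simp: W_def X_def Y_def s_def stage_weight_def)
    qed
    have "top m2 = 0" using 0 by (simp add: top_def)
    then have "single m1 1 - single m2 1 \<in> G k"
      using Suc.prems(1) 0 old by (intro Suc.IH) simp_all
    then show ?case using G_mono[of k s] by (auto simp: s_def)
  next
    case (Suc d)
    have cancel: "single m1 1 - single m2 1 \<in> G s"
      if e: "e = X \<or> e = Y" "e \<in> keys m1" "e \<in> keys m2"
        and m: "top m1 = Suc d" "keys m1 \<subseteq> edges" "keys m2 \<subseteq> edges" "weight W m1 = weight W m2"
      for e m1 m2
    proof -
      obtain m1' m2' where m': "m1 = single e 1 + m1'" "keys m1' \<subseteq> keys m1"
        "m2 = single e 1 + m2'" "keys m2' \<subseteq> keys m2"
        using keys_monomial_decomp[OF e(2)] keys_monomial_decomp[OF e(3)] by blast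
      have "weight W m1' = weight W m2'" using m(4) unfolding m'(1,3) weight_add by simp
      moreover have "top m1' = d"
        using m(1) e(1) W_top[of e] unfolding m'(1) top_def weight_add lookup_add by auto
      ultimately have "single m1' 1 - single m2' 1 \<in> G s"
        using m m' by (intro Suc.IH) auto
      then have "mpoly_var e * (single m1' 1 - single m2' 1) \<in> G s"
        using e(1) XYS by (intro G_closed(4)) auto
      then show ?thesis by (simp add: right_diff_distrib var_times_single m'(1,3))
    qed
    have mixed: "single m1 1 - single m2 1 \<in> G s"
      if e: "X \<in> keys m1" "Y \<in> keys m2"
        and m: "top m1 = Suc d" "keys m1 \<subseteq> edges" "keys m2 \<subseteq> edges" "weight W m1 = weight W m2"
      for m1 m2
    proof (cases "X \<in> keys m2")
      case True
      then show ?thesis using cancel[of X m1 m2] e m by blast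
    next
      case False
      have "lookup (weight W m1) (2 * (s + 1)) > 0"
        unfolding weight_pos_iff W_sub using e(1) by auto
      then obtain e where e': "e \<in> keys m2" "e = 2 * s \<or> (2 \<le> s \<and> e = 2 * s - 1)"
        unfolding m(4) weight_pos_iff W_sub zero_less_of_bool_iff using False by blast
      define c where "c = (if e = 2 * s then a s else z s)"
      define p :: "(nat, 'k) mpoly" where "p = (if e = 2 * s then minor_f s else minor_g s)"
      have ne: "2 * s - 1 \<noteq> 2 * s" "e \<noteq> Y" using s(1) e'(2) by (auto simp: Y_def)
      have p: "p = mpoly_var c * mpoly_var X - mpoly_var e * mpoly_var Y"
        using e'(2) ne(1) by (auto simp: p_def c_def minor_f_def minor_g_def X_def Y_def)
      have Wc: "W c + W X = W e + W Y"
        using e'(2) ne(1) stage_weight_relations[OF s(1) order_refl]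
        by (auto simp: W_def c_def X_def Y_def)
      have pG: "p * q \<in> G s" if "q \<in> S" for q
        using gen_in_G[OF s that] by (simp add: p_def)
      have c: "c \<in> edges" using a_z_less[OF s(1)] e'(2) s ne(1) by (auto simp: c_def edges_def)
      obtain m' where m': "m2 = single Y 1 + m'" "keys m' \<subseteq> keys m2"
        using keys_monomial_decomp[OF e(2)] by blast
      have "e \<in> {Y} \<union> keys m'" using e'(1) unfolding m'(1) keys_add_nat by simp
      then have "e \<in> keys m'" using ne(2) by simp
      from keys_monomial_decomp[OF this]
      obtain m'' where m'': "m' = single e 1 + m''" "keys m'' \<subseteq> keys m'"
        by blast
      define n where "n = single X 1 + (single c 1 + m'')"
      have "keys m'' \<subseteq> edges" using m' m'' m(3) by blast
      then have n: "keys n \<subseteq> edges" "single m'' 1 \<in> S"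
        using XY c by (auto simp: n_def keys_add_nat intro: S_closed)
      have "weight W n = (W c + W X) + weight W m''"
        by (simp add: n_def weight_add add.commute add.left_commute)
      also have "\<dots> = weight W m2"
        unfolding Wc by (simp add: m'(1) m''(1) weight_add add.commute add.left_commute)
      finally have "weight W m1 = weight W n" using m(4) by simp
      then have 1: "single m1 1 - single n 1 \<in> G s"
        using m n e(1) by (intro cancel[of X]) (auto simp: n_def keys_add_nat)
      have "single n 1 - single m2 1 = p * single m'' 1"
        by (simp add: p n_def m'(1) m''(1) mpoly_var_mult left_diff_distrib mult_single add.assoc add.commute add.left_commute)
      then have 2: "single n 1 - single m2 1 \<in> G s" using pG[OF n(2)] by simp
      show ?thesis using G_closed(3)[OF 1 2] by simp
    qed
    have top2: "top m2 = Suc d" using Suc.prems by (simp add: top_def)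
    have X1: "X \<in> keys m1 \<or> Y \<in> keys m1"
      and X2: "X \<in> keys m2 \<or> Y \<in> keys m2"
      using top_pos[of m1] top_pos[of m2] Suc.prems(1) top2 by auto
    have sym: "single m1 1 - single m2 1 \<in> G s"
      if "single m2 1 - single m1 1 \<in> G s"
      using G_closed(5)[OF that] by simp
    from X1 X2 show ?case
      using cancel[of X m1 m2] cancel[of Y m1 m2] mixed[of m1 m2] mixed[of m2 m1] sym Suc.prems top2
      by metis
  qed
  then show ?case using Suc.prems unfolding W_def s_def by blast
qed

definition stage_map :: "nat \<Rightarrow> ((nat, 'k) mpoly) \<Rightarrow> ((nat, 'k) mpoly)"
  where "stage_map k = mpoly_subst (\<lambda>e. single (stage_weight k e) 1)"

text \<open>Stated for an arbitrary monomial map \<open>\<phi>\<close> that is at least as fine as the one of the stage, because the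
toric ideal is defined with rows and columns as variables.\<close>

lemma binomial_kernel_in_G:
  assumes k: "k \<le> K" and p: "p \<in> S"
    and "(\<Sum>m\<in>keys p. single (\<phi> m) (lookup p m)) = 0"
    and "\<And>m m'. keys m \<subseteq> edges \<Longrightarrow> keys m' \<subseteq> edges \<Longrightarrow> \<phi> m = \<phi> m' \<Longrightarrow>
      weight (stage_weight k) m = weight (stage_weight k) m'"
  shows "p \<in> G k"
proof (rule monomial_map_kernel_induct[OF assms(3)])
  fix m m' c assume "m \<in> keys p" "m' \<in> keys p" and \<phi>: "\<phi> m = \<phi> m'"
  then have mm: "keys m \<subseteq> edges" "keys m' \<subseteq> edges"
    using p by (auto simp: mpoly_carrier_iff)
  have "single 0 c * (single m 1 - single m' 1) \<in> G k"
    by (intro G_closed(4) same_weight_congruent k mm assms(4)[OF mm \<phi>] S_closed(7)) simp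
  then show "single m c - single m' c \<in> G k"
    by (simp add: right_diff_distrib mult_single)
qed (fact G_closed)+

text \<open>\<open>G k\<close> is the kernel of a homomorphism to a polynomial ring; this is why it is prime.\<close>

lemma G_eq_kernel:
  assumes "k \<le> K" "p \<in> S"
  shows "p \<in> G k \<longleftrightarrow> stage_map k p = 0"
proof
  have gen: "stage_map k (minor_f j) = 0" "stage_map k (minor_g j) = 0" if "1 \<le> j" "j \<le> k" for j
    using stage_weight_relations[OF that]
    by (simp_all add: stage_map_def minor_f_def minor_g_def mpoly_subst_diff mpoly_subst_mult mult_single)
  have "stage_map k w = 0" if "w \<in> G j" "j \<le> k" for w j
    using that
  proof (induction j arbitrary: w)
    case 0
    then show ?case by (simp add: G_0 stage_map_def)
  next
    case (Suc j)
    then obtain u p q where w: "w = u + minor_f (Suc j) * p + minor_g (Suc j) * q" "u \<in> G j"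
      using G_Suc[of j w] assms(1) by auto
    have "stage_map k u = 0" using Suc w by simp
    then show ?case using gen[of "Suc j"] Suc.prems(2)
      unfolding w(1) by (simp add: stage_map_def mpoly_subst_add mpoly_subst_mult)
  qed
  then show "p \<in> G k \<Longrightarrow> stage_map k p = 0" by blast
  assume "stage_map k p = 0"
  then have "(\<Sum>m\<in>keys p. single (weight (stage_weight k) m) (lookup p m)) = 0"
    by (simp add: stage_map_def mpoly_subst_weight)
  then show "p \<in> G k" by (rule binomial_kernel_in_G[OF assms])
qed

lemma G_prime:
  assumes "k \<le> K" "p \<in> S" "q \<in> S" "p * q \<in> G k"
  shows "p \<in> G k \<or> q \<in> G k"
  using assms G_eq_kernel[OF assms(1)] S_closed(4)[OF assms(2,3)]
  by (simp add: stage_map_def mpoly_subst_mult)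

lemma single_nonzero: "single m (1::'k) \<noteq> 0"
  by (metis lookup_single_eq lookup_zero zero_neq_one)

lemma var_notin_G: "k \<le> K \<Longrightarrow> mpoly_var e \<in> S \<Longrightarrow> mpoly_var e \<notin> G k"
  by (simp add: G_eq_kernel stage_map_def single_nonzero)

lemma minor_f_notin_G:
  assumes "Suc k \<le> K"
  shows "minor_f (Suc k) \<notin> G k"
proof
  assume "minor_f (Suc k) \<in> G k"
  moreover have "minor_f (Suc k) \<in> S" using assms by (intro minor_f_in_S) simp_all
  ultimately have "stage_map k (minor_f (Suc k)) = 0" using G_eq_kernel assms by simp
  then have "single (stage_weight k (a (Suc k)) + stage_weight k (2 * Suc k + 2)) (1::'k) =
      single (stage_weight k (2 * Suc k) + stage_weight k (2 * Suc k + 1)) 1"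
    by (simp add: stage_map_def minor_f_def mpoly_subst_diff mpoly_subst_mult mult_single)
  then have eq: "stage_weight k (a (Suc k)) + stage_weight k (2 * Suc k + 2) =
      stage_weight k (2 * Suc k) + stage_weight k (2 * Suc k + 1)"
    by (metis keys_single singleton_iff zero_neq_one)
  define i where "i = 2 * (2 * Suc k + 2) + 1"
  have "lookup (edge_weight (\<lambda>x. 2 * x) (2 * Suc k)) i = 0"
    unfolding edge_weight_even lookup_add lookup_single when_def i_def by auto
  then have "lookup (stage_weight k (2 * Suc k) + stage_weight k (2 * Suc k + 1)) i = 0"
    by (simp add: lookup_add stage_weight_def lookup_single when_def i_def)
  moreover have "lookup (stage_weight k (a (Suc k)) + stage_weight k (2 * Suc k + 2)) i \<noteq> 0"
    by (simp add: lookup_add stage_weight_def i_def)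
  ultimately show False using eq by simp
qed

section \<open>A regular sequence in the toric ideal\<close>

text \<open>The sequence starts at index \<open>0\<close>, the stages at \<open>1\<close>.\<close>

definition f_sequence :: "nat \<Rightarrow> (nat, 'k) mpoly"
  where "f_sequence j = (if j < K then minor_f (Suc j) else 0)"

lemma f_sequence_in_S: "f_sequence j \<in> S"
  by (simp add: f_sequence_def minor_f_in_S S_closed(1))

lemma free_of_minor_f: "1 \<le> k \<Longrightarrow> 2 * k + 2 < w \<Longrightarrow> free_of w (minor_f k)"
  unfolding minor_f_def using a_z_less[of k] by (intro free_of_closed(3,4,6)) auto

lemma free_of_minor_g: "1 \<le> k \<Longrightarrow> 2 * k + 2 < w \<Longrightarrow> free_of w (minor_g k :: (nat, 'k) mpoly)"
proof (cases "2 \<le> k")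
  case True
  assume "2 * k + 2 < w"
  then show ?thesis unfolding minor_g_def if_P[OF True] using a_z_less[of k] True
    by (intro free_of_closed(3,4,6)) auto
qed (simp add: minor_g_def free_of_def)

lemma free_of_f_sequence: "i < j \<Longrightarrow> 2 * j + 2 < w \<Longrightarrow> free_of w (f_sequence i)"
  using free_of_minor_f[of "Suc i" w] by (auto simp: f_sequence_def free_of_def)

lemma free_of_gen: "i < 2 * k \<Longrightarrow> 2 * k + 2 < w \<Longrightarrow> free_of w (gen i)"
proof -
  assume i: "i < 2 * k" "2 * k + 2 < w"
  then have w: "2 * (i div 2 + 1) + 2 < w" by presburger
  have "free_of w (minor_f (i div 2 + 1) :: (nat, 'k) mpoly)"
    "free_of w (minor_g (i div 2 + 1) :: (nat, 'k) mpoly)"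
    by (rule free_of_minor_f free_of_minor_g, simp, rule w)+
  then show ?thesis unfolding gen_def by (simp add: free_of_closed(1))
qed

abbreviation J :: "nat \<Rightarrow> ((nat, 'k) mpoly) set"
  where "J j \<equiv> sequence_ideal (mpoly_ring edges) f_sequence j"

lemmas J_closed = sequence_ideal_mpoly[of f_sequence edges, OF f_sequence_in_S]

lemma J_split:
  assumes "p + mpoly_var w * q \<in> J j" "free_of w p" "2 * j + 2 < w"
  shows "p \<in> J j" "q \<in> J j"
proof -
  have "p \<in> J j \<and> q \<in> J j"
    by (rule sequence_ideal_split_variable[of f_sequence, OF f_sequence_in_S free_of_f_sequence[OF _ assms(3)] assms(1,2)])
  then show "p \<in> J j" "q \<in> J j" by blast+
qed

lemma G_split:
  assumes "p + mpoly_var w * q \<in> G k" "free_of w p" "2 * k + 2 < w"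
  shows "p \<in> G k" "q \<in> G k"
proof -
  have "p \<in> G k \<and> q \<in> G k"
    unfolding G_def
    by (rule sequence_ideal_split_variable[of gen, OF gen_in_S free_of_gen[OF _ assms(3)] assms(1)[unfolded G_def] assms(2)])
  then show "p \<in> G k" "q \<in> G k" by blast+
qed

text \<open>Modulo the ideal \<open>J j\<close>, which does not involve \<open>x\<close> and \<open>y\<close>, the minor is \<open>c * x - b * y\<close>. Setting
\<open>x = 0\<close> in a relation \<open>f h = 0\<close> shows that the remainder of \<open>h\<close> on division by \<open>x\<close> vanishes modulo
\<open>J j\<close>, since \<open>b\<close> and \<open>y\<close> can be cancelled; the quotient is treated by induction on the degree in \<open>x\<close>.\<close>

lemma f_cancel_step:
  assumes j: "j < K" and last: "\<And>h. h \<in> S \<Longrightarrow> mpoly_var (2 * j + 2) * h \<in> J j \<Longrightarrow> h \<in> J j"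
    and "h \<in> S" "f_sequence j * h \<in> J j"
  shows "h \<in> J j"
proof -
  define x :: "(nat, 'k) mpoly" where "x = mpoly_var (2 * Suc j + 2)"
  define y :: "(nat, 'k) mpoly" where "y = mpoly_var (2 * Suc j + 1)"
  define b :: "(nat, 'k) mpoly" where "b = mpoly_var (2 * Suc j)"
  define c :: "(nat, 'k) mpoly" where "c = mpoly_var (a (Suc j))"
  have f: "f_sequence j = c * x - b * y"
    using j by (simp add: f_sequence_def minor_f_def x_def y_def b_def c_def)
  have bound: "2 * j + 2 < 2 * Suc j + 2" and bound': "2 * j + 2 < 2 * Suc j + 1" by simp_all
  have c: "a (Suc j) < 2 * Suc j" "a (Suc j) \<noteq> 1" using a_z_less[of "Suc j"] by auto
  have S: "x \<in> S" "y \<in> S" "b \<in> S" "c \<in> S"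
    unfolding x_def y_def b_def c_def using j c by (auto intro!: var_in_S)
  have "h \<in> J j" if "\<forall>m\<in>keys h. lookup m (2 * Suc j + 2) < D" "h \<in> S" "f_sequence j * h \<in> J j" for D h
    using that
  proof (induction D arbitrary: h)
    case 0
    then have "keys h = {}" by auto
    then have "h = 0" by simp
    then show ?case using J_closed(2) by simp
  next
    case (Suc D)
    obtain h0 h1 where h: "h = h0 + x * h1" "free_of (2 * Suc j + 2) h0" "h0 \<in> S" "h1 \<in> S"
      "\<forall>m\<in>keys h1. lookup m (2 * Suc j + 2) < D"
      using split_variable[OF Suc.prems(2), of "2 * Suc j + 2"] Suc.prems(1) unfolding x_def by blast
    have "f_sequence j * h = - (b * (y * h0)) + x * (c * h0 + f_sequence j * h1)"
      unfolding f h(1) by (simp add: algebra_simps)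
    then have sum: "- (b * (y * h0)) + x * (c * h0 + f_sequence j * h1) \<in> J j" using Suc.prems(3) by simp
    have fr: "free_of (2 * Suc j + 2) (- (b * (y * h0)))"
      unfolding b_def y_def using h(2) by (intro free_of_closed(4,5,6)) auto
    note parts = J_split[OF sum[unfolded x_def] fr bound]
    have "b * (y * h0) \<in> J j" using J_closed(5)[OF parts(1)] by simp
    then have "y * h0 \<in> J j" using last[of "y * h0"] S_closed(4)[OF S(2) h(3)] by (simp add: b_def)
    then have "0 + mpoly_var (2 * Suc j + 1) * h0 \<in> J j" unfolding y_def add_0 .
    then have h0: "h0 \<in> J j" by (rule J_split(2)[OF _ free_of_closed(1) bound'])
    then have "c * h0 + f_sequence j * h1 - c * h0 \<in> J j"
      by (intro J_closed(6) J_closed(4) parts S)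
    then have "h1 \<in> J j" using Suc.IH[OF h(5,4)] by simp
    then show ?case unfolding h(1) by (intro J_closed(3) J_closed(4) h0 S)
  qed
  moreover have "\<exists>D. \<forall>m\<in>keys h. lookup m (2 * Suc j + 2) < D"
    using finite_nat_set_iff_bounded[of "(\<lambda>m. lookup m (2 * Suc j + 2)) ` keys h"] by auto
  ultimately show ?thesis using assms(3,4) by blast
qed

text \<open>The assumption of \<open>f_cancel_step\<close> on \<open>b\<close>, which is the corner variable of the stage before: modulo
\<open>x\<close>, the minor becomes \<open>- b * y\<close>, and by induction \<open>b\<close> can be cancelled modulo the ideal \<open>J j\<close> of the
earlier minors.\<close>

lemma last_variable_cancel:
  "j < K \<Longrightarrow> h \<in> S \<Longrightarrow> mpoly_var (2 * j + 2) * h \<in> J j \<Longrightarrow> h \<in> J j"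
proof (induction j arbitrary: h)
  case 0
  then have "mpoly_var 2 * h = 0" by simp
  then show ?case by simp
next
  case (Suc j)
  define x :: "(nat, 'k) mpoly" where "x = mpoly_var (2 * Suc j + 2)"
  define y :: "(nat, 'k) mpoly" where "y = mpoly_var (2 * Suc j + 1)"
  define b :: "(nat, 'k) mpoly" where "b = mpoly_var (2 * Suc j)"
  define c :: "(nat, 'k) mpoly" where "c = mpoly_var (a (Suc j))"
  have j: "j < K" using Suc.prems by simp
  have f: "f_sequence j = c * x - b * y"
    using j by (simp add: f_sequence_def minor_f_def x_def y_def b_def c_def)
  have bound: "2 * j + 2 < 2 * Suc j + 2" and bound': "2 * j + 2 < 2 * Suc j + 1" by simp_all
  have c: "a (Suc j) < 2 * Suc j" "a (Suc j) \<noteq> 1" using a_z_less[of "Suc j"] by auto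
  have S: "x \<in> S" "y \<in> S" "b \<in> S" "c \<in> S"
    unfolding x_def y_def b_def c_def using j c by (auto intro!: var_in_S)
  obtain w s where ws: "x * h = w + f_sequence j * s" "w \<in> J j" "s \<in> S"
    using Suc.prems(3) unfolding sequence_ideal_mpoly_Suc[of f_sequence, OF f_sequence_in_S] x_def by blast
  obtain s0 s1 where s: "s = s0 + x * s1" "free_of (2 * Suc j + 2) s0" "s0 \<in> S" "s1 \<in> S"
    using split_variable[OF ws(3), of "2 * Suc j + 2"] unfolding x_def by blast
  have "w = x * h - f_sequence j * s" using ws(1) by simp
  also have "\<dots> = b * (y * s0) + x * (h - c * s0 - f_sequence j * s1)"
    unfolding f s(1) by (simp add: algebra_simps)
  finally have sum: "b * (y * s0) + x * (h - c * s0 - f_sequence j * s1) \<in> J j" using ws(2) by simp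
  have fr: "free_of (2 * Suc j + 2) (b * (y * s0))"
    unfolding b_def y_def using s(2) by (intro free_of_closed(4,6)) auto
  note parts = J_split[OF sum[unfolded x_def] fr bound]
  have "y * s0 \<in> J j" using Suc.IH[of "y * s0"] parts(1) j S_closed(4)[OF S(2) s(3)] by (simp add: b_def)
  then have "0 + mpoly_var (2 * Suc j + 1) * s0 \<in> J j" unfolding y_def add_0 .
  then have "s0 \<in> J j" by (rule J_split(2)[OF _ free_of_closed(1) bound'])
  then have "(h - c * s0 - f_sequence j * s1) + c * s0 \<in> J j"
    by (intro J_closed(3) J_closed(4) parts S)
  then have "h - f_sequence j * s1 \<in> J j" by simp
  then show ?case unfolding sequence_ideal_mpoly_Suc[of f_sequence, OF f_sequence_in_S]
    using s(4) by (intro exI[of _ "h - f_sequence j * s1"] exI[of _ s1]) simp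
qed

theorem f_sequence_regular: "j < K \<Longrightarrow> h \<in> S \<Longrightarrow> f_sequence j * h \<in> J j \<Longrightarrow> h \<in> J j"
  using f_cancel_step last_variable_cancel by blast

section \<open>The upper bound for the projective dimension\<close>

interpretation coefficient_ring S
  by unfold_locales (fact S_closed)+

definition is_ideal :: "((nat, 'k) mpoly) set \<Rightarrow> bool"
  where "is_ideal I \<longleftrightarrow> I \<subseteq> S \<and> 0 \<in> I \<and> (\<forall>u\<in>I. \<forall>w\<in>I. u + w \<in> I) \<and> (\<forall>r\<in>S. \<forall>u\<in>I. r * u \<in> I)"

lemma is_idealD:
  assumes "is_ideal I"
  shows "u \<in> I \<Longrightarrow> u \<in> S" "0 \<in> I" "u \<in> I \<Longrightarrow> w \<in> I \<Longrightarrow> u + w \<in> I" "r \<in> S \<Longrightarrow> u \<in> I \<Longrightarrow> r * u \<in> I"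
    "u \<in> I \<Longrightarrow> - u \<in> I" "u \<in> I \<Longrightarrow> w \<in> I \<Longrightarrow> u - w \<in> I"
proof -
  show 0: "u \<in> I \<Longrightarrow> u \<in> S" "0 \<in> I" "u \<in> I \<Longrightarrow> w \<in> I \<Longrightarrow> u + w \<in> I" "r \<in> S \<Longrightarrow> u \<in> I \<Longrightarrow> r * u \<in> I" for u w r
    using assms by (auto simp: is_ideal_def)
  show m: "u \<in> I \<Longrightarrow> - u \<in> I" for u
    using 0(4)[of "- 1" u] S_closed(5)[OF S_closed(2)] by simp
  show "u \<in> I \<Longrightarrow> w \<in> I \<Longrightarrow> u - w \<in> I"
    using 0(3)[of u "- w"] m[of w] by simp
qed

lemma is_ideal_G: "is_ideal (G k)"
  unfolding is_ideal_def using G_closed(1-4) by blast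

lemma is_ideal_S: "is_ideal S"
  unfolding is_ideal_def using S_closed(1,3,4) by blast

text \<open>Ideals are placed at position \<open>0\<close> of the sequences.\<close>

definition ideal_pd_le :: "nat \<Rightarrow> ((nat, 'k) mpoly) set \<Rightarrow> ((nat, 'k) mpoly) set \<Rightarrow> bool"
  where "ideal_pd_le d U W \<longleftrightarrow> pd_le d (single 0 ` U) (single 0 ` W)"

lemma submod_ideal: "is_ideal I \<Longrightarrow> submod (single 0 ` I)"
  by (rule submod_single) (rule is_idealD; assumption)+

lemma ideal_pd_le_mono: "ideal_pd_le d U W \<Longrightarrow> d \<le> e \<Longrightarrow> ideal_pd_le e U W"
  unfolding ideal_pd_le_def by (rule pd_le_mono)

lemma ideal_pd_le_quotient:
  assumes "is_ideal W" "is_ideal V" "is_ideal U" "W \<subseteq> V" "V \<subseteq> U" "ideal_pd_le d V W" "ideal_pd_le (Suc d) U W"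
  shows "ideal_pd_le (Suc d) U V"
  using assms(6,7) unfolding ideal_pd_le_def
  by (rule pd_le_quotient[OF submod_ideal[OF assms(1)] submod_ideal[OF assms(2)] submod_ideal[OF assms(3)]
        image_mono[OF assms(4)] image_mono[OF assms(5)]])

lemma ideal_pd_le_sub:
  assumes "is_ideal W" "is_ideal V" "is_ideal U" "W \<subseteq> V" "V \<subseteq> U"
    "ideal_pd_le (Suc d) U W" "ideal_pd_le (Suc (Suc d)) U V"
  shows "ideal_pd_le (Suc d) V W"
  using assms(6,7) unfolding ideal_pd_le_def
  by (rule pd_le_sub[OF submod_ideal[OF assms(1)] submod_ideal[OF assms(2)] submod_ideal[OF assms(3)]
        image_mono[OF assms(4)] image_mono[OF assms(5)]])

text \<open>The isomorphisms that occur are multiplications by a fraction \<open>b / c\<close> modulo an ideal; they relate \<open>u\<close> to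
\<open>u'\<close> if \<open>b * u\<close> and \<open>c * u'\<close> are congruent.\<close>

lemma ideal_pd_le_transfer:
  assumes "ideal_pd_le d U W" "is_ideal U" "is_ideal U'" and I: "is_ideal I" and bc: "b \<in> S" "c \<in> S"
    and t: "\<And>u. u \<in> U \<Longrightarrow> \<exists>u'\<in>U'. b * u - c * u' \<in> I"
    and t': "\<And>u'. u' \<in> U' \<Longrightarrow> \<exists>u\<in>U. b * u - c * u' \<in> I"
    and W: "\<And>u u'. u \<in> U \<Longrightarrow> u' \<in> U' \<Longrightarrow> b * u - c * u' \<in> I \<Longrightarrow> u \<in> W \<longleftrightarrow> u' \<in> W'"
  shows "ideal_pd_le d U' W'"
proof -
  define Q where "Q u w \<longleftrightarrow> (\<exists>p q. u = single (0::nat) p \<and> w = single (0::nat) q \<and> b * p - c * q \<in> I)" for u w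
  have Qs: "Q (single 0 p) (single 0 q) \<longleftrightarrow> b * p - c * q \<in> I" for p q
  proof
    assume "Q (single 0 p) (single 0 q)"
    then obtain p' q' where "single (0::nat) p = single 0 p'"
      "single (0::nat) q = single 0 q'" "b * p' - c * q' \<in> I"
      unfolding Q_def by blast
    then show "b * p - c * q \<in> I" by (metis lookup_single_eq)
  qed (auto simp: Q_def)
  show ?thesis
    unfolding ideal_pd_le_def
  proof (rule pd_le_transfer[where Q = Q])
    show "linear_rel Q"
      unfolding linear_rel_def
    proof (intro conjI allI ballI impI)
      show "Q 0 0" using Qs[of 0 0] is_idealD(2)[OF I] by simp
    next
      fix u w u' w' assume "Q u u'" "Q w w'"
      then obtain p q p' q' where h: "u = single 0 p" "u' = single 0 p'" "b * p - c * p' \<in> I"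
        "w = single 0 q" "w' = single 0 q'" "b * q - c * q' \<in> I"
        unfolding Q_def by blast
      have "b * (p + q) - c * (p' + q') \<in> I" using is_idealD(3)[OF I h(3,6)] by (simp add: algebra_simps)
      then show "Q (u + w) (u' + w')" unfolding h single_add[symmetric] Qs .
    next
      fix r u u' assume r: "r \<in> S" and "Q u u'"
      then obtain p p' where h: "u = single 0 p" "u' = single 0 p'" "b * p - c * p' \<in> I"
        unfolding Q_def by blast
      have "b * (r * p) - c * (r * p') \<in> I" using is_idealD(4)[OF I r h(3)] by (simp add: algebra_simps)
      then show "Q (scal r u) (scal r u')" unfolding h scal_single Qs .
    qed
  next
    fix u u' assume "u \<in> single 0 ` U" "u' \<in> single 0 ` U'" "Q u u'"
    then show "u \<in> single 0 ` W \<longleftrightarrow> u' \<in> single 0 ` W'"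
      using W Qs by (elim imageE) (simp add: inj_image_mem_iff[OF inj_single])
  qed (use assms Qs in \<open>auto simp: ideal_pd_le_def submod_ideal\<close>)
qed

definition adjoin :: "((nat, 'k) mpoly) set \<Rightarrow> ((nat, 'k) mpoly) \<Rightarrow> ((nat, 'k) mpoly) set"
  where "adjoin I x = {w + x * p | w p. w \<in> I \<and> p \<in> S}"

lemma adjoinI: "w \<in> I \<Longrightarrow> p \<in> S \<Longrightarrow> w + x * p \<in> adjoin I x"
  by (auto simp: adjoin_def)

lemma is_ideal_adjoin:
  assumes I: "is_ideal I" and x: "x \<in> S"
  shows "is_ideal (adjoin I x)" "I \<subseteq> adjoin I x"
proof -
  note D = is_idealD[OF I]
  show sub: "I \<subseteq> adjoin I x"
  proof
    fix w assume "w \<in> I"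
    then show "w \<in> adjoin I x" using adjoinI[of w I 0 x] S_closed(1) by simp
  qed
  show "is_ideal (adjoin I x)"
    unfolding is_ideal_def
  proof (intro conjI ballI)
    show "adjoin I x \<subseteq> S" using D(1) x S_closed(3,4) unfolding adjoin_def by blast
    show "0 \<in> adjoin I x" using D(2) sub by blast
  next
    fix u w assume "u \<in> adjoin I x" "w \<in> adjoin I x"
    then obtain u' p w' q where h: "u = u' + x * p" "u' \<in> I" "p \<in> S" "w = w' + x * q" "w' \<in> I" "q \<in> S"
      unfolding adjoin_def by blast
    have "(u' + w') + x * (p + q) \<in> adjoin I x" using h by (intro adjoinI D(3) S_closed(3))
    then show "u + w \<in> adjoin I x" unfolding h by (simp add: algebra_simps)
  next
    fix r u assume r: "r \<in> S" and "u \<in> adjoin I x"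
    then obtain u' p where h: "u = u' + x * p" "u' \<in> I" "p \<in> S" unfolding adjoin_def by blast
    have "r * u' + x * (r * p) \<in> adjoin I x" using h r by (intro adjoinI D(4) S_closed(4))
    then show "r * u \<in> adjoin I x" unfolding h by (simp add: algebra_simps)
  qed
qed

text \<open>Multiplication by a nonzerodivisor \<open>x\<close> identifies \<open>S / I\<close> with \<open>(I + (x)) / I\<close>.\<close>

lemma pd_adjoin:
  assumes I: "is_ideal I" and x: "x \<in> S" and cancel: "\<And>u. u \<in> S \<Longrightarrow> x * u \<in> I \<Longrightarrow> u \<in> I"
    and pd: "ideal_pd_le d S I"
  shows "ideal_pd_le (Suc d) S (adjoin I x)"
proof (rule ideal_pd_le_quotient[OF I is_ideal_adjoin(1)[OF I x] is_ideal_S is_ideal_adjoin(2)[OF I x]])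
  note D = is_idealD[OF I]
  show "adjoin I x \<subseteq> S" using is_idealD(1)[OF is_ideal_adjoin(1)[OF I x]] by blast
  show "ideal_pd_le (Suc d) S I" using pd by (rule ideal_pd_le_mono) simp
  show "ideal_pd_le d (adjoin I x) I"
  proof (rule ideal_pd_le_transfer[OF pd is_ideal_S is_ideal_adjoin(1)[OF I x] I x S_closed(2)])
    show "\<exists>u'\<in>adjoin I x. x * u - 1 * u' \<in> I" if "u \<in> S" for u
      using adjoinI[OF D(2) that, of x] D(2) by (intro bexI[of _ "x * u"]) simp_all
    show "\<exists>u\<in>S. x * u - 1 * u' \<in> I" if u': "u' \<in> adjoin I x" for u'
    proof -
      obtain w p where h: "u' = w + x * p" "w \<in> I" "p \<in> S" using u' unfolding adjoin_def by blast
      then show ?thesis using D(5)[OF h(2)] by (intro bexI[of _ p]) simp_all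
    qed
    show "u \<in> I \<longleftrightarrow> u' \<in> I" if u: "u \<in> S" "u' \<in> adjoin I x" "x * u - 1 * u' \<in> I" for u u'
    proof
      assume "u \<in> I"
      then have "x * u - (x * u - 1 * u') \<in> I" using D(4)[OF x] D(6) u(3) by blast
      then show "u' \<in> I" by simp
    next
      assume "u' \<in> I"
      then have "(x * u - 1 * u') + u' \<in> I" using D(3) u(3) by blast
      then show "u \<in> I" using cancel[OF u(1)] by simp
    qed
  qed
qed

lemma base_pd: "ideal_pd_le 0 S {0}"
proof -
  have "single 0 ` S = free_on {0::nat}"
  proof (intro equalityI subsetI)
    fix c assume c: "c \<in> free_on {0::nat}"
    then have "c = single 0 (lookup c 0)"
      by (intro poly_mapping_eqI) (auto simp: free_on_def lookup_single when_def)
    then show "c \<in> single 0 ` S" using c by (auto simp: free_on_def)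
  qed (auto simp: free_on_def lookup_single when_def S_closed(1))
  then show ?thesis using pd_le_free[of "{0}"] by (simp add: ideal_pd_le_def)
qed

lemma G_cancel: "k \<le> K \<Longrightarrow> x \<in> S \<Longrightarrow> x \<notin> G k \<Longrightarrow> u \<in> S \<Longrightarrow> x * u \<in> G k \<Longrightarrow> u \<in> G k"
  using G_prime by blast

text \<open>The edges \<open>a\<close> and \<open>z\<close> of stage \<open>s + 1\<close> and the two new edges of stage \<open>s\<close> form a four-cycle, and its
minor is one of the two minors of stage \<open>s\<close>, depending on the bit.\<close>

lemma minor_in_G:
  assumes "1 \<le> s" "s \<le> K"
  shows "mpoly_var (z (Suc s)) * mpoly_var (2 * s + 2) - mpoly_var (a (Suc s)) * mpoly_var (2 * s + 1) \<in> G s"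
proof -
  from step[OF assms(1)] have "mpoly_var (z (Suc s)) * mpoly_var (2 * s + 2) - mpoly_var (a (Suc s)) * mpoly_var (2 * s + 1)
      = (minor_f s :: (nat, 'k) mpoly) \<or>
    mpoly_var (z (Suc s)) * mpoly_var (2 * s + 2) - mpoly_var (a (Suc s)) * mpoly_var (2 * s + 1)
      = (minor_g s :: (nat, 'k) mpoly)"
    by (elim disjE conjE) (simp_all add: minor_f_def minor_g_def)
  then show ?thesis using gen_in_G[OF assms S_closed(2)] by auto
qed

text \<open>In the induction step, \<open>x\<close> and \<open>y\<close> are the new variables of stage \<open>s\<close>, \<open>f\<close> and \<open>g\<close> are the minors of
stage \<open>s + 1\<close>, and \<open>U\<close> is generated by \<open>G m\<close>, \<open>x\<close> and \<open>y\<close>, where \<open>m + 1 = s\<close>. The ideal \<open>U\<close> contains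
\<open>G s\<close>, and \<open>U / G s\<close> is isomorphic to \<open>G (s + 1) / G s\<close> by multiplication with \<open>f / x\<close>, which sends \<open>x\<close>
to \<open>f\<close> and \<open>y\<close> to \<open>g\<close>.\<close>

theorem pd_G: "k \<le> K \<Longrightarrow> ideal_pd_le k S (G k)"
proof (induction k rule: less_induct)
  case (less k)
  consider "k = 0" | "k = 1" | m where "k = Suc (Suc m)" by (metis One_nat_def not0_implies_Suc)
  then show ?case
  proof cases
    case 1
    then show ?thesis using base_pd by (simp add: G_0)
  next
    case 2
    have f: "minor_f 1 \<in> S" "minor_f 1 \<notin> G 0"
      using less.prems 2 minor_f_in_S[of 1] minor_f_notin_G[of 0] by simp_all
    have "G 1 = adjoin (G 0) (minor_f 1)"
    proof (rule Set.set_eqI)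
      fix w
      show "w \<in> G 1 \<longleftrightarrow> w \<in> adjoin (G 0) (minor_f 1)"
        using G_Suc[of 0 w] less.prems 2 S_closed(1) by (auto simp: minor_g_def adjoin_def)
    qed
    moreover have "ideal_pd_le (Suc 0) S (adjoin (G 0) (minor_f 1))"
      using G_cancel[of 0 "minor_f 1"] f base_pd by (intro pd_adjoin is_ideal_G) (simp_all add: G_0)
    ultimately show ?thesis using 2 by simp
  next
    case (3 m)
    define s where "s = Suc m"
    have s: "1 \<le> s" "s \<le> K" "m \<le> K" "k = Suc s" "Suc s \<le> K" using 3 less.prems by (simp_all add: s_def)
    define x :: "(nat, 'k) mpoly" where "x = mpoly_var (2 * s + 2)"
    define y :: "(nat, 'k) mpoly" where "y = mpoly_var (2 * s + 1)"
    define f :: "(nat, 'k) mpoly" where "f = minor_f (Suc s)"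
    define g :: "(nat, 'k) mpoly" where "g = minor_g (Suc s)"
    have xy: "x \<in> S" "y \<in> S" unfolding x_def y_def using s by (auto intro!: var_in_S)
    have fg: "f \<in> S" "g \<in> S" "f \<notin> G s"
      unfolding f_def g_def using s minor_f_notin_G minor_f_in_S minor_g_in_S by auto
    have notin: "x \<notin> G m" "y \<notin> G m" "x \<notin> G s"
      using xy var_notin_G s by (simp_all add: x_def y_def)
    define A where "A = adjoin (G m) x"
    define U where "U = adjoin A y"
    have A: "is_ideal A" "G m \<subseteq> A" using is_ideal_adjoin[OF is_ideal_G xy(1)] by (simp_all add: A_def)
    have U: "is_ideal U" "A \<subseteq> U" using is_ideal_adjoin[OF A(1) xy(2)] by (simp_all add: U_def)
    note GD = is_idealD[OF is_ideal_G[of s]]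
    have pdA: "ideal_pd_le (Suc m) S A"
      unfolding A_def using G_cancel[OF s(3) xy(1) notin(1)] less.IH[of m] 3 s(3)
      by (intro pd_adjoin is_ideal_G xy) simp_all
    have y_cancel: "u \<in> A" if u: "u \<in> S" "y * u \<in> A" for u
    proof -
      obtain w q where w: "y * u = w + x * q" "w \<in> G m" "q \<in> S"
        using u(2) unfolding A_def adjoin_def by blast
      obtain u0 u1 where u01: "u = u0 + x * u1" "free_of (2 * s + 2) u0" "u0 \<in> S" "u1 \<in> S"
        using split_variable[OF u(1), of "2 * s + 2"] unfolding x_def by blast
      have "y * u0 + x * (y * u1 - q) = w" using w(1) unfolding u01(1) by (simp add: algebra_simps)
      then have sum: "y * u0 + x * (y * u1 - q) \<in> G m" using w(2) by simp
      have fr: "free_of (2 * s + 2) (y * u0)"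
        unfolding y_def using u01(2) by (intro free_of_closed(4,6)) auto
      have "2 * m + 2 < 2 * s + 2" by (simp add: s_def)
      then have "y * u0 \<in> G m" by (rule G_split(1)[OF sum[unfolded x_def] fr])
      then have "u0 \<in> G m" using G_cancel[OF s(3) xy(2) notin(2) u01(3)] by blast
      then show ?thesis unfolding A_def u01(1) by (intro adjoinI u01(4))
    qed
    have pdU: "ideal_pd_le (Suc (Suc m)) S U"
      unfolding U_def by (rule pd_adjoin[OF A(1) xy(2) y_cancel pdA])
    have pdG: "ideal_pd_le (Suc m) S (G s)" using less.IH[of s] s by (simp add: s_def)
    have in_U: "w + x * p + y * q \<in> U" if "w \<in> G m" "p \<in> S" "q \<in> S" for w p q
      unfolding U_def A_def using that by (intro adjoinI)
    have GU: "G s \<subseteq> U"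
    proof
      fix w assume "w \<in> G s"
      then obtain u p q where h: "w = u + minor_f s * p + minor_g s * q" "u \<in> G m" "p \<in> S" "q \<in> S"
        using G_Suc[of m w] s by (auto simp: s_def)
      have vars: "mpoly_var (a s) \<in> S" "mpoly_var (2 * s) \<in> S" "2 \<le> s \<Longrightarrow> mpoly_var (z s) \<in> S"
        "2 \<le> s \<Longrightarrow> mpoly_var (2 * s - 1) \<in> S"
        using a_z_less[OF s(1)] s by (auto intro!: var_in_S)
      have xU: "x * p \<in> U" "y * p \<in> U" if "p \<in> S" for p
        using in_U[of 0 p 0] in_U[of 0 0 p] is_idealD(2)[OF is_ideal_G[of m]] that S_closed(1) by simp_all
      note UD = is_idealD[OF U(1)]
      have "minor_f s = x * mpoly_var (a s) - y * mpoly_var (2 * s)"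
        by (simp add: minor_f_def x_def y_def mult.commute)
      then have "minor_f s \<in> U" using UD(6) xU vars by simp
      moreover have "minor_g s \<in> U"
      proof (cases "2 \<le> s")
        case True
        then have "minor_g s = x * mpoly_var (z s) - y * mpoly_var (2 * s - 1)"
          by (simp add: minor_g_def x_def y_def mult.commute)
        then show ?thesis using UD(6) xU vars True by simp
      qed (simp add: minor_g_def UD(2))
      ultimately have "p * minor_f s \<in> U" "q * minor_g s \<in> U" using UD(4) h by blast+
      moreover have "u \<in> U" using h(2) A(2) U(2) by blast
      ultimately show "w \<in> U" unfolding h(1) using UD(3) by (simp add: mult.commute)
    qed
    have US: "U \<subseteq> S" using is_idealD(1)[OF U(1)] by blast
    have pdQ: "ideal_pd_le (Suc m) U (G s)"
      by (rule ideal_pd_le_sub[OF is_ideal_G U(1) is_ideal_S GU US pdG pdU])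
    \<comment> \<open>The syzygy behind the isomorphism: it is a minor of the previous stage times the newest corner variable.\<close>
    have "x * g - y * f = mpoly_var (2 * Suc s + 2) *
        (mpoly_var (z (Suc s)) * mpoly_var (2 * s + 2) - mpoly_var (a (Suc s)) * mpoly_var (2 * s + 1))"
      using s(1) by (simp add: x_def y_def f_def g_def minor_f_def minor_g_def algebra_simps)
    moreover have "mpoly_var (2 * Suc s + 2) \<in> S" using s by (intro var_in_S) auto
    ultimately have syz: "x * g - y * f \<in> G s"
      using GD(4) minor_in_G[OF s(1,2)] by simp
    have GS: "G s \<subseteq> G (Suc s)" by (rule G_mono) simp
    have "ideal_pd_le (Suc m) (G (Suc s)) (G s)"
    proof (rule ideal_pd_le_transfer[OF pdQ U(1) is_ideal_G is_ideal_G[of s] fg(1) xy(1)])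
      fix u assume "u \<in> U"
      then obtain w p q where h: "u = w + x * p + y * q" "w \<in> G m" "p \<in> S" "q \<in> S"
        unfolding U_def A_def adjoin_def by blast
      have "w \<in> G s" using h(2) G_mono[of m s] by (auto simp: s_def)
      then have "f * w - q * (x * g - y * f) \<in> G s"
        by (rule GD(6)[OF GD(4)[OF fg(1)] GD(4)[OF h(4) syz]])
      moreover have "f * u - x * (f * p + g * q) = f * w - q * (x * g - y * f)"
        unfolding h(1) by (simp add: algebra_simps)
      moreover have "f * p + g * q \<in> G (Suc s)"
        using gen_in_G[of "Suc s"] s h unfolding f_def g_def by (intro is_idealD(3)[OF is_ideal_G]) auto
      ultimately show "\<exists>u'\<in>G (Suc s). f * u - x * u' \<in> G s" by metis
    next
      fix u' assume "u' \<in> G (Suc s)"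
      then obtain w p q where h: "u' = w + f * p + g * q" "w \<in> G s" "p \<in> S" "q \<in> S"
        using G_Suc[of s u'] s(5) by (auto simp: f_def g_def)
      have "- (x * w) - q * (x * g - y * f) \<in> G s"
        by (rule GD(6)[OF GD(5)[OF GD(4)[OF xy(1) h(2)]] GD(4)[OF h(4) syz]])
      moreover have "f * (0 + x * p + y * q) - x * u' = - (x * w) - q * (x * g - y * f)"
        unfolding h(1) by (simp add: algebra_simps)
      moreover have "0 + x * p + y * q \<in> U"
        using h is_idealD(2)[OF is_ideal_G] by (intro in_U)
      ultimately show "\<exists>u\<in>U. f * u - x * u' \<in> G s" by metis
    next
      fix u u' assume u: "u \<in> U" "u' \<in> G (Suc s)" "f * u - x * u' \<in> G s"
      have c: "u \<in> S" "u' \<in> S" using u US GD(1) is_idealD(1)[OF is_ideal_G] by blast+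
      show "u \<in> G s \<longleftrightarrow> u' \<in> G s"
      proof
        assume "u \<in> G s"
        then have "f * u - (f * u - x * u') \<in> G s" using GD(4)[OF fg(1)] GD(6) u(3) by blast
        then show "u' \<in> G s" using G_cancel[OF s(2) xy(1) notin(3) c(2)] by simp
      next
        assume "u' \<in> G s"
        then have "(f * u - x * u') + x * u' \<in> G s" using GD(4)[OF xy(1)] GD(3) u(3) by blast
        then show "u \<in> G s" using G_cancel[OF s(2) fg(1,3) c(1)] by simp
      qed
    qed
    moreover have "ideal_pd_le (Suc (Suc m)) S (G s)" using pdG by (rule ideal_pd_le_mono) simp
    moreover have "G (Suc s) \<subseteq> S" using is_idealD(1)[OF is_ideal_G] by blast
    ultimately have "ideal_pd_le (Suc (Suc m)) S (G (Suc s))"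
      by (intro ideal_pd_le_quotient[OF is_ideal_G is_ideal_G is_ideal_S GS])
    then show ?thesis using s 3 by simp
  qed
qed

end

section \<open>Ladders as arrays\<close>

context ladder_sequence
begin

lemma v_parity: "1 \<le> k \<Longrightarrow> even (v k) \<longleftrightarrow> odd k"
proof (induction k rule: less_induct)
  case (less k)
  then obtain j where k: "k = Suc j" by (cases k) auto
  show ?case
  proof (cases "j = 0")
    case True
    then show ?thesis using k v1 by simp
  next
    case False
    have "even (v (j - 1)) \<longleftrightarrow> odd (j - 1)" if "2 \<le> j" using that k by (intro less.IH) auto
    then show ?thesis using step[of j] False k by auto
  qed
qed

text \<open>Even vertices are columns and odd vertices are rows, both numbered from \<open>1\<close>. Exactly one end of every edge
is even.\<close>

definition cell :: "nat \<Rightarrow> nat \<times> nat"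
  where "cell e = (if odd (end1 e) then (end1 e div 2 + 1, end2 e div 2 + 1)
    else (end2 e div 2 + 1, end1 e div 2 + 1))"

lemma end_parity: "e \<noteq> 1 \<Longrightarrow> even (end1 e) \<longleftrightarrow> odd (end2 e)"
proof (cases "even e")
  case False
  assume "e \<noteq> 1"
  from False obtain k where k: "e = 2 * k + 1" by (rule oddE)
  with \<open>e \<noteq> 1\<close> show ?thesis using v_parity[of k] by (simp add: end1_def end2_def)
qed (simp add: end1_def end2_def)

lemma cell_eq_iff:
  assumes "e \<noteq> 1" "odd x" "even y"
  shows "cell e = (x div 2 + 1, y div 2 + 1) \<longleftrightarrow> (end1 e = x \<and> end2 e = y) \<or> (end1 e = y \<and> end2 e = x)"
proof -
  have o: "a = b" if "odd a" "odd b" "a div 2 = b div 2" for a b :: nat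
    using that by presburger
  have e: "a = b" if "even a" "even b" "a div 2 = b div 2" for a b :: nat
    using that by presburger
  show ?thesis
  proof (cases "odd (end1 e)")
    case True
    then have "even (end2 e)" using end_parity[OF assms(1)] by simp
    then show ?thesis using True assms o[of "end1 e" x] e[of "end2 e" y] by (auto simp: cell_def)
  next
    case False
    then have "odd (end2 e)" using end_parity[OF assms(1)] by simp
    then show ?thesis using False assms o[of "end2 e" x] e[of "end1 e" y] by (auto simp: cell_def)
  qed
qed

lemma end2_le: "e \<in> ladder_edges n \<Longrightarrow> end1 e \<le> n + 2 \<and> end2 e \<le> n + 3"
proof (cases "even e")
  case True
  assume "e \<in> ladder_edges n"
  with True show ?thesis by (auto simp: ladder_edges_def end1_def end2_def)
next
  case False
  assume e: "e \<in> ladder_edges n"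
  from False obtain k where k: "e = 2 * k + 1" by (rule oddE)
  then have "v k < k" "k \<le> n + 1" using e v_less[of k] by (auto simp: ladder_edges_def)
  then show ?thesis by (simp add: k end1_def end2_def)
qed

text \<open>The vertex \<open>n + 1\<close> is the row above, or the column to the left of, the one that is added when passing to
the ladder with parameter \<open>n\<close>. Its three edges are the entries among which a bit chooses.\<close>

lemma neighbours:
  assumes "2 \<le> n"
  shows "(\<exists>e\<in>ladder_edges (n - 1). (end1 e = n + 1 \<and> end2 e = y) \<or> (end1 e = y \<and> end2 e = n + 1)) \<longleftrightarrow>
    y = v (n - 1) \<or> y = n \<or> y = n + 2"
proof
  assume "\<exists>e\<in>ladder_edges (n - 1). (end1 e = n + 1 \<and> end2 e = y) \<or> (end1 e = y \<and> end2 e = n + 1)"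
  then obtain e where e: "e \<in> ladder_edges (n - 1)" "(end1 e = n + 1 \<and> end2 e = y) \<or> (end1 e = y \<and> end2 e = n + 1)"
    by blast
  show "y = v (n - 1) \<or> y = n \<or> y = n + 2"
  proof (cases "even e")
    case True
    then show ?thesis using e(2) by (auto simp: end1_def end2_def)
  next
    case False
    then obtain k where k: "e = 2 * k + 1" by (rule oddE)
    then have "v k < k" "k \<le> n" using e(1) assms v_less[of k] by (auto simp: ladder_edges_def)
    moreover have ends: "end1 e = v k" "end2 e = k + 2" by (simp_all add: k end1_def end2_def)
    ultimately have "y = v k \<and> k = n - 1" using e(2) by auto
    then show ?thesis by simp
  qed
next
  have "2 * (n - 1) + 1 \<in> ladder_edges (n - 1)" "2 * n \<in> ladder_edges (n - 1)" "2 * (n + 1) \<in> ladder_edges (n - 1)"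
    using assms by (auto simp: ladder_edges_def)
  moreover have "end1 (2 * (n - 1) + 1) = v (n - 1)" "end2 (2 * (n - 1) + 1) = n + 1"
    "end1 (2 * n) = n" "end2 (2 * n) = n + 1" "end1 (2 * (n + 1)) = n + 1" "end2 (2 * (n + 1)) = n + 2"
    using assms by (simp_all add: end1_def end2_def)
  ultimately show "y = v (n - 1) \<or> y = n \<or> y = n + 2 \<Longrightarrow>
    \<exists>e\<in>ladder_edges (n - 1). (end1 e = n + 1 \<and> end2 e = y) \<or> (end1 e = y \<and> end2 e = n + 1)"
    by metis
qed

lemma cell_new:
  "cell (2 * n + 4) = (if even n then (n div 2 + 2, n div 2 + 2) else (n div 2 + 2, n div 2 + 3))"
  "cell (2 * n + 3) = (if even n then (n div 2 + 2, v (n + 1) div 2 + 1) else (v (n + 1) div 2 + 1, n div 2 + 3))"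
proof -
  have e4: "end1 (2 * n + 4) = n + 2" "end2 (2 * n + 4) = n + 3"
    by (simp_all add: end1_def end2_def)
  have "(2 * n + 3) div 2 = n + 1" by presburger
  then have e3: "end1 (2 * n + 3) = v (n + 1)" "end2 (2 * n + 3) = n + 3"
    by (simp_all add: end1_def end2_def)
  have "(n + 3) div 2 = n div 2 + 1 \<and> (n + 2) div 2 = n div 2 + 1" if "even n" using that by presburger
  moreover have "(n + 3) div 2 = n div 2 + 2 \<and> (n + 2) div 2 = n div 2 + 1" if "odd n" using that by presburger
  ultimately show "cell (2 * n + 4) = (if even n then (n div 2 + 2, n div 2 + 2) else (n div 2 + 2, n div 2 + 3))"
    "cell (2 * n + 3) = (if even n then (n div 2 + 2, v (n + 1) div 2 + 1) else (v (n + 1) div 2 + 1, n div 2 + 3))"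
    using v_parity[of "n + 1"] by (auto simp: cell_def e4 e3)
qed

definition is_ladder_array :: "nat \<Rightarrow> array \<Rightarrow> bool"
  where "is_ladder_array n A \<longleftrightarrow> (\<forall>pos e. A pos = Some e \<longleftrightarrow> e \<in> ladder_edges n \<and> pos = cell e)"

lemma is_ladder_arrayD: "is_ladder_array n A \<Longrightarrow> A pos = Some e \<longleftrightarrow> e \<in> ladder_edges n \<and> pos = cell e"
  unfolding is_ladder_array_def by blast

lemma is_ladder_array_nonempty: "is_ladder_array n A \<Longrightarrow> A pos \<noteq> None \<longleftrightarrow> (\<exists>e\<in>ladder_edges n. cell e = pos)"
  unfolding not_None_eq is_ladder_arrayD by blast

lemma cell_inj:
  assumes "e \<noteq> 1" "e' \<noteq> 1" "cell e = cell e'"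
  shows "(end1 e = end1 e' \<and> end2 e = end2 e') \<or> (end1 e = end2 e' \<and> end2 e = end1 e')"
proof (cases "odd (end1 e')")
  case True
  then have "cell e = (end1 e' div 2 + 1, end2 e' div 2 + 1)" using assms(3) by (simp add: cell_def)
  then show ?thesis using cell_eq_iff[OF assms(1) True] end_parity[OF assms(2)] True by blast
next
  case False
  then have o: "odd (end2 e')" using end_parity[OF assms(2)] by blast
  have "cell e = (end2 e' div 2 + 1, end1 e' div 2 + 1)" using assms(3) False by (simp add: cell_def)
  then show ?thesis using cell_eq_iff[OF assms(1) o] False by blast
qed

lemma cell_new_fresh:
  shows "e \<in> ladder_edges n \<Longrightarrow> cell e \<noteq> cell (2 * n + 5)"
    "e \<in> ladder_edges n \<Longrightarrow> cell e \<noteq> cell (2 * n + 6)" "cell (2 * n + 5) \<noteq> cell (2 * n + 6)"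
proof -
  have "(2 * n + 5) div 2 = n + 2" by presburger
  then have ends: "end2 (2 * n + 5) = n + 4" "end2 (2 * n + 6) = n + 4" "end1 (2 * n + 6) = n + 3"
    "end1 (2 * n + 5) = v (n + 2)" by (simp_all add: end1_def end2_def)
  have not1: "e \<noteq> 1" if "e \<in> ladder_edges n" for e using that by (auto simp: ladder_edges_def)
  show "cell e \<noteq> cell (2 * n + 5)" if "e \<in> ladder_edges n"
    using cell_inj[OF not1[OF that], of "2 * n + 5"] end2_le[OF that] ends by auto
  show "cell e \<noteq> cell (2 * n + 6)" if "e \<in> ladder_edges n"
    using cell_inj[OF not1[OF that], of "2 * n + 6"] end2_le[OF that] ends by auto
  show "cell (2 * n + 5) \<noteq> cell (2 * n + 6)"
    using cell_inj[of "2 * n + 5" "2 * n + 6"] v_less[of "n + 2"] ends by auto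
qed

lemma is_ladder_array_step:
  assumes "is_ladder_array n A"
  shows "is_ladder_array (Suc n) (A(cell (2 * n + 5) \<mapsto> 2 * n + 5, cell (2 * n + 6) \<mapsto> 2 * n + 6))"
  unfolding is_ladder_array_def
proof (intro allI)
  fix pos e
  have "ladder_edges (Suc n) = ladder_edges n \<union> {2 * n + 5, 2 * n + 6}"
    by (auto simp: ladder_edges_def)
  moreover have "A pos = Some e \<longleftrightarrow> e \<in> ladder_edges n \<and> pos = cell e"
    using assms by (rule is_ladder_arrayD)
  moreover have "2 * n + 5 \<notin> ladder_edges n" "2 * n + 6 \<notin> ladder_edges n"
    by (auto simp: ladder_edges_def)
  ultimately show "(A(cell (2 * n + 5) \<mapsto> 2 * n + 5, cell (2 * n + 6) \<mapsto> 2 * n + 6)) pos = Some e \<longleftrightarrow>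
      e \<in> ladder_edges (Suc n) \<and> pos = cell e"
    using cell_new_fresh(1,2)[of e n] cell_new_fresh(3)[of n] by (auto simp: fun_upd_def)
qed

text \<open>Only the first two entries of the list can be picked; they correspond to the vertices \<open>v (n - 1)\<close> and
\<open>n\<close>, in this order, because \<open>v (n - 1) < n\<close>.\<close>

lemma filter_three:
  fixes P :: "nat \<Rightarrow> bool"
  assumes "\<And>j. 1 \<le> j \<Longrightarrow> j \<le> c \<Longrightarrow> P j \<longleftrightarrow> j = x \<or> j = y \<or> j = w" "1 \<le> x" "x < y" "y < w" "w \<le> c"
  shows "filter P [1..<c + 1] = [x, y, w]"
proof (rule sorted_distinct_set_unique)
  show "set (filter P [1..<c + 1]) = set [x, y, w]" using assms by auto
  show "sorted (filter P [1..<c + 1])" by (rule sorted_wrt_filter[OF sorted_upt])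
qed (use assms in auto)

lemma v_small: "v 2 = 1"
  using step[of 1] by (simp add: numeral_2_eq_2)

lemma cell_small: "cell 0 = (1, 1)" "cell 2 = (1, 2)" "cell 3 = (2, 1)" "cell 4 = (2, 2)" "cell 5 = (1, 3)" "cell 6 = (2, 3)"
  using v1 v_small by (simp_all add: cell_def end1_def end2_def)

lemma is_ladder_array_ladder_0: "is_ladder_array 0 (ladder 0 t)"
proof -
  have "ladder_edges 0 = {0, 2, 3, 4}" by (auto simp: ladder_edges_def)
  then show ?thesis unfolding is_ladder_array_def by (auto simp: cell_small)
qed

lemma is_ladder_array_ladder_1: "is_ladder_array 1 (ladder 1 t)"
proof -
  have "ladder 1 t = (ladder 0 t)(cell 5 \<mapsto> 5, cell 6 \<mapsto> 6)"
    by (rule ext) (simp add: cell_small fun_upd_def)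
  then show ?thesis using is_ladder_array_step[OF is_ladder_array_ladder_0] by simp
qed

lemma pick_three: "pick b [x, y, w] = (if b = 0 then x else y)"
  by (simp add: pick_def)

lemma last_row:
  assumes "is_ladder_array (n - 1) A" "2 \<le> n" "even n"
  shows "filter (\<lambda>j. A (n div 2 + 1, j) \<noteq> None) [1..<n div 2 + 2 + 1] =
    [v (n - 1) div 2 + 1, n div 2 + 1, n div 2 + 2]"
proof (rule filter_three)
  have ev: "even (v (n - 1))" using v_parity[of "n - 1"] assms by simp
  then have "v (n - 1) \<le> n - 2" using v_less[of "n - 1"] assms by presburger
  then show "v (n - 1) div 2 + 1 < n div 2 + 1" using assms ev by presburger
  fix j :: nat assume j: "1 \<le> j"
  have half: "2 * (j - 1) = x \<longleftrightarrow> j = x div 2 + 1" if "1 \<le> j" "even x" for j x :: nat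
    using that by presburger
  have pos: "(n div 2 + 1, j) = ((n + 1) div 2 + 1, (2 * (j - 1)) div 2 + 1)" using j assms(3) by auto
  have "A (n div 2 + 1, j) \<noteq> None \<longleftrightarrow> (\<exists>e\<in>ladder_edges (n - 1). cell e = (n div 2 + 1, j))"
    by (rule is_ladder_array_nonempty[OF assms(1)])
  also have "\<dots> \<longleftrightarrow> (\<exists>e\<in>ladder_edges (n - 1). (end1 e = n + 1 \<and> end2 e = 2 * (j - 1)) \<or> (end1 e = 2 * (j - 1) \<and> end2 e = n + 1))"
    unfolding pos using assms(3) by (intro bex_cong refl cell_eq_iff) (auto simp: ladder_edges_def)
  also have "\<dots> \<longleftrightarrow> 2 * (j - 1) = v (n - 1) \<or> 2 * (j - 1) = n \<or> 2 * (j - 1) = n + 2"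
    by (rule neighbours[OF assms(2)])
  also have "\<dots> \<longleftrightarrow> j = v (n - 1) div 2 + 1 \<or> j = n div 2 + 1 \<or> j = n div 2 + 2"
    using half[OF j, of "v (n - 1)"] half[OF j, of n] half[OF j, of "n + 2"] ev assms(3) by simp
  finally show "A (n div 2 + 1, j) \<noteq> None \<longleftrightarrow> j = v (n - 1) div 2 + 1 \<or> j = n div 2 + 1 \<or> j = n div 2 + 2" .
qed auto

lemma last_column:
  assumes "is_ladder_array (n - 1) A" "2 \<le> n" "odd n"
  shows "filter (\<lambda>i. A (i, n div 2 + 2) \<noteq> None) [1..<n div 2 + 2 + 1] =
    [v (n - 1) div 2 + 1, n div 2 + 1, n div 2 + 2]"
proof (rule filter_three)
  have od: "odd (v (n - 1))" using v_parity[of "n - 1"] assms by simp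
  then have "v (n - 1) \<le> n - 2" using v_less[of "n - 1"] assms by presburger
  then show "v (n - 1) div 2 + 1 < n div 2 + 1" using assms od by presburger
  fix i :: nat assume i: "1 \<le> i"
  have half: "2 * (i - 1) + 1 = x \<longleftrightarrow> i = x div 2 + 1" if "1 \<le> i" "odd x" for i x :: nat
    using that by presburger
  have "(n + 1) div 2 + 1 = n div 2 + 2" using assms(3) by presburger
  then have pos: "(i, n div 2 + 2) = ((2 * (i - 1) + 1) div 2 + 1, (n + 1) div 2 + 1)" using i by auto
  have "A (i, n div 2 + 2) \<noteq> None \<longleftrightarrow> (\<exists>e\<in>ladder_edges (n - 1). cell e = (i, n div 2 + 2))"
    by (rule is_ladder_array_nonempty[OF assms(1)])
  also have "\<dots> \<longleftrightarrow> (\<exists>e\<in>ladder_edges (n - 1). (end1 e = n + 1 \<and> end2 e = 2 * (i - 1) + 1) \<or> (end1 e = 2 * (i - 1) + 1 \<and> end2 e = n + 1))"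
    unfolding pos using assms(3) by (intro bex_cong refl, subst cell_eq_iff) (auto simp: ladder_edges_def)
  also have "\<dots> \<longleftrightarrow> 2 * (i - 1) + 1 = v (n - 1) \<or> 2 * (i - 1) + 1 = n \<or> 2 * (i - 1) + 1 = n + 2"
    by (rule neighbours[OF assms(2)])
  also have "\<dots> \<longleftrightarrow> i = v (n - 1) div 2 + 1 \<or> i = n div 2 + 1 \<or> i = n div 2 + 2"
    using half[OF i, of "v (n - 1)"] half[OF i, of n] half[OF i, of "n + 2"] od assms(3) by simp
  finally show "A (i, n div 2 + 2) \<noteq> None \<longleftrightarrow> i = v (n - 1) div 2 + 1 \<or> i = n div 2 + 1 \<or> i = n div 2 + 2" .
qed auto

text \<open>The array is truncated together with the bit string, so the induction runs over prefixes of one fixed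
string.\<close>

theorem is_ladder_array_ladder:
  assumes bits: "\<And>n. 2 \<le> n \<Longrightarrow> n < length t \<Longrightarrow> v (n + 1) = (if t ! n = 0 then v (n - 1) else n)"
    and "n < length t"
  shows "is_ladder_array n (ladder n (take (Suc n) t))"
  using assms(2)
proof (induction n rule: less_induct)
  case (less n)
  consider "n = 0" | "n = 1" | m where "n = Suc (Suc m)" by (metis One_nat_def not0_implies_Suc)
  then show ?case
  proof cases
    case 1
    show ?thesis unfolding 1 by (rule is_ladder_array_ladder_0)
  next
    case 2
    show ?thesis unfolding 2 by (rule is_ladder_array_ladder_1)
  next
    case (3 m)
    define A where "A = ladder (Suc m) (take n t)"
    have A: "is_ladder_array (n - 1) A" using less.IH[of "Suc m"] less.prems 3 by (simp add: A_def)
    have tk: "butlast (take (Suc n) t) = take n t" "last (take (Suc n) t) = t ! n"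
      using less.prems by (simp_all add: take_Suc_conv_app_nth)
    have n2: "2 \<le> n" "m + 2 = n" using 3 by simp_all
    have v: "v (n + 1) = (if t ! n = 0 then v (n - 1) else n)" using bits[OF n2(1) less.prems] .
    have nums: "2 * (n - 1) + 5 = 2 * n + 3" "2 * (n - 1) + 6 = 2 * n + 4" "Suc (n - 1) = n" using n2 by simp_all
    note next_array = is_ladder_array_step[OF A, unfolded nums]
    have lad: "ladder n (take (Suc n) t) =
      (if even n then
         (let j = pick (t ! n) (filter (\<lambda>j. A (ladder_rows n - 1, j) \<noteq> None) [1..<ladder_cols n + 1])
          in A((ladder_rows n, j) \<mapsto> 2 * n + 3, (ladder_rows n, ladder_cols n) \<mapsto> 2 * n + 4))
       else
         (let i = pick (t ! n) (filter (\<lambda>i. A (i, ladder_cols n - 1) \<noteq> None) [1..<ladder_rows n + 1])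
          in A((i, ladder_cols n) \<mapsto> 2 * n + 3, (ladder_rows n, ladder_cols n) \<mapsto> 2 * n + 4)))"
      unfolding 3 ladder.simps Let_def n2(2)[unfolded 3] unfolding 3[symmetric] tk A_def[symmetric] by (rule refl)
    show ?thesis
    proof (cases "even n")
      case True
      have rc: "ladder_rows n = n div 2 + 2" "n div 2 + 2 - 1 = n div 2 + 1" "ladder_cols n = n div 2 + 2"
        using True by (auto simp: ladder_rows_def ladder_cols_def)
      have "ladder n (take (Suc n) t) = A(cell (2 * n + 3) \<mapsto> 2 * n + 3, cell (2 * n + 4) \<mapsto> 2 * n + 4)"
        unfolding lad if_P[OF True] Let_def rc last_row[OF A n2(1) True] pick_three cell_new
        using True v by simp
      then show ?thesis using next_array by (simp only:)
    next
      case False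
      have rc: "ladder_rows n = n div 2 + 2" "ladder_cols n = n div 2 + 3" "n div 2 + 3 - 1 = n div 2 + 2"
        using False by (auto simp: ladder_rows_def ladder_cols_def elim!: oddE)
      have "ladder n (take (Suc n) t) = A(cell (2 * n + 3) \<mapsto> 2 * n + 3, cell (2 * n + 4) \<mapsto> 2 * n + 4)"
        unfolding lad if_not_P[OF False] Let_def rc last_column[OF A n2(1) False] pick_three cell_new
        using False v by simp
      then show ?thesis using next_array by (simp only:)
    qed
  qed
qed

section \<open>The toric ideal of a ladder\<close>

definition vertex_of :: "nat \<Rightarrow> vertex"
  where "vertex_of x = (if odd x then Row (x div 2 + 1) else Col (x div 2 + 1))"

lemma vertex_of_inj: "vertex_of x = vertex_of y \<longleftrightarrow> x = y"
proof -
  have "x = y" if "odd x = odd y" "x div 2 = y div 2" using that by presburger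
  then show ?thesis by (auto simp: vertex_of_def)
qed

lemma ladder_ends_eq:
  assumes "is_ladder_array n (ladder n t)" "e \<in> ladder_edges n"
  shows "ladder_ends n t e = {vertex_of (end1 e), vertex_of (end2 e)}"
proof -
  have "e \<noteq> 1" using assms(2) by (auto simp: ladder_edges_def)
  then have par: "even (end1 e) \<longleftrightarrow> odd (end2 e)" by (rule end_parity)
  have "{p. ladder n t p = Some e} = {cell e}" using assms by (auto simp: is_ladder_array_def)
  then have "ladder_ends n t e = {Row (fst (cell e)), Col (snd (cell e))}"
    unfolding ladder_ends_def by (auto simp: case_prod_beta)
  then show ?thesis using par by (auto simp: cell_def vertex_of_def)
qed

end

lemma mpoly_subst_cong:
  assumes "\<And>m e. m \<in> keys p \<Longrightarrow> e \<in> keys m \<Longrightarrow> f e = g e"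
  shows "mpoly_subst f p = mpoly_subst g p"
  unfolding mpoly_subst_def using assms by (intro sum.cong prod.cong arg_cong2[where f = "(*)"] refl) auto

context ladder_algebra
begin

lemma edges_eq: "K = n + 1 \<Longrightarrow> edges = ladder_edges n"
proof -
  assume "K = n + 1"
  then have "2 * K + 2 = 2 * n + 4" by simp
  then show ?thesis unfolding edges_def ladder_edges_def by (simp only:)
qed

text \<open>At the last stage all edges have their true ends, and relabelling the vertices is injective.\<close>

lemma stage_weight_from_vertices:
  assumes "keys m \<subseteq> edges" "keys m' \<subseteq> edges"
    and eq: "weight (edge_weight vertex_of) m = weight (edge_weight vertex_of) m'"
  shows "weight (stage_weight K) m = weight (stage_weight K) m'"
proof (rule poly_mapping_eqI)
  fix i
  have st: "stage_weight K e = edge_weight (\<lambda>x. 2 * x) e" if "e \<in> edges" for e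
    using that by (intro stage_weight_edge) (auto simp: edges_def)
  have edges: "finite edges" by (simp add: edges_def)
  show "lookup (weight (stage_weight K) m) i = lookup (weight (stage_weight K) m') i"
  proof (cases "even i")
    case True
    then obtain x where i: "i = 2 * x" by (rule evenE)
    have "lookup (stage_weight K e) i = lookup (edge_weight vertex_of e) (vertex_of x)"
      if "e \<in> edges" for e
      by (simp add: st[OF that] i edge_weight_def lookup_add lookup_single when_def vertex_of_inj)
    then have "lookup (weight (stage_weight K) q) i = lookup (weight (edge_weight vertex_of) q) (vertex_of x)"
      if "keys q \<subseteq> edges" for q
      unfolding lookup_weight[OF edges that] by (intro sum.cong) auto
    then show ?thesis using assms by simp
  next
    case False
    then have ne: "2 * x \<noteq> i" for x by presburger
    have "lookup (stage_weight K e) i = 0" if "e \<in> edges" for e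
      by (simp add: st[OF that] edge_weight_def lookup_add lookup_single when_def ne)
    then have "lookup (weight (stage_weight K) q) i = 0" if "keys q \<subseteq> edges" for q
      unfolding lookup_weight[OF edges that] by (intro sum.neutral) auto
    then show ?thesis using assms by simp
  qed
qed

theorem toric_ideal_eq_G:
  assumes K: "K = n + 1" and A: "is_ladder_array n (ladder n t)"
  shows "ladder_toric_ideal n t = G K"
proof -
  define \<tau> where "\<tau> = mpoly_subst (\<lambda>e. single (edge_weight vertex_of e) (1::'k))"
  have prod: "(\<Prod>u\<in>ladder_ends n t e. mpoly_var u) = single (edge_weight vertex_of e) (1::'k)"
    if "e \<in> edges" for e
  proof -
    have e: "e \<in> ladder_edges n" using that edges_eq[OF K] by simp
    then have "e \<noteq> 1" by (auto simp: ladder_edges_def)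
    then have "end1 e \<noteq> end2 e" using end_parity[of e] by auto
    then show ?thesis
      unfolding ladder_ends_eq[OF A e] by (simp add: vertex_of_inj mpoly_var_mult edge_weight_def)
  qed
  have \<tau>: "mpoly_subst (\<lambda>e. \<Prod>u\<in>ladder_ends n t e. mpoly_var u) p = \<tau> p" if "p \<in> S" for p
    unfolding \<tau>_def using that prod by (intro mpoly_subst_cong) (auto simp: mpoly_carrier_iff)
  have ker: "ladder_toric_ideal n t = {p \<in> S. \<tau> p = 0}"
    unfolding ladder_toric_ideal_def toric_ideal_def a_kernel_def' edges_eq[OF K, symmetric]
    using \<tau> by auto
  have gen: "\<tau> (minor_f j) = 0" "\<tau> (minor_g j) = 0" if "1 \<le> j" for j
    using edge_weight_f[OF that, of vertex_of] edge_weight_g[of j vertex_of]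
    by (simp_all add: \<tau>_def minor_f_def minor_g_def mpoly_subst_diff mpoly_subst_mult mult_single)
  have "\<tau> w = 0" if "w \<in> G j" "j \<le> K" for w j
    using that
  proof (induction j arbitrary: w)
    case 0
    then show ?case by (simp add: G_0 \<tau>_def)
  next
    case (Suc j)
    then obtain u p q where w: "w = u + minor_f (Suc j) * p + minor_g (Suc j) * q" "u \<in> G j"
      using G_Suc[of j w] by auto
    have "\<tau> u = 0" using Suc w by simp
    then show ?case using gen[of "Suc j"]
      unfolding w(1) by (simp add: \<tau>_def mpoly_subst_add mpoly_subst_mult)
  qed
  moreover have "p \<in> G K" if "p \<in> S" "\<tau> p = 0" for p
  proof (rule binomial_kernel_in_G[OF order_refl that(1)])
    show "(\<Sum>m\<in>keys p. single (weight (edge_weight vertex_of) m) (lookup p m)) = 0"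
      using that(2) by (simp add: \<tau>_def mpoly_subst_weight)
  qed (rule stage_weight_from_vertices)
  ultimately show ?thesis unfolding ker using G_closed(1) by blast
qed

end

text \<open>The data of a \<open>ladder_sequence\<close> for a string of bits. The bit with list index \<open>k\<close> belongs to stage
\<open>k + 1\<close>.\<close>

fun ladder_v :: "bit list \<Rightarrow> nat \<Rightarrow> nat" where
  "ladder_v t 0 = 0"
| "ladder_v t (Suc 0) = 0"
| "ladder_v t (Suc (Suc 0)) = 1"
| "ladder_v t (Suc (Suc (Suc j))) = (if t ! (j + 2) = 0 then ladder_v t (Suc j) else j + 2)"

fun ladder_a :: "bit list \<Rightarrow> nat \<Rightarrow> nat" where
  "ladder_a t 0 = 0"
| "ladder_a t (Suc 0) = 0"
| "ladder_a t (Suc (Suc 0)) = 2"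
| "ladder_a t (Suc (Suc (Suc j))) = (if t ! (j + 2) = 0 then 2 * (j + 2) - 1 else 2 * (j + 2))"

fun ladder_z :: "bit list \<Rightarrow> nat \<Rightarrow> nat" where
  "ladder_z t (Suc (Suc (Suc j))) = (if t ! (j + 2) = 0 then ladder_z t (Suc (Suc j)) else ladder_a t (Suc (Suc j)))"
| "ladder_z t _ = 0"

lemma ladder_sequence_of_bits: "ladder_sequence (ladder_a t) (ladder_z t) (ladder_v t)"
proof
  fix k :: nat assume "1 \<le> k"
  then consider "k = 1" | j where "k = Suc (Suc j)" by (metis One_nat_def not0_implies_Suc not_one_le_zero)
  then show "(ladder_a t (Suc k) = 2 * k \<and> ladder_z t (Suc k) = ladder_a t k \<and> ladder_v t (Suc k) = k) \<or>
      (2 \<le> k \<and> ladder_a t (Suc k) = 2 * k - 1 \<and> ladder_z t (Suc k) = ladder_z t k \<and> ladder_v t (Suc k) = ladder_v t (k - 1))"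
    by cases auto
qed auto

lemma ladder_v_bits: "2 \<le> n \<Longrightarrow> ladder_v t (n + 1) = (if t ! n = 0 then ladder_v t (n - 1) else n)"
proof -
  assume "2 \<le> n"
  then obtain j where "n = j + 2" by (metis add.commute le_Suc_ex)
  then show ?thesis by simp
qed

section \<open>From presentations to resolutions by modules\<close>

text \<open>The definition of projectivity asks for a basis in the type of elements of the module; the unit vectors
themselves are used.\<close>

lemma (in cring) projective_free_module:
  fixes J :: "'i set"
  assumes "\<one> \<noteq> \<zero>"
  shows "projective_module R (free_module R J)"
proof -
  define \<delta> where "\<delta> j = (\<lambda>i::'i. if i = j then \<one> else \<zero>)" for j
  have inj: "inj_on \<delta> J"
  proof (rule inj_onI)
    fix i j assume "\<delta> i = \<delta> j"
    then have "\<delta> i i = \<delta> j i" by simp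
    then show "i = j" using assms by (auto simp: \<delta>_def split: if_splits)
  qed
  define F where "F = free_module R J"
  define F' where "F' = free_module R (\<delta> ` J)"
  define \<phi> where "\<phi> f g = (if g \<in> \<delta> ` J then f (inv_into J \<delta> g) else \<zero>)" for f :: "'i \<Rightarrow> 'a" and g
  have \<phi>\<delta>: "\<phi> f (\<delta> j) = f j" if "j \<in> J" for f j
    using that inv_into_f_f[OF inj that] by (simp add: \<phi>_def)
  have \<phi>F: "\<phi> f \<in> carrier F'" if f: "f \<in> carrier F" for f
    unfolding F'_def free_module_carrier_iff
  proof (intro conjI allI impI)
    have "{g. \<phi> f g \<noteq> \<zero>} \<subseteq> \<delta> ` {j. f j \<noteq> \<zero>}"
    proof
      fix g assume "g \<in> {g. \<phi> f g \<noteq> \<zero>}"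
      then have g: "\<phi> f g \<noteq> \<zero>" by simp
      then obtain j where j: "j \<in> J" "g = \<delta> j" by (auto simp: \<phi>_def split: if_splits)
      then show "g \<in> \<delta> ` {j. f j \<noteq> \<zero>}" using g \<phi>\<delta>[OF j(1)] by simp
    qed
    moreover have "finite {j. f j \<noteq> \<zero>}" using f by (simp add: F_def free_module_carrier_iff)
    ultimately show "finite {g. \<phi> f g \<noteq> \<zero>}" using finite_surj by blast
  qed (use f in \<open>auto simp: \<phi>_def F_def free_module_carrier_iff\<close>)
  have hom: "\<phi> \<in> module_hom R F F'"
    by (intro module_homI \<phi>F) (auto simp: F_def F'_def free_module_simps \<phi>_def fun_eq_iff)
  have injF: "inj_on \<phi> (carrier F)"
  proof (rule inj_onI)
    fix f g assume fg: "f \<in> carrier F" "g \<in> carrier F" "\<phi> f = \<phi> g"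
    show "f = g"
    proof
      fix j
      show "f j = g j"
      proof (cases "j \<in> J")
        case True
        then show ?thesis using \<phi>\<delta>[OF True, of f] \<phi>\<delta>[OF True, of g] fg(3) by simp
      qed (use fg in \<open>simp add: F_def free_module_carrier_iff\<close>)
    qed
  qed
  interpret F': Module.module R F' unfolding F'_def by (rule module_free_module)
  interpret F: Module.module R F unfolding F_def by (rule module_free_module)
  have sub: "submodule {\<zero>\<^bsub>F'\<^esub>} R F'"
    by (rule F'.submoduleI) auto
  have surj: "\<phi> ` carrier F = carrier F'"
  proof (intro equalityI subsetI)
    fix g assume g: "g \<in> carrier F'"
    define f where "f j = (if j \<in> J then g (\<delta> j) else \<zero>)" for j
    have "f \<in> carrier F"
      unfolding F_def free_module_carrier_iff
    proof (intro conjI allI impI)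
      have "{j. f j \<noteq> \<zero>} \<subseteq> J \<inter> \<delta> -` {x. g x \<noteq> \<zero>}" by (auto simp: f_def)
      moreover have "finite (\<delta> -` {x. g x \<noteq> \<zero>} \<inter> J)"
        using g inj by (intro finite_vimage_IntI) (simp_all add: F'_def free_module_carrier_iff)
      ultimately show "finite {j. f j \<noteq> \<zero>}" by (metis finite_subset inf_commute)
    qed (use g in \<open>auto simp: f_def F'_def free_module_carrier_iff\<close>)
    moreover have "\<phi> f = g"
    proof
      fix x
      show "\<phi> f x = g x"
      proof (cases "x \<in> \<delta> ` J")
        case True
        then obtain j where "j \<in> J" "x = \<delta> j" by blast
        then show ?thesis using \<phi>\<delta>[of j f] by (simp add: f_def)
      qed (use g in \<open>simp add: \<phi>_def F'_def free_module_carrier_iff\<close>)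
    qed
    ultimately show "g \<in> \<phi> ` carrier F" by blast
  qed (use \<phi>F in blast)
  have "\<phi> ` carrier F <+>\<^bsub>F'\<^esub> {\<zero>\<^bsub>F'\<^esub>} = carrier F'"
    unfolding surj set_add_def' by auto
  moreover have "\<phi> ` carrier F \<inter> {\<zero>\<^bsub>F'\<^esub>} = {\<zero>\<^bsub>F'\<^esub>}"
    unfolding surj by auto
  ultimately show ?thesis
    unfolding projective_module_def F_def[symmetric]
    using hom injF sub F.module_axioms F'_def by blast
qed

lemma coefficient_ring_mpoly: "coefficient_ring (carrier (mpoly_ring V :: (('v, 'k::field) mpoly) ring))"
  by unfold_locales (fact mpoly_carrier_closed)+

text \<open>The index sets of the resolution are subsets of \<open>'b \<times> nat\<close>; sequences are stored at a fixed element of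
\<open>'b\<close>.\<close>

definition to_fun :: "'b \<Rightarrow> (nat \<Rightarrow>\<^sub>0 'r::zero) \<Rightarrow> 'b \<times> nat \<Rightarrow> 'r"
  where "to_fun b c = (\<lambda>i. if fst i = b then lookup c (snd i) else 0)"

definition of_fun :: "'b \<Rightarrow> ('b \<times> nat \<Rightarrow> 'r::zero) \<Rightarrow> (nat \<Rightarrow>\<^sub>0 'r)"
  where "of_fun b f = Abs_poly_mapping (\<lambda>j. f (b, j))"

lemma of_to_fun: "of_fun b (to_fun b c) = c"
  by (rule poly_mapping_eqI) (simp add: of_fun_def to_fun_def)

locale mpoly_ideal =
  fixes V :: "'v set" and I :: "(('v, 'k::field) mpoly) set"
  assumes ideal: "ideal I (mpoly_ring V)"
begin

interpretation cring "mpoly_ring V :: (('v, 'k) mpoly) ring" by (rule cring_mpoly_ring)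
interpretation I: ideal I "mpoly_ring V" by (rule ideal)

interpretation coefficient_ring "carrier (mpoly_ring V :: (('v, 'k) mpoly) ring)"
  by (rule coefficient_ring_mpoly)

abbreviation "Rng \<equiv> mpoly_ring V :: (('v, 'k) mpoly) ring"
abbreviation "Quo \<equiv> quotient_module Rng I"

lemma quotient_module_simps:
  "carrier Quo = a_rcosets\<^bsub>Rng\<^esub> I" "\<zero>\<^bsub>Quo\<^esub> = I"
  "X \<oplus>\<^bsub>Quo\<^esub> Y = X <+>\<^bsub>Rng\<^esub> Y"
  "r \<odot>\<^bsub>Quo\<^esub> X = [mod I:] (I +>\<^bsub>Rng\<^esub> r) \<Otimes>\<^bsub>Rng\<^esub> X"
  by (simp_all add: quotient_module_def FactRing_def ring.defs)

lemma coset_eq_I_iff: "p \<in> carrier Rng \<Longrightarrow> I +>\<^bsub>Rng\<^esub> p = I \<longleftrightarrow> p \<in> I"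
  using I.a_rcos_const I.a_rcos_self by auto

lemma quotient_carrier: "carrier Quo = (\<lambda>p. I +>\<^bsub>Rng\<^esub> p) ` carrier Rng"
  by (auto simp: quotient_module_simps A_RCOSETS_def')

lemma quotient_add: "p \<in> carrier Rng \<Longrightarrow> q \<in> carrier Rng \<Longrightarrow>
    (I +>\<^bsub>Rng\<^esub> p) \<oplus>\<^bsub>Quo\<^esub> (I +>\<^bsub>Rng\<^esub> q) = I +>\<^bsub>Rng\<^esub> (p + q)"
  using I.a_rcos_sum[of p q] by (simp add: quotient_module_simps)

lemma quotient_smult: "p \<in> carrier Rng \<Longrightarrow> q \<in> carrier Rng \<Longrightarrow>
    p \<odot>\<^bsub>Quo\<^esub> (I +>\<^bsub>Rng\<^esub> q) = I +>\<^bsub>Rng\<^esub> (p * q)"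
  using I.rcoset_mult_add[of p q] by (simp add: quotient_module_simps)

abbreviation "Free b J \<equiv> free_module Rng ({b} \<times> J)"

lemma to_fun_carrier: "c \<in> free_on J \<Longrightarrow> to_fun b c \<in> carrier (Free b J)"
proof -
  assume c: "c \<in> free_on J"
  have "{i. to_fun b c i \<noteq> 0} \<subseteq> Pair b ` keys c"
    by (auto simp: to_fun_def in_keys_iff split: if_splits)
  then have "finite {i. to_fun b c i \<noteq> 0}" by (rule finite_subset) simp
  then show ?thesis using c
    by (auto simp: free_module_carrier_iff to_fun_def free_on_def)
qed

lemma lookup_of_fun:
  assumes "f \<in> carrier (Free b J)"
  shows "lookup (of_fun b f) j = f (b, j)"
proof -
  have "{j. f (b, j) \<noteq> 0} \<subseteq> Pair b -` {i. f i \<noteq> 0}" by auto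
  moreover have "finite (Pair b -` {i. f i \<noteq> 0})"
    using assms by (intro finite_vimageI) (auto simp: free_module_carrier_iff inj_on_def)
  ultimately have "finite {j. f (b, j) \<noteq> 0}" by (rule finite_subset)
  then show ?thesis by (simp add: of_fun_def)
qed

lemma of_fun_free_on: "f \<in> carrier (Free b J) \<Longrightarrow> of_fun b f \<in> free_on J"
  unfolding free_on_def by (auto simp: lookup_of_fun free_module_carrier_iff)

lemma to_of_fun: "f \<in> carrier (Free b J) \<Longrightarrow> to_fun b (of_fun b f) = f"
  by (rule ext) (auto simp: to_fun_def lookup_of_fun free_module_carrier_iff)

lemma of_fun_add: "f \<in> carrier (Free b J) \<Longrightarrow> g \<in> carrier (Free b J) \<Longrightarrow>
    of_fun b (f \<oplus>\<^bsub>Free b J\<^esub> g) = of_fun b f + of_fun b g"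
proof (rule poly_mapping_eqI)
  fix j assume fg: "f \<in> carrier (Free b J)" "g \<in> carrier (Free b J)"
  interpret F: Module.module Rng "Free b J" by (rule module_free_module)
  show "lookup (of_fun b (f \<oplus>\<^bsub>Free b J\<^esub> g)) j = lookup (of_fun b f + of_fun b g) j"
    using fg lookup_of_fun[OF F.a_closed[OF fg]] by (simp add: lookup_add lookup_of_fun free_module_simps)
qed

lemma of_fun_smult: "r \<in> carrier Rng \<Longrightarrow> f \<in> carrier (Free b J) \<Longrightarrow>
    of_fun b (r \<odot>\<^bsub>Free b J\<^esub> f) = scal r (of_fun b f)"
proof (rule poly_mapping_eqI)
  fix j assume rf: "r \<in> carrier Rng" "f \<in> carrier (Free b J)"
  interpret F: Module.module Rng "Free b J" by (rule module_free_module)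
  show "lookup (of_fun b (r \<odot>\<^bsub>Free b J\<^esub> f)) j = lookup (scal r (of_fun b f)) j"
    using rf lookup_of_fun[OF F.smult_closed[OF rf]] by (simp add: lookup_of_fun free_module_simps)
qed

lemma to_fun_add: "to_fun b (c + c') = to_fun b c \<oplus>\<^bsub>Free b J\<^esub> to_fun b c'"
  by (rule ext) (simp add: to_fun_def free_module_simps lookup_add)

lemma to_fun_scal: "to_fun b (scal r c) = r \<odot>\<^bsub>Free b J\<^esub> to_fun b c"
  by (rule ext) (simp add: to_fun_def free_module_simps)

lemma to_fun_zero: "to_fun b 0 = \<zero>\<^bsub>Free b J\<^esub>"
  by (rule ext) (simp add: to_fun_def free_module_simps)

text \<open>The free modules are those of the presentation. The augmentation reads the value of the first cover at
position \<open>0\<close>, where the ring is placed, and takes its coset.\<close>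

lemma resolution_of_pd_le:
  fixes b :: 'b
  assumes "pd_le d (single 0 ` carrier Rng) (single 0 ` I)"
  shows "\<exists>(P :: nat \<Rightarrow> (('v, 'k) mpoly, 'b \<times> nat \<Rightarrow> ('v, 'k) mpoly) module) D \<epsilon>. projective_resolution Rng Quo P D \<epsilon> \<and>
    (\<forall>i>d. carrier (P i) = {\<zero>\<^bsub>P i\<^esub>})"
proof -
  have subI: "submod (single 0 ` I)"
    by (rule submod_single) (use I.zero_closed I.a_closed I.I_l_closed in simp_all)
  obtain J y where res: "\<forall>i>d. J i = {}" "\<forall>j\<in>J 0. y 0 j \<in> single 0 ` carrier Rng"
    "\<forall>u\<in>single 0 ` carrier Rng.
      \<exists>c\<in>free_on (J 0). u - lincomb (y 0) c \<in> single 0 ` I"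
    "lincomb (y 1) ` free_on (J 1) = {c \<in> free_on (J 0). lincomb (y 0) c \<in> single 0 ` I}"
    "\<forall>i. lincomb (y (Suc (Suc i))) ` free_on (J (Suc (Suc i))) =
      {c \<in> free_on (J (Suc i)). lincomb (y (Suc i)) c = 0}"
    using pd_le_resolution[OF assms subI] by (elim exE conjE) (rule that)
  note J0 = res(1)[rule_format] and y0 = res(2)[rule_format] and onto = res(3)[rule_format]
    and ex0 = res(4) and ex = res(5)[rule_format]
  define P where "P i = Free b (J i)" for i
  define D where "D i f = to_fun b (lincomb (y (Suc i)) (of_fun b f))" for i f
  define aug where "aug c = lookup (lincomb (y 0) c) 0" for c
  define \<epsilon> where "\<epsilon> f = I +>\<^bsub>Rng\<^esub> aug (of_fun b f)" for f
  have P: "of_fun b f \<in> free_on (J i)" "to_fun b (of_fun b f) = f" if "f \<in> carrier (P i)" for f i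
    using that of_fun_free_on to_of_fun by (auto simp: P_def)
  have P': "to_fun b c \<in> carrier (P i)" if "c \<in> free_on (J i)" for c i
    using to_fun_carrier[OF that] by (simp add: P_def)
  have subS: "submod (single 0 ` carrier Rng)"
    by (rule submod_single) (fact zero_in add_in mult_in)+
  have aug: "aug c \<in> carrier Rng" "lincomb (y 0) c = single 0 (aug c)" if "c \<in> free_on (J 0)" for c
  proof -
    have "lincomb (y 0) c \<in> single 0 ` carrier Rng"
      by (rule lincomb_in[OF subS _ that]) (rule y0)
    then obtain p where "p \<in> carrier Rng" "lincomb (y 0) c = single 0 p" by blast
    then show "aug c \<in> carrier Rng" "lincomb (y 0) c = single 0 (aug c)"
      by (simp_all add: aug_def)
  qed
  have img: "lincomb (y (Suc i)) ` free_on (J (Suc i)) \<subseteq> free_on (J i)" for i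
    using ex0 ex by (cases i) auto
  have D: "D i \<in> module_hom Rng (P (Suc i)) (P i)" for i
  proof (rule module_homI)
    show "D i x \<in> carrier (P i)" if "x \<in> carrier (P (Suc i))" for x
      unfolding D_def using P(1)[OF that] img by (intro P') blast
  qed (simp_all add: D_def P_def of_fun_add of_fun_smult lincomb_add lincomb_scal to_fun_add to_fun_scal)
  have \<epsilon>: "\<epsilon> \<in> module_hom Rng (P 0) Quo"
  proof (rule module_homI)
    fix f g assume fg: "f \<in> carrier (P 0)" "g \<in> carrier (P 0)"
    show "\<epsilon> f \<in> carrier Quo" using aug(1)[OF P(1)[OF fg(1)]] by (auto simp: \<epsilon>_def quotient_carrier)
    have "aug (of_fun b (f \<oplus>\<^bsub>P 0\<^esub> g)) = aug (of_fun b f) + aug (of_fun b g)"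
      using fg by (simp add: aug_def P_def of_fun_add lincomb_add lookup_add)
    then show "\<epsilon> (f \<oplus>\<^bsub>P 0\<^esub> g) = \<epsilon> f \<oplus>\<^bsub>Quo\<^esub> \<epsilon> g"
      using aug(1)[OF P(1)[OF fg(1)]] aug(1)[OF P(1)[OF fg(2)]] by (simp add: \<epsilon>_def quotient_add)
  next
    fix r f assume rf: "r \<in> carrier Rng" "f \<in> carrier (P 0)"
    have "aug (of_fun b (r \<odot>\<^bsub>P 0\<^esub> f)) = r * aug (of_fun b f)"
      using rf by (simp add: aug_def P_def of_fun_smult lincomb_scal)
    then show "\<epsilon> (r \<odot>\<^bsub>P 0\<^esub> f) = r \<odot>\<^bsub>Quo\<^esub> \<epsilon> f"
      using rf aug(1)[OF P(1)[OF rf(2)]] by (simp add: \<epsilon>_def quotient_smult)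
  qed
  have \<epsilon>_onto: "\<epsilon> ` carrier (P 0) = carrier Quo"
  proof (intro equalityI subsetI)
    fix X assume "X \<in> carrier Quo"
    then obtain p where p: "p \<in> carrier Rng" "X = I +>\<^bsub>Rng\<^esub> p" by (auto simp: quotient_carrier)
    then obtain c where c: "c \<in> free_on (J 0)"
      "single 0 p - lincomb (y 0) c \<in> single 0 ` I"
      using onto[of "single 0 p"] by blast
    from c(2) obtain q where q: "q \<in> I" "single 0 p - lincomb (y 0) c = single 0 q" by blast
    have "p - aug c = q" using arg_cong[OF q(2), of "\<lambda>x. lookup x 0"] by (simp add: aug_def lookup_minus)
    then have p': "p = aug c + q" by (simp add: algebra_simps)
    have "I +>\<^bsub>Rng\<^esub> p = (I +>\<^bsub>Rng\<^esub> aug c) \<oplus>\<^bsub>Quo\<^esub> (I +>\<^bsub>Rng\<^esub> q)"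
      unfolding p' using aug(1)[OF c(1)] I.a_Hcarr[OF q(1)] by (simp add: quotient_add)
    also have "I +>\<^bsub>Rng\<^esub> q = I +>\<^bsub>Rng\<^esub> 0"
      using I.a_rcos_const[OF q(1)] I.a_rcos_const[OF I.zero_closed] by simp
    also have "(I +>\<^bsub>Rng\<^esub> aug c) \<oplus>\<^bsub>Quo\<^esub> (I +>\<^bsub>Rng\<^esub> 0) = I +>\<^bsub>Rng\<^esub> aug c"
      using aug(1)[OF c(1)] zero_in by (simp add: quotient_add)
    finally have "X = \<epsilon> (to_fun b c)" using p(2) by (simp add: \<epsilon>_def of_to_fun)
    then show "X \<in> \<epsilon> ` carrier (P 0)" using P'[OF c(1)] by blast
  qed (use module_homD(1)[OF \<epsilon>] in blast)
  have \<epsilon>_zero: "\<epsilon> f = \<zero>\<^bsub>Quo\<^esub> \<longleftrightarrow> lincomb (y 0) (of_fun b f) \<in> single 0 ` I"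
    if "f \<in> carrier (P 0)" for f
    using aug[OF P(1)[OF that]] coset_eq_I_iff
    by (simp add: \<epsilon>_def quotient_module_simps inj_image_mem_iff[OF inj_single])
  have exact_at: "D i ` carrier (P (Suc i)) = {f \<in> carrier (P i). of_fun b f \<in> lincomb (y (Suc i)) ` free_on (J (Suc i))}" for i
  proof (intro equalityI subsetI)
    fix g assume "g \<in> D i ` carrier (P (Suc i))"
    then obtain f where f: "f \<in> carrier (P (Suc i))" "g = D i f" by blast
    then show "g \<in> {f \<in> carrier (P i). of_fun b f \<in> lincomb (y (Suc i)) ` free_on (J (Suc i))}"
      using module_homD(1)[OF D f(1)] P(1)[OF f(1)] by (simp add: D_def of_to_fun)
  next
    fix g assume "g \<in> {f \<in> carrier (P i). of_fun b f \<in> lincomb (y (Suc i)) ` free_on (J (Suc i))}"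
    then obtain c where c: "g \<in> carrier (P i)" "c \<in> free_on (J (Suc i))" "of_fun b g = lincomb (y (Suc i)) c" by blast
    have "D i (to_fun b c) = g" using P(2)[OF c(1)] c(3) by (simp add: D_def of_to_fun)
    then show "g \<in> D i ` carrier (P (Suc i))" using P'[OF c(2)] by blast
  qed
  have D_zero: "D i f = \<zero>\<^bsub>P i\<^esub> \<longleftrightarrow> lincomb (y (Suc i)) (of_fun b f) = 0" for i f
    unfolding D_def P_def using to_fun_zero[of b "J i"] of_to_fun by metis
  have "D 0 ` carrier (P 1) = a_kernel (P 0) Quo \<epsilon>"
  proof (rule Set.set_eqI)
    fix f
    show "f \<in> D 0 ` carrier (P 1) \<longleftrightarrow> f \<in> a_kernel (P 0) Quo \<epsilon>"
      unfolding a_kernel_def' One_nat_def exact_at ex0[unfolded One_nat_def]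
      using P(1)[of f 0] \<epsilon>_zero[of f] by blast
  qed
  moreover have "D (Suc i) ` carrier (P (Suc (Suc i))) = a_kernel (P (Suc i)) (P i) (D i)" for i
    unfolding a_kernel_def' exact_at ex D_zero using P(1) by auto
  moreover have "projective_module Rng (P i)" for i
    unfolding P_def by (rule projective_free_module) simp
  ultimately have "projective_resolution Rng Quo P D \<epsilon>"
    unfolding projective_resolution_def using D \<epsilon> \<epsilon>_onto by blast
  moreover have "carrier (P i) = {\<zero>\<^bsub>P i\<^esub>}" if "i > d" for i
  proof -
    have "f = \<zero>\<^bsub>P i\<^esub>" if "f \<in> carrier (P i)" for f
      using that J0[OF \<open>i > d\<close>] by (auto simp: P_def free_module_carrier_iff free_module_simps)
    moreover have "\<zero>\<^bsub>P i\<^esub> \<in> carrier (P i)" by (simp add: P_def free_module_carrier_iff free_module_simps)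
    ultimately show ?thesis by blast
  qed
  ultimately show ?thesis by blast
qed

end

section \<open>The projective dimension of the toric ring\<close>

context ladder_algebra
begin

lemma ideal_G: "ideal (G k) (mpoly_ring edges)"
proof -
  let ?R = "mpoly_ring edges :: ((nat, 'k) mpoly) ring"
  interpret cring ?R by (rule cring_mpoly_ring)
  note D = is_idealD[OF is_ideal_G[of k]]
  show ?thesis
  proof (rule idealI)
    show "subgroup (G k) (add_monoid ?R)"
    proof (rule add.subgroupI)
      show "G k \<subseteq> carrier ?R" using D(1) by blast
      show "G k \<noteq> {}" using D(2) by blast
      show "\<ominus>\<^bsub>?R\<^esub> p \<in> G k" if "p \<in> G k" for p
        using D(1,5)[OF that] by (simp add: mpoly_ring_a_inv)
      show "p \<oplus>\<^bsub>?R\<^esub> q \<in> G k" if "p \<in> G k" "q \<in> G k" for p q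
        using D(3)[OF that] by simp
    qed
  next
    fix p q assume pq: "p \<in> G k" "q \<in> carrier ?R"
    show "q \<otimes>\<^bsub>?R\<^esub> p \<in> G k" using D(4)[OF pq(2,1)] by simp
    then show "p \<otimes>\<^bsub>?R\<^esub> q \<in> G k" by (simp add: mult.commute)
  qed (rule ring_axioms)
qed

lemma mpoly_ideal_G: "mpoly_ideal edges (G k)"
  by (rule mpoly_ideal.intro) (rule ideal_G)

lemma one_notin_G: "k \<le> K \<Longrightarrow> 1 \<notin> G k"
proof
  assume "k \<le> K" "1 \<in> G k"
  moreover have "mpoly_var 0 \<in> S" by (rule var_in_S) simp_all
  ultimately have "mpoly_var 0 * 1 \<in> G k" by (intro is_idealD(4)[OF is_ideal_G])
  then show False using var_notin_G[OF \<open>k \<le> K\<close> \<open>mpoly_var 0 \<in> S\<close>] by simp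
qed

lemma resolution_exists:
  fixes b :: 'b
  shows "\<exists>(P :: nat \<Rightarrow> ((nat, 'k) mpoly, 'b \<times> nat \<Rightarrow> (nat, 'k) mpoly) module) D \<epsilon>.
    projective_resolution (mpoly_ring edges) (quotient_module (mpoly_ring edges) (G K)) P D \<epsilon> \<and>
    (\<forall>i>K. carrier (P i) = {\<zero>\<^bsub>P i\<^esub>})"
  using mpoly_ideal.resolution_of_pd_le[OF mpoly_ideal_G] pd_G[OF order_refl] unfolding ideal_pd_le_def by blast

text \<open>The toric ring is not zero and is annihilated by the regular sequence of the minors \<open>f\<close>.\<close>

lemma resolution_long:
  assumes "projective_resolution (mpoly_ring edges) (quotient_module (mpoly_ring edges) (G K)) P D \<epsilon>"
    and "1 \<le> K" and short: "carrier (P K) = {\<zero>\<^bsub>P K\<^esub>}"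
  shows False
proof -
  let ?R = "mpoly_ring edges :: ((nat, 'k) mpoly) ring"
  let ?M = "quotient_module ?R (G K)"
  interpret R: cring ?R by (rule cring_mpoly_ring)
  interpret projective_resolution_of ?R ?M P D \<epsilon> by unfold_locales (rule assms(1))
  note quotient = mpoly_ideal.quotient_carrier[OF mpoly_ideal_G] mpoly_ideal.quotient_smult[OF mpoly_ideal_G]
    mpoly_ideal.coset_eq_I_iff[OF mpoly_ideal_G] mpoly_ideal.quotient_module_simps(2)[OF mpoly_ideal_G]
  have "carrier ?M = {\<zero>\<^bsub>?M\<^esub>}"
  proof (rule zero_if_short_resolution[of f_sequence "K - 1"])
    show "f_sequence j \<in> carrier ?R" for j by (rule f_sequence_in_S)
    show "s \<in> sequence_ideal ?R f_sequence j"
      if "j \<le> K - 1" "s \<in> carrier ?R" "f_sequence j \<otimes>\<^bsub>?R\<^esub> s \<in> sequence_ideal ?R f_sequence j" for j s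
      using f_sequence_regular[of j s] that assms(2) by simp
    show "f_sequence j \<odot>\<^bsub>?M\<^esub> x = \<zero>\<^bsub>?M\<^esub>" if j: "j \<le> K - 1" and x: "x \<in> carrier ?M" for j x
    proof -
      obtain p where p: "p \<in> carrier ?R" "x = G K +>\<^bsub>?R\<^esub> p" using x by (auto simp: quotient)
      have jK: "j < K" using j assms(2) by linarith
      then have "f_sequence j * p \<in> G (Suc j)"
        using gen_in_G(1)[of "Suc j" p] p(1) by (simp add: f_sequence_def)
      then have "f_sequence j * p \<in> G K" using G_mono[of "Suc j" K] jK by auto
      then show ?thesis
        using p f_sequence_in_S[of j] S_closed(4)[OF f_sequence_in_S p(1)] by (simp add: quotient)
    qed
    show "carrier (P (Suc (K - 1))) = {\<zero>\<^bsub>P (Suc (K - 1))\<^esub>}" using short assms(2) by simp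
  qed
  moreover have "G K +>\<^bsub>?R\<^esub> 1 \<in> carrier ?M" using S_closed(2) by (auto simp: quotient)
  ultimately have "G K +>\<^bsub>?R\<^esub> 1 = G K" by (simp add: quotient)
  then have "1 \<in> G K" using S_closed(2) by (simp add: quotient)
  then show False using one_notin_G by blast
qed

theorem projective_dimension_quotient:
  assumes "1 \<le> K"
  shows "projective_dimension (mpoly_ring edges) (quotient_module (mpoly_ring edges) (G K)) = enat K"
proof -
  let ?R = "mpoly_ring edges :: ((nat, 'k) mpoly) ring"
  let ?M = "quotient_module ?R (G K)"
  let ?lengths = "{enat m |m. \<exists>(P :: nat \<Rightarrow> ((nat, 'k) mpoly, ((nat, 'k) mpoly) set \<times> nat \<Rightarrow> (nat, 'k) mpoly) module) D \<epsilon>.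
    projective_resolution ?R ?M P D \<epsilon> \<and> (\<forall>i>m. carrier (P i) = {\<zero>\<^bsub>P i\<^esub>})}"
  have "enat K \<in> ?lengths" using resolution_exists by blast
  moreover have "enat K \<le> l" if "l \<in> ?lengths" for l
  proof -
    from that obtain m and P :: "nat \<Rightarrow> ((nat, 'k) mpoly, ((nat, 'k) mpoly) set \<times> nat \<Rightarrow> (nat, 'k) mpoly) module" and D \<epsilon> where m: "l = enat m"
      "projective_resolution ?R ?M P D \<epsilon>" "\<forall>i>m. carrier (P i) = {\<zero>\<^bsub>P i\<^esub>}" by blast
    have "\<not> m < K" using resolution_long[OF m(2) assms] m(3) by blast
    then show ?thesis using m(1) by simp
  qed
  ultimately show ?thesis
    unfolding projective_dimension_def by (intro antisym Inf_lower Inf_greatest)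
qed

end

theorem corollary1p2:
  fixes n :: nat and t :: "bit list"
  assumes "length t = n + 1"
  shows "projective_dimension
           (ladder_poly_ring n :: ((nat \<Rightarrow>\<^sub>0 nat) \<Rightarrow>\<^sub>0 'k::field) ring)
           (ladder_toric_ring n t) = enat (n + 1)"
proof -
  interpret ladder_sequence "ladder_a t" "ladder_z t" "ladder_v t"
    by (rule ladder_sequence_of_bits)
  interpret ladder_algebra "ladder_a t" "ladder_z t" "ladder_v t" "n + 1" "TYPE('k)" ..
  have "is_ladder_array n (ladder n (take (Suc n) t))"
    using assms by (intro is_ladder_array_ladder ladder_v_bits) simp_all
  then have "is_ladder_array n (ladder n t)" using assms by simp
  then have "ladder_toric_ideal n t = G (n + 1)" by (intro toric_ideal_eq_G refl)
  moreover have "(ladder_poly_ring n :: ((nat \<Rightarrow>\<^sub>0 nat) \<Rightarrow>\<^sub>0 'k) ring) = mpoly_ring edges"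
    unfolding ladder_poly_ring_def edges_eq[OF refl] by (rule refl)
  ultimately show ?thesis
    unfolding ladder_toric_ring_def using projective_dimension_quotient by simp
qed

end
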